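(* Let $k,n$ be positive integers with $k+2\le n$ and let $Z\in\mathrm{Mat}^{>0}_{n,k+2}$. Then $$\mathcal A_{n,k,2}(Z)=\bigcup_{w\in D_{k+1,n}}\hat\Delta_w(Z).$$
   Context: $\mathrm{Gr}_{k,n}$ is the Grassmannian of $k$-planes in $\mathbb R^n$ (row spans of full-rank $k\times n$ matrices); $\mathrm{Gr}^{\ge0}_{k,n}$ is the set of points having a representative with all maximal minors $\ge0$. $\mathrm{Mat}^{>0}_{n,k+2}$ is the set of real $n\times(k+2)$ matrices with all maximal minors positive; $Z$ has rows $Z_1,\dots,Z_n$ and induces $\tilde Z:\mathrm{Gr}^{\ge0}_{k,n}\to\mathrm{Gr}_{k,k+2}$, $C\mapsto CZ$, with image the amplituhedron $\mathcal A_{n,k,2}(Z)$. For $Y\in\mathrm{Gr}_{k,k+2}$ with representative rows $y_1,\dots,y_k$, $\langle Yij\rangle=\det(y_1,\dots,y_k,Z_i,Z_j)$ (up to a common nonzero scalar), and $\langle Yi\hat j\rangle:=(-1)^{k+1}\langle Yij\rangle$ (i.e. $Z_j$ replaced by $\hat Z_j=(-1)^{k+1}Z_j$). For $v\in\mathbb R^n$, $\mathrm{Flip}(v)\subseteq[n]$ is the set of $i$ such that $v_i,v_{i+1}\ne0$ have different signs (indices mod $n$). For $w\in S_n$, a letter $i\in[n]$ is a cyclic left descent of $w$ if either $i\ge2$ and $i$ occurs to the left of $i-1$ in the one-line notation of $w$, or $i=1$ and $1$ occurs to the left of $n$. $\mathrm{cDes}_L(w)$ is the set of cyclic left descents. $D_{k+1,n}$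 is the set of $w\in S_n$ with $w_n=n$ and exactly $k+1$ cyclic left descents. For $w\in D_{k+1,n}$, $w^{(a)}$ denotes the cyclic rotation of the word $w$ ending at $a$, and $I_r=I_r(w):=\mathrm{cDes}_L(w^{(r-1)})$ for $r=1,\dots,n$ (with $w^{(0)}=w^{(n)}=w$). The open amplituhedron $w$-chamber $\hat\Delta_w^\circ(Z)$ is the set of $Y\in\mathcal A_{n,k,2}(Z)$ such that $\langle Yij\rangle\ne0$ for all $i\neq j$ and, for $a=1,\dots,n$, $$\mathrm{Flip}(\langle Ya\hat1\rangle,\langle Ya\hat2\rangle,\dots,\langle Ya\,\widehat{a-1}\rangle,\langle Yaa\rangle,\langle Ya\,a{+}1\rangle,\dots,\langle Yan\rangle)=I_a\setminus\{a\}.$$ The closed $w$-chamber $\hat\Delta_w(Z)$ is the closure of $\hat\Delta_w^\circ(Z)$ (it may be empty). *)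

theory Defs
  imports
    "HOL-Analysis.Function_Topology"
    "HOL-Combinatorics.Multiset_Permutations"
    "Jordan_Normal_Form.DL_Rank"
    "Jordan_Normal_Form.DL_Submatrix"
begin

section \<open>Grassmannians\<close>

definition full_rank_mats :: "nat \<Rightarrow> nat \<Rightarrow> real mat set" where
  "full_rank_mats k n = {C \<in> carrier_mat k n. vec_space.rank k C = k}"

text \<open>A point of the Grassmannian is a subspace of \<open>carrier_vec n\<close>, given as a set of row vectors.\<close>

definition rowspan :: "nat \<Rightarrow> real mat \<Rightarrow> real vec set" where
  "rowspan n C = vec_space.row_space n C"

definition grassmannian :: "nat \<Rightarrow> nat \<Rightarrow> real vec set set" where
  "grassmannian k n = rowspan n ` full_rank_mats k n"

definition full_rank_topology :: "nat \<Rightarrow> nat \<Rightarrow> real mat topology" where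
  "full_rank_topology k n =
     pullback_topology (full_rank_mats k n)
       (\<lambda>C. restrict (\<lambda>ij. C $$ ij) ({..<k} \<times> {..<n}))
       (product_topology (\<lambda>_. euclideanreal) ({..<k} \<times> {..<n}))"

text \<open>The usual topology of the Grassmannian: the quotient topology along \<open>rowspan\<close>,
  where matrices carry the topology of \<open>\<real>\<^bsup>k n\<^esup>\<close>.\<close>

definition grassmannian_topology :: "nat \<Rightarrow> nat \<Rightarrow> real vec set topology" where
  "grassmannian_topology k n =
     topology (\<lambda>U. U \<subseteq> grassmannian k n \<and>
       openin (full_rank_topology k n) {C \<in> full_rank_mats k n. rowspan n C \<in> U})"

lemma topspace_full_rank_topology: "topspace (full_rank_topology k n) = full_rank_mats k n"
  by (auto simp: full_rank_topology_def topspace_pullback_topology)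

lemma openin_grassmannian_topology:
  "openin (grassmannian_topology k n) U \<longleftrightarrow>
     U \<subseteq> grassmannian k n \<and>
     openin (full_rank_topology k n) {C \<in> full_rank_mats k n. rowspan n C \<in> U}"
proof -
  let ?P = "\<lambda>U. {C \<in> full_rank_mats k n. rowspan n C \<in> U}"
  have "istopology (\<lambda>U. U \<subseteq> grassmannian k n \<and> openin (full_rank_topology k n) (?P U))"
    unfolding istopology_def
  proof (intro conjI allI impI; (elim conjE)?)
    fix S T
    assume "openin (full_rank_topology k n) (?P S)" "openin (full_rank_topology k n) (?P T)"
    moreover have "?P (S \<inter> T) = ?P S \<inter> ?P T" by auto
    ultimately show "openin (full_rank_topology k n) (?P (S \<inter> T))" by auto
  next
    fix \<K>
    assume *: "\<forall>K\<in>\<K>. K \<subseteq> grassmannian k n \<and> openin (full_rank_topology k n) (?P K)"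
    have "?P (\<Union>\<K>) = \<Union>(?P ` \<K>)" by auto
    then show "openin (full_rank_topology k n) (?P (\<Union>\<K>))" using * by auto
  qed auto
  then show ?thesis by (simp add: grassmannian_topology_def)
qed

lemma topspace_grassmannian_topology:
  "topspace (grassmannian_topology k n) = grassmannian k n"
proof -
  have "{C \<in> full_rank_mats k n. rowspan n C \<in> grassmannian k n}
      = topspace (full_rank_topology k n)"
    by (auto simp: topspace_full_rank_topology grassmannian_def)
  then have "openin (grassmannian_topology k n) (grassmannian k n)"
    by (simp only: openin_grassmannian_topology openin_topspace subset_refl)
  then show ?thesis
    by (meson openin_grassmannian_topology openin_subset openin_topspace subset_antisym)
qed

lemma quotient_map_rowspan:
  "quotient_map (full_rank_topology k n) (grassmannian_topology k n) (rowspan n)"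
  by (auto simp: quotient_map_def topspace_full_rank_topology topspace_grassmannian_topology
      openin_grassmannian_topology grassmannian_def)


section \<open>The amplituhedron\<close>

definition nonneg_grassmannian :: "nat \<Rightarrow> nat \<Rightarrow> real vec set set" where
  "nonneg_grassmannian k n =
     {V. \<exists>C \<in> full_rank_mats k n. rowspan n C = V \<and>
           (\<forall>J \<subseteq> {..<n}. card J = k \<longrightarrow> det (submatrix C UNIV J) \<ge> 0)}"

definition pos_mats :: "nat \<Rightarrow> nat \<Rightarrow> real mat set" where
  "pos_mats n p =
     {Z \<in> carrier_mat n p. \<forall>I \<subseteq> {..<n}. card I = p \<longrightarrow> det (submatrix Z I UNIV) > 0}"

text \<open>The image of the nonnegative Grassmannian under \<open>C \<mapsto> C Z\<close>. The row span of \<open>C Z\<close>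
  depends only on that of \<open>C\<close>, so \<open>C\<close> may range over all representatives.\<close>

definition amplituhedron :: "nat \<Rightarrow> nat \<Rightarrow> real mat \<Rightarrow> real vec set set" where
  "amplituhedron n k Z =
     {rowspan (k + 2) (C * Z) | C.
        C \<in> full_rank_mats k n \<and> rowspan n C \<in> nonneg_grassmannian k n}"

text \<open>Here \<open>y\<close> is a matrix representing \<open>Y\<close>. The indices \<open>i, j\<close> run through \<open>1, \<dots>, n\<close>,
  whereas rows of a matrix are numbered from \<open>0\<close>.\<close>

definition twistor :: "nat \<Rightarrow> real mat \<Rightarrow> real mat \<Rightarrow> nat \<Rightarrow> nat \<Rightarrow> real" where
  "twistor k Z y i j = det (mat_of_rows (k + 2) (rows y @ [row Z (i - 1), row Z (j - 1)]))"

definition twistor_hat :: "nat \<Rightarrow> real mat \<Rightarrow> real mat \<Rightarrow> nat \<Rightarrow> nat \<Rightarrow> real" where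
  "twistor_hat k Z y i j = (-1) ^ (k + 1) * twistor k Z y i j"


section \<open>Sign flips and cyclic descents\<close>

text \<open>Vectors in \<open>\<real>\<^sup>n\<close> are functions read on \<open>{1..n}\<close>; \<open>i mod n + 1\<close> is the cyclic
  successor of \<open>i\<close> in \<open>{1..n}\<close>.\<close>

definition Flip :: "nat \<Rightarrow> (nat \<Rightarrow> real) \<Rightarrow> nat set" where
  "Flip n v = {i \<in> {1..n}. v i \<noteq> 0 \<and> v (i mod n + 1) \<noteq> 0 \<and> sgn (v i) \<noteq> sgn (v (i mod n + 1))}"

definition left_of :: "nat list \<Rightarrow> nat \<Rightarrow> nat \<Rightarrow> bool" where
  "left_of w i j \<longleftrightarrow> (\<exists>p q. p < q \<and> q < length w \<and> w ! p = i \<and> w ! q = j)"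

text \<open>A permutation in \<open>S\<^sub>n\<close> is given in one-line notation, as a list enumerating \<open>{1..n}\<close>.\<close>

definition cDes_L :: "nat \<Rightarrow> nat list \<Rightarrow> nat set" where
  "cDes_L n w = {i \<in> {1..n}. (i \<ge> 2 \<and> left_of w i (i - 1)) \<or> (i = 1 \<and> left_of w 1 n)}"

text \<open>\<open>D_perms m n\<close> is \<open>D\<^bsub>m,n\<^esub>\<close>.\<close>

definition D_perms :: "nat \<Rightarrow> nat \<Rightarrow> nat list set" where
  "D_perms m n = {w \<in> permutations_of_set {1..n}. w ! (n - 1) = n \<and> card (cDes_L n w) = m}"

definition rot_to_end :: "nat list \<Rightarrow> nat \<Rightarrow> nat list" where
  "rot_to_end w a = rotate (Suc (length (takeWhile (\<lambda>x. x \<noteq> a) w))) w"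

lemma last_rot_to_end:
  assumes "a \<in> set w"
  shows "last (rot_to_end w a) = a"
proof -
  obtain xs ys where w: "w = xs @ a # ys" "a \<notin> set xs"
    using split_list_first[OF assms] by blast
  have "takeWhile (\<lambda>x. x \<noteq> a) w = xs"
    using w by (auto simp: takeWhile_append2 takeWhile_tail)
  then have "rot_to_end w a = rotate (length (xs @ [a])) ((xs @ [a]) @ ys)"
    using w by (simp add: rot_to_end_def)
  also have "\<dots> = ys @ xs @ [a]"
    by (subst rotate_append) simp
  finally show ?thesis by simp
qed

text \<open>The index \<open>r - 1\<close> is cyclic: \<open>w\<^bsup>(0)\<^esup> = w\<^bsup>(n)\<^esup>\<close>.\<close>

definition I_set :: "nat \<Rightarrow> nat list \<Rightarrow> nat \<Rightarrow> nat set" where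
  "I_set n w r = cDes_L n (rot_to_end w (if r = 1 then n else r - 1))"


section \<open>Amplituhedron chambers\<close>

text \<open>All twistor coordinates of \<open>Y\<close> are taken with respect to one representative \<open>y\<close>; another
  representative rescales them by a common nonzero factor, which affects none of the conditions.\<close>

definition open_chamber :: "nat \<Rightarrow> nat \<Rightarrow> real mat \<Rightarrow> nat list \<Rightarrow> real vec set set" where
  "open_chamber n k Z w =
     {Y \<in> amplituhedron n k Z.
        \<exists>y \<in> full_rank_mats k (k + 2). rowspan (k + 2) y = Y \<and>
          (\<forall>i \<in> {1..n}. \<forall>j \<in> {1..n}. i \<noteq> j \<longrightarrow> twistor k Z y i j \<noteq> 0) \<and>
          (\<forall>a \<in> {1..n}.
             Flip n (\<lambda>j. if j < a then twistor_hat k Z y a j else twistor k Z y a j)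
               = I_set n w a - {a})}"

definition closed_chamber :: "nat \<Rightarrow> nat \<Rightarrow> real mat \<Rightarrow> nat list \<Rightarrow> real vec set set" where
  "closed_chamber n k Z w = grassmannian_topology k (k + 2) closure_of open_chamber n k Z w"

end

theory Submission
  imports Defs "HOL-Analysis.Elementary_Metric_Spaces"
begin

text \<open>For \<open>Y = C Z\<close> with \<open>C\<close> positive, the rows of \<open>Z\<close> become \<open>n\<close> vectors \<open>z\<^sub>1, \<dots>, z\<^sub>n\<close> in the plane
\<open>\<real>\<^bsup>k+2\<^esup> / Y\<close>, and \<open>\<langle>Yij\<rangle>\<close> is the area of the parallelogram on \<open>z\<^sub>i\<close> and \<open>z\<^sub>j\<close>. If no two of these vectors
are parallel, they span \<open>n\<close> distinct lines, hence \<open>n\<close> cyclically ordered points of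
\<open>\<real>P\<^sup>1\<close>. Positivity makes the path through \<open>z\<^sub>1, \<dots>, z\<^sub>n, (-1)\<^bsup>k+1\<^esup> z\<^sub>1\<close> turn always in the
same sense, by less than a half turn at each step, and by \<open>k + 1\<close> half turns in total. Let \<open>w\<close>
list the lines in the order in which a line rotating from line \<open>1\<close> meets them, where line \<open>i + 1\<close> gets the
label \<open>i\<close> and line \<open>1\<close>, with label \<open>n\<close>, comes last. A cyclic left descent of \<open>w\<^bsup>(a-1)\<^esup>\<close> at \<open>i\<close>
says that the step from line \<open>i\<close> to line \<open>i + 1\<close> passes the point just after line \<open>a\<close>; away from
\<open>i = a\<close> this is exactly a sign change of \<open>\<langle>Yaj\<rangle>\<close> between \<open>j = i\<close> and \<open>j = i + 1\<close>. The number of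
descents of \<open>w\<close> is the number \<open>k + 1\<close> of half turns. So every such \<open>Y\<close> lies in an open chamber
(\<open>chamber_word_exists\<close>, \<open>generic_in_open_chamber\<close>).

The signs come from two facts about vectors \<open>M\<^sub>1, \<dots>, M\<^sub>n\<close> in \<open>\<real>\<^sup>p\<close> with positive maximal minors,
in the spirit of Gantmakher and Krein: a nonzero linear relation among the \<open>M\<^sub>i\<close> has at least
\<open>p\<close> sign changes (\<open>kernel_alternates\<close>), and the values at the \<open>M\<^sub>i\<close> of a nonzero linear form
have at most \<open>p - 1\<close> sign changes, even if zeros may be given any sign
(\<open>range_not_weakly_alternates\<close>). For fixed \<open>i\<close> the vector \<open>(\<langle>Yij\<rangle>)\<^sub>j\<close> is of both kinds: it is
a relation among the columns of \<open>C\<close> and it is a linear form evaluated at the rows of \<open>Z\<close>. So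
it has at least \<open>k\<close> and at most \<open>k + 1\<close> sign changes, and its zero at \<open>j = i\<close> then forces the
signs used above (\<open>bracket_signs\<close>).

It remains to pass to arbitrary points. There are finitely many chambers, so the union of
the closed ones is the closure of the union of the open ones. Points as above are dense in the
amplituhedron: a nonnegative \<open>C\<close> is a limit of positive ones, because adding a small positive
multiple of a column to an adjacent column preserves nonnegativity (\<open>nonneg_rows_perturb\<close>), and
a positive \<open>C\<close> can be moved off the zero sets of the finitely many polynomials \<open>\<langle>Yij\<rangle>\<close>
(\<open>generic_perturb\<close>). Conversely the amplituhedron is closed (\<open>closedin_amplituhedron\<close>): a point
has a representative \<open>B Z\<close> such that the maximal minors of \<open>B\<close> do not have opposite signs. The
rows of \<open>B\<close> have few sign changes and relations among the rows of \<open>Z\<close> have many, so by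
compactness \<open>B\<close> is bounded in terms of \<open>B Z\<close>. So if a sequence of such matrices \<open>B Z\<close>
converges, then the matrices \<open>B\<close> converge along a subsequence.\<close>

section \<open>Determinants as functions of their rows\<close>

definition rdet :: "nat \<Rightarrow> (nat \<Rightarrow> nat \<Rightarrow> real) \<Rightarrow> real" where
  "rdet p f = det (mat p p (\<lambda>(a, c). f a c))"

lemma rdet_cong:
  assumes "\<And>a c. a < p \<Longrightarrow> c < p \<Longrightarrow> f a c = g a c"
  shows "rdet p f = rdet p g"
proof -
  have "mat p p (\<lambda>(a, c). f a c) = mat p p (\<lambda>(a, c). g a c)"
    using assms by (intro eq_matI) auto
  then show ?thesis by (simp add: rdet_def)
qed

lemma rdet_expand_row:
  assumes "b < p"
  shows "\<exists>h. \<forall>x. rdet p (f(b := x)) = (\<Sum>c<p. h c * x c)"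
proof -
  define A where "A x = mat p p (\<lambda>(a, c). (f(b := x)) a c)" for x :: "nat \<Rightarrow> real"
  have del: "mat_delete (A x) b c = mat_delete (A (\<lambda>_. 0)) b c" for x c
    using assms by (intro eq_matI) (auto simp: A_def mat_delete_def)
  have cof: "cofactor (A x) b c = cofactor (A (\<lambda>_. 0)) b c" for x c
    unfolding cofactor_def del[of x c] ..
  have "rdet p (f(b := x)) = (\<Sum>c<p. cofactor (A (\<lambda>_. 0)) b c * x c)" for x
  proof -
    have "rdet p (f(b := x)) = (\<Sum>c<p. A x $$ (b, c) * cofactor (A x) b c)"
      unfolding rdet_def A_def[symmetric]
      by (rule laplace_expansion_row) (use assms in \<open>auto simp: A_def\<close>)
    also have "\<dots> = (\<Sum>c<p. cofactor (A (\<lambda>_. 0)) b c * x c)"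
    proof (intro sum.cong refl)
      fix c assume "c \<in> {..<p}"
      then have "A x $$ (b, c) = x c" using assms by (simp add: A_def)
      then show "A x $$ (b, c) * cofactor (A x) b c = cofactor (A (\<lambda>_. 0)) b c * x c"
        by (simp add: cof[of x])
    qed
    finally show ?thesis .
  qed
  then show ?thesis by blast
qed

lemma rdet_row_add:
  assumes "b < p"
  shows "rdet p (f(b := \<lambda>c. x c + t * y c)) = rdet p (f(b := x)) + t * rdet p (f(b := y))"
proof -
  obtain h where h: "\<forall>x. rdet p (f(b := x)) = (\<Sum>c<p. h c * x c)"
    using rdet_expand_row[OF assms] by blast
  show ?thesis
    by (simp add: h[rule_format] sum.distrib sum_distrib_left algebra_simps)
qed

lemma rdet_identical_rows:
  assumes "a < p" "b < p" "a \<noteq> b" "\<And>c. c < p \<Longrightarrow> f a c = f b c"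
  shows "rdet p f = 0"
  unfolding rdet_def
  by (rule det_identical_rows[of _ p a b]) (use assms in \<open>auto simp: row_def intro!: eq_vecI\<close>)

text \<open>Cramer's rule without division: \<open>p + 1\<close> vectors in \<open>\<real>\<^sup>p\<close> satisfy the linear relation whose
coefficients are their signed maximal minors. The left side is the expansion, along its first
column, of a determinant with two equal columns.\<close>

lemma rdet_cramer:
  fixes f :: "nat \<Rightarrow> nat \<Rightarrow> real"
  assumes "c < p"
  shows "(\<Sum>j\<le>p. (-1) ^ j * f j c * rdet p (\<lambda>i. f (if i < j then i else Suc i))) = 0"
proof -
  define A where "A = mat (Suc p) (Suc p) (\<lambda>(a, e). if e = 0 then f a c else f a (e - 1))"
  have A: "A \<in> carrier_mat (Suc p) (Suc p)" by (simp add: A_def)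
  have "det A = 0"
    by (rule det_identical_columns[OF A, of 0 "Suc c"])
       (use assms in \<open>auto simp: A_def col_def intro!: eq_vecI\<close>)
  moreover have "det A = (\<Sum>j<Suc p. A $$ (j, 0) * cofactor A j 0)"
    by (rule laplace_expansion_column[OF A]) simp
  moreover have "A $$ (j, 0) * cofactor A j 0
      = (-1) ^ j * f j c * rdet p (\<lambda>i. f (if i < j then i else Suc i))" if "j < Suc p" for j
  proof -
    have "mat_delete A j 0 = mat p p (\<lambda>(a, e). f (if a < j then a else Suc a) e)"
      using that by (intro eq_matI) (auto simp: A_def mat_delete_def)
    then show ?thesis using that by (simp add: cofactor_def rdet_def A_def)
  qed
  ultimately show ?thesis by (simp add: lessThan_Suc_atMost)
qed

lemma rdet_nonzero_rows_independent:
  assumes "rdet p f \<noteq> 0" "\<And>c. c < p \<Longrightarrow> (\<Sum>a<p. x a * f a c) = 0" "a < p"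
  shows "x a = 0"
proof -
  let ?A = "(mat p p (\<lambda>(a, c). f a c))\<^sup>T"
  have A: "?A \<in> carrier_mat p p" by simp
  have "det ?A \<noteq> 0" using assms(1) by (simp add: rdet_def det_transpose[of _ p])
  moreover have "?A *\<^sub>v vec p x = 0\<^sub>v p"
    using assms(2) by (intro eq_vecI) (auto simp: scalar_prod_def mult.commute lessThan_atLeast0)
  ultimately have "vec p x = 0\<^sub>v p"
    using det_0_iff_vec_prod_zero_field[OF A] by (metis vec_carrier)
  then show ?thesis using assms(3) by (metis index_vec index_zero_vec(1))
qed

lemma rdet_nonzero_columns_independent:
  assumes "rdet p f \<noteq> 0" "\<And>a. a < p \<Longrightarrow> (\<Sum>c<p. f a c * x c) = 0" "c < p"
  shows "x c = 0"
proof -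
  have "rdet p (\<lambda>a c. f c a) = rdet p f"
  proof -
    have "mat p p (\<lambda>(a, c). f c a) = (mat p p (\<lambda>(a, c). f a c))\<^sup>T"
      by (intro eq_matI) auto
    then show ?thesis by (simp add: rdet_def det_transpose[of _ p])
  qed
  then show ?thesis
    using rdet_nonzero_rows_independent[of p "\<lambda>a c. f c a" x c] assms by (simp add: mult.commute)
qed

lemma rdet_zero_dependent:
  assumes "rdet p f = 0"
  shows "\<exists>x. (\<exists>a<p. x a \<noteq> 0) \<and> (\<forall>c<p. (\<Sum>a<p. x a * f a c) = 0)"
proof -
  let ?A = "(mat p p (\<lambda>(a, c). f a c))\<^sup>T"
  have A: "?A \<in> carrier_mat p p" by simp
  have "det ?A = 0" using assms(1) by (simp add: rdet_def det_transpose[of _ p])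
  then obtain v where v: "v \<in> carrier_vec p" "v \<noteq> 0\<^sub>v p" "?A *\<^sub>v v = 0\<^sub>v p"
    using det_0_iff_vec_prod_zero_field[OF A] by auto
  have "(\<Sum>a<p. v $ a * f a c) = 0" if "c < p" for c
  proof -
    have "(?A *\<^sub>v v) $ c = (\<Sum>a<p. v $ a * f a c)"
      using that v(1) by (auto simp: scalar_prod_def mult.commute lessThan_atLeast0)
    then show ?thesis using v(3) that by simp
  qed
  moreover have "\<exists>a<p. v $ a \<noteq> 0"
    using v(1,2) by (metis carrier_vecD eq_vecI index_zero_vec(1) index_zero_vec(2))
  ultimately show ?thesis by blast
qed

section \<open>Sign alternation and positive maximal minors\<close>

definition incr :: "nat \<Rightarrow> nat \<Rightarrow> (nat \<Rightarrow> nat) \<Rightarrow> bool" where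
  "incr m n s \<longleftrightarrow> (\<forall>a b. a < b \<longrightarrow> b < m \<longrightarrow> s a < s b) \<and> (\<forall>a<m. s a < n)"

text \<open>A matrix with \<open>n\<close> rows of length \<open>p\<close> is treated as \<open>n\<close> vectors \<open>M 0, \<dots>, M (n - 1)\<close>. A positive matrix \<open>Z\<close>
and the transpose of a positive \<open>C\<close> are then objects of the same kind.\<close>

definition pos_rows :: "nat \<Rightarrow> nat \<Rightarrow> (nat \<Rightarrow> nat \<Rightarrow> real) \<Rightarrow> bool" where
  "pos_rows p n M \<longleftrightarrow> (\<forall>s. incr p n s \<longrightarrow> rdet p (\<lambda>a. M (s a)) > 0)"

text \<open>Alternation at \<open>m\<close> positions is the same as having at least \<open>m - 1\<close> sign changes. The factor \<open>e\<close> leaves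
the sign at the first position free.\<close>

definition alternates :: "nat \<Rightarrow> nat \<Rightarrow> (nat \<Rightarrow> real) \<Rightarrow> bool" where
  "alternates m n v \<longleftrightarrow> (\<exists>s e. incr m n s \<and> (\<forall>a<m. e * (-1) ^ a * v (s a) > 0))"

definition weakly_alternates :: "nat \<Rightarrow> nat \<Rightarrow> (nat \<Rightarrow> real) \<Rightarrow> bool" where
  "weakly_alternates m n v \<longleftrightarrow>
     (\<exists>s e. e \<noteq> 0 \<and> incr m n s \<and> (\<forall>a<m. e * (-1) ^ a * v (s a) \<ge> 0))"

lemma sign_transfer: "e * y > 0 \<Longrightarrow> y * z > 0 \<Longrightarrow> e * z > 0" for e y z :: real
  by (auto simp: zero_less_mult_iff)

lemma incr_less: "incr m n s \<Longrightarrow> a < b \<Longrightarrow> b < m \<Longrightarrow> s a < s b"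
  by (auto simp: incr_def)

lemma incr_bound: "incr m n s \<Longrightarrow> a < m \<Longrightarrow> s a < n"
  by (auto simp: incr_def)

lemma incr_inj: "incr m n s \<Longrightarrow> inj_on s {..<m}"
  by (rule inj_onI) (metis incr_less lessThan_iff linorder_neqE_nat less_irrefl)

lemma incr_mono: "incr m n s \<Longrightarrow> m' \<le> m \<Longrightarrow> incr m' n s"
  by (auto simp: incr_def)

lemma incr_skip: "incr (Suc m) n s \<Longrightarrow> incr m n (\<lambda>a. s (if a < j then a else Suc a))"
  by (auto simp: incr_def)

lemma incr_enumerates:
  assumes "I \<subseteq> {..<n}" "card I = m"
  obtains s where "incr m n s" "s ` {..<m} = I"
proof
  let ?l = "sorted_list_of_set I"
  have fin: "finite I" using assms(1) finite_subset by blast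
  have len: "length ?l = m" using assms(2) by simp
  have set: "set ?l = I" using fin by simp
  have srt: "sorted_wrt (<) ?l" by simp
  show "incr m n ((!) ?l)"
    unfolding incr_def
  proof (intro conjI allI impI)
    fix a b assume "a < b" "b < m"
    then show "?l ! a < ?l ! b" using sorted_wrt_nth_less[OF srt] len by simp
  next
    fix a assume "a < m"
    then have "?l ! a \<in> I" using nth_mem[of a ?l] len set by simp
    then show "?l ! a < n" using assms(1) by auto
  qed
  show "(!) ?l ` {..<m} = I"
    using nth_image[of m ?l] set len by (simp add: lessThan_atLeast0)
qed

text \<open>The relation between \<open>p + 1\<close> of the vectors is alternating, as its coefficients are signed
positive minors.\<close>

lemma circuit:
  assumes "pos_rows p n M" "incr (Suc p) n s"
  obtains D where "\<And>j. j \<le> p \<Longrightarrow> D j > 0"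
    "\<And>c. c < p \<Longrightarrow> (\<Sum>j\<le>p. (-1) ^ j * D j * M (s j) c) = 0"
proof
  let ?D = "\<lambda>j. rdet p (\<lambda>i. M (s (if i < j then i else Suc i)))"
  show "?D j > 0" if "j \<le> p" for j
    using assms(1) incr_skip[OF assms(2), of j] by (auto simp: pos_rows_def)
  show "(\<Sum>j\<le>p. (-1) ^ j * ?D j * M (s j) c) = 0" if "c < p" for c
    using rdet_cramer[OF that, of "\<lambda>i. M (s i)"] by (simp add: mult_ac)
qed

lemma kernel_support_gt:
  assumes pos: "pos_rows p n M" and "p \<le> n"
    and ker: "\<And>c. c < p \<Longrightarrow> (\<Sum>i<n. v i * M i c) = 0" and "i < n" "v i \<noteq> 0"
  shows "p < card {i. i < n \<and> v i \<noteq> 0}"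
proof (rule ccontr)
  let ?S = "{i. i < n \<and> v i \<noteq> 0}"
  assume "\<not> p < card ?S"
  then have "card ?S \<le> p" by simp
  then obtain I where I: "?S \<subseteq> I" "I \<subseteq> {..<n}" "card I = p"
    using exists_subset_between[of ?S p "{..<n}"] assms(2) by auto
  obtain s where s: "incr p n s" "s ` {..<p} = I"
    using incr_enumerates[OF I(2,3)] by blast
  have "(\<Sum>a<p. v (s a) * M (s a) c) = 0" if "c < p" for c
  proof -
    have "(\<Sum>a<p. v (s a) * M (s a) c) = (\<Sum>i\<in>I. v i * M i c)"
      using sum.reindex[OF incr_inj[OF s(1)], of "\<lambda>i. v i * M i c"] s(2) by (simp add: o_def)
    also have "\<dots> = (\<Sum>i<n. v i * M i c)"
      by (rule sum.mono_neutral_left) (use I in auto)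
    finally show ?thesis using ker[OF that] by simp
  qed
  moreover have "rdet p (\<lambda>a. M (s a)) \<noteq> 0"
    using pos s(1) by (auto simp: pos_rows_def dest: spec[of _ s])
  ultimately have "v (s a) = 0" if "a < p" for a
    using rdet_nonzero_rows_independent[of p "\<lambda>a. M (s a)" "\<lambda>a. v (s a)" a] that by simp
  moreover have "i \<in> s ` {..<p}" using assms(4,5) I(1) s(2) by auto
  ultimately show False using assms(5) by auto
qed

text \<open>Every relation is a sum of relations between \<open>p + 1\<close> vectors (circuits) that agree with it in sign, and
these alternate by \<open>circuit\<close>. The induction on the support subtracts one circuit,
scaled so that a coordinate vanishes while no sign is reversed; what remains is either zero
or has smaller support, and an alternation in it is one in \<open>v\<close>.\<close>

theorem kernel_alternates:
  assumes pos: "pos_rows p n M" and pn: "p \<le> n"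
    and ker: "\<And>c. c < p \<Longrightarrow> (\<Sum>i<n. v i * M i c) = 0" and nz: "i < n" "v i \<noteq> 0"
  shows "alternates (Suc p) n v"
  using ker nz
proof (induction "card {i. i < n \<and> v i \<noteq> 0}" arbitrary: v i rule: less_induct)
  case (less v i)
  let ?S = "{i. i < n \<and> v i \<noteq> 0}"
  have "Suc p \<le> card ?S"
    using kernel_support_gt[OF pos pn less.prems] by simp
  then obtain I where I: "I \<subseteq> ?S" "card I = Suc p"
    by (meson obtain_subset_with_card_n)
  then have "I \<subseteq> {..<n}" by auto
  then obtain s where s: "incr (Suc p) n s" "s ` {..<Suc p} = I"
    using incr_enumerates I(2) by blast
  have vs: "v (s j) \<noteq> 0" "s j < n" if "j \<le> p" for j
  proof -
    have "s j \<in> I" using that s(2) by (auto simp: lessThan_Suc_atMost)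
    then show "v (s j) \<noteq> 0" "s j < n" using I(1) by auto
  qed
  obtain D where D: "\<And>j. j \<le> p \<Longrightarrow> D j > 0"
    "\<And>c. c < p \<Longrightarrow> (\<Sum>j\<le>p. (-1) ^ j * D j * M (s j) c) = 0"
    using circuit[OF pos s(1)] by blast
  \<comment> \<open>Scaling the circuit by the ratio that is smallest in absolute value reverses no sign:
    \<open>r j - r m\<close> is zero or has the sign of \<open>r j\<close>.\<close>
  define r where "r j = v (s j) / ((-1) ^ j * D j)" for j
  have r: "v (s j) = r j * ((-1) ^ j * D j)" if "j \<le> p" for j
    using D(1)[OF that] by (simp add: r_def)
  obtain m where m: "m \<le> p" "\<And>j. j \<le> p \<Longrightarrow> \<bar>r m\<bar> \<le> \<bar>r j\<bar>"
  proof -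
    have "finite {..p}" "{..p} \<noteq> {}" by auto
    from ex_min_if_finite[of "(\<lambda>j. \<bar>r j\<bar>) ` {..p}"] obtain y
      where "y \<in> (\<lambda>j. \<bar>r j\<bar>) ` {..p}" "\<not> (\<exists>z\<in>(\<lambda>j. \<bar>r j\<bar>) ` {..p}. z < y)" by auto
    then show ?thesis using that by (auto simp: not_less)
  qed
  define u where "u i = (\<Sum>j\<le>p. if s j = i then (-1) ^ j * D j else 0)" for i
  have us: "u (s j) = (-1) ^ j * D j" if "j \<le> p" for j
  proof -
    have "u (s j) = (\<Sum>j'\<le>p. if j' = j then (-1) ^ j' * D j' else 0)"
      unfolding u_def using incr_inj[OF s(1)] that
      by (intro sum.cong) (auto simp: inj_on_def)
    then show ?thesis using that by simp
  qed
  have u0: "u i = 0" if "i \<notin> I" for i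
    unfolding u_def using that s(2) by (intro sum.neutral) auto
  define v' where "v' i = v i - r m * u i" for i
  have v's: "v' (s j) = (r j - r m) * ((-1) ^ j * D j)" if "j \<le> p" for j
    using that by (simp add: v'_def us r left_diff_distrib)
  have conf: "0 < v' i * v i" if "v' i \<noteq> 0" "i < n" for i
  proof (cases "i \<in> I")
    case True
    then obtain j where j: "j \<le> p" "i = s j"
      using s(2) by (metis imageE lessThan_iff less_Suc_eq_le)
    have "v' i * v i = ((r j - r m) * r j) * ((-1) ^ j * D j)\<^sup>2"
      using j v's[of j] r[of j] by (simp add: power2_eq_square)
    moreover have "(r j - r m) * r j > 0"
    proof -
      have "r j \<noteq> r m" using that j v's[of j] by auto
      then have "(0 < r j \<and> r m < r j) \<or> (r j < 0 \<and> r j < r m)"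
        using m(2)[OF j(1)] by linarith
      then show ?thesis by (auto intro: mult_neg_neg)
    qed
    moreover have "((-1) ^ j * D j)\<^sup>2 > 0" using D(1)[OF j(1)] by simp
    ultimately show ?thesis by simp
  next
    case False
    then have "v' i = v i" by (simp add: v'_def u0)
    then show ?thesis using that by (metis not_real_square_gt_zero)
  qed
  show ?case
  proof (cases "\<exists>i<n. v' i \<noteq> 0")
    \<comment> \<open>Here \<open>v\<close> agrees with a multiple of the circuit on \<open>s\<close>, so it alternates along \<open>s\<close>.\<close>
    case False
    then have "r j = r m" if "j \<le> p" for j
      using v's[OF that] vs(2)[OF that] D(1)[OF that] by auto
    then have "r m * (-1) ^ j * v (s j) = (r m)\<^sup>2 * D j" if "j \<le> p" for j
      using r[OF that] that by (simp add: power2_eq_square mult_ac flip: power_mult_distrib)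
    moreover have "r m \<noteq> 0" using vs(1)[OF m(1)] r[OF m(1)] by auto
    ultimately have "r m * (-1) ^ j * v (s j) > 0" if "j < Suc p" for j
      using D(1)[of j] that by simp
    then show ?thesis using s(1) by (auto simp: alternates_def)
  next
    case True
    then obtain i' where i': "i' < n" "v' i' \<noteq> 0" by blast
    let ?S' = "{i. i < n \<and> v' i \<noteq> 0}"
    have "?S' \<subseteq> ?S" using conf by fastforce
    moreover have "s m \<in> ?S" "s m \<notin> ?S'" using vs[OF m(1)] v's[OF m(1)] by auto
    ultimately have "?S' \<subset> ?S" by blast
    then have "card ?S' < card ?S" by (intro psubset_card_mono) auto
    moreover have "(\<Sum>i<n. v' i * M i c) = 0" if "c < p" for c
    proof -
      have "(\<Sum>i<n. u i * M i c) = (\<Sum>i\<in>I. u i * M i c)"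
        using \<open>I \<subseteq> {..<n}\<close> u0 by (intro sum.mono_neutral_right) auto
      also have "\<dots> = (\<Sum>j\<le>p. u (s j) * M (s j) c)"
        using sum.reindex[OF incr_inj[OF s(1)], of "\<lambda>i. u i * M i c"] s(2)
        by (simp add: o_def lessThan_Suc_atMost)
      also have "\<dots> = 0" using D(2)[OF that] us by simp
      finally show ?thesis using less.prems(1)[OF that]
        by (simp add: v'_def left_diff_distrib sum_subtractf mult.assoc flip: sum_distrib_left)
    qed
    ultimately have "alternates (Suc p) n v'"
      using less.hyps[of v' i'] i' by blast
    then obtain s' e where s': "incr (Suc p) n s'" "\<forall>a<Suc p. e * (-1) ^ a * v' (s' a) > 0"
      by (auto simp: alternates_def)
    have "e * (-1) ^ a * v (s' a) > 0" if "a < Suc p" for a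
    proof -
      have pv: "e * (-1) ^ a * v' (s' a) > 0" using s'(2) that by blast
      then have "v' (s' a) \<noteq> 0" by auto
      then have "v' (s' a) * v (s' a) > 0"
        by (rule conf) (rule incr_bound[OF s'(1) that])
      then show ?thesis using pv sign_transfer by blast
    qed
    then show ?thesis using s'(1) by (auto simp: alternates_def)
  qed
qed

text \<open>Pairing a weakly alternating vector \<open>M x\<close> with the circuit on the same positions gives a sum of
nonnegative terms that is zero. So \<open>M x\<close> vanishes at \<open>p + 1\<close> positions and \<open>x\<close> is zero.\<close>

theorem range_not_weakly_alternates:
  assumes pos: "pos_rows p n M" and "c < p" "x c \<noteq> 0"
  shows "\<not> weakly_alternates (Suc p) n (\<lambda>i. \<Sum>c<p. M i c * x c)"
proof
  let ?u = "\<lambda>i. \<Sum>c<p. M i c * x c"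
  assume "weakly_alternates (Suc p) n ?u"
  then obtain s e where s: "e \<noteq> 0" "incr (Suc p) n s" "\<And>a. a < Suc p \<Longrightarrow> e * (-1) ^ a * ?u (s a) \<ge> 0"
    by (auto simp: weakly_alternates_def)
  obtain D where D: "\<And>j. j \<le> p \<Longrightarrow> D j > 0"
    "\<And>c. c < p \<Longrightarrow> (\<Sum>j\<le>p. (-1) ^ j * D j * M (s j) c) = 0"
    using circuit[OF pos s(2)] by blast
  have "(\<Sum>j\<le>p. (e * (-1) ^ j * ?u (s j)) * D j)
      = (\<Sum>j\<le>p. \<Sum>c<p. e * x c * ((-1) ^ j * D j * M (s j) c))"
    by (simp add: sum_distrib_left sum_distrib_right mult_ac)
  also have "\<dots> = (\<Sum>c<p. e * x c * (\<Sum>j\<le>p. (-1) ^ j * D j * M (s j) c))"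
    by (subst sum.swap) (simp add: sum_distrib_left)
  also have "\<dots> = 0" using D(2) by simp
  finally have "(\<Sum>j\<le>p. (e * (-1) ^ j * ?u (s j)) * D j) = 0" .
  moreover have "(e * (-1) ^ j * ?u (s j)) * D j \<ge> 0" if "j \<in> {..p}" for j
    using s(3)[of j] D(1)[of j] that by simp
  ultimately have "\<forall>j\<in>{..p}. (e * (-1) ^ j * ?u (s j)) * D j = 0"
    by (subst (asm) sum_nonneg_eq_0_iff) auto
  then have "?u (s j) = 0" if "j \<le> p" for j
    using D(1)[OF that] s(1) that by auto
  moreover have "rdet p (\<lambda>a. M (s a)) \<noteq> 0"
    using pos incr_mono[OF s(2), of p] by (auto simp: pos_rows_def dest: spec[of _ s])
  ultimately have "x c = 0"
    using rdet_nonzero_columns_independent[of p "\<lambda>a. M (s a)" x c] assms(2) by simp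
  then show False using assms(3) by simp
qed

lemma alternates_imp_weakly: "m > 0 \<Longrightarrow> alternates m n v \<Longrightarrow> weakly_alternates m n v"
  unfolding alternates_def weakly_alternates_def
  by (metis less_eq_real_def mult_zero_left order_less_irrefl)

section \<open>Nonnegative configurations as limits of positive ones\<close>

definition nonneg_rows :: "nat \<Rightarrow> nat \<Rightarrow> (nat \<Rightarrow> nat \<Rightarrow> real) \<Rightarrow> bool" where
  "nonneg_rows p n M \<longleftrightarrow> (\<forall>s. incr p n s \<longrightarrow> rdet p (\<lambda>a. M (s a)) \<ge> 0)"

lemma incr_move:
  assumes "incr p n s" "b < p" "i < n" "i = Suc (s b) \<or> s b = Suc i" "i \<notin> s ` {..<p}"
  shows "incr p n (s(b := i))"
  unfolding incr_def
proof (intro conjI allI impI)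
  fix a a' assume *: "a < a'" "a' < p"
  then have "s a < s a'" using assms(1) incr_less by blast
  moreover have "s a \<noteq> i" "s a' \<noteq> i" using assms(5) * by auto
  ultimately show "(s(b := i)) a < (s(b := i)) a'" using assms(4) * by auto
next
  fix a assume "a < p"
  then show "(s(b := i)) a < n" using assms(1,3) incr_bound by auto
qed

lemma minor_row_step:
  assumes "incr p n s" "b < p"
  shows "rdet p (\<lambda>a. (M(s b := \<lambda>c. M (s b) c + t * M i c)) (s a))
       = rdet p (\<lambda>a. M (s a)) + t * rdet p (\<lambda>a. M ((s(b := i)) a))"
proof -
  have "rdet p (\<lambda>a. (M(s b := \<lambda>c. M (s b) c + t * M i c)) (s a))
      = rdet p ((\<lambda>a. M (s a))(b := \<lambda>c. M (s b) c + t * M i c))"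
    using inj_onD[OF incr_inj[OF assms(1)], of _ b] assms(2) by (intro rdet_cong) auto
  also have "\<dots> = rdet p ((\<lambda>a. M (s a))(b := M (s b))) + t * rdet p ((\<lambda>a. M (s a))(b := M i))"
    by (rule rdet_row_add[OF assms(2)])
  also have "(\<lambda>a. M (s a))(b := M (s b)) = (\<lambda>a. M (s a))" by auto
  also have "(\<lambda>a. M (s a))(b := M i) = (\<lambda>a. M ((s(b := i)) a))" by auto
  finally show ?thesis .
qed

text \<open>Replacing the index \<open>j\<close> by an adjacent index \<open>i\<close> either keeps the indices of a minor in increasing order or
produces a repetition. So the term that the row operation adds to a minor is a
nonnegative minor or zero, without a sign from reordering.\<close>

lemma minor_row_step_ge:
  assumes "nonneg_rows p n M" "incr p n s" "i < n" "i = Suc j \<or> j = Suc i" "t \<ge> 0"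
  shows "rdet p (\<lambda>a. (M(j := \<lambda>c. M j c + t * M i c)) (s a)) \<ge> rdet p (\<lambda>a. M (s a))"
proof (cases "j \<in> s ` {..<p}")
  case False
  then have "rdet p (\<lambda>a. (M(j := \<lambda>c. M j c + t * M i c)) (s a)) = rdet p (\<lambda>a. M (s a))"
    by (intro rdet_cong) auto
  then show ?thesis by simp
next
  case True
  then obtain b where b: "b < p" "j = s b" by auto
  have "rdet p (\<lambda>a. M ((s(b := i)) a)) \<ge> 0"
  proof (cases "i \<in> s ` {..<p}")
    case True
    then obtain b' where b': "b' < p" "i = s b'" by auto
    then have "b' \<noteq> b" using b assms(4) by auto
    then have "rdet p (\<lambda>a. M ((s(b := i)) a)) = 0"
      using b b' by (intro rdet_identical_rows[of b p b']) auto
    then show ?thesis by simp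
  next
    case False
    then have "incr p n (s(b := i))"
      using incr_move[OF assms(2) b(1) assms(3)] assms(4) b by auto
    then show ?thesis using assms(1) by (simp only: nonneg_rows_def)
  qed
  then show ?thesis using minor_row_step[OF assms(2) b(1), of M t i] b(2) assms(5) by simp
qed

text \<open>Unit steps down lead from every increasing tuple to \<open>(0, \<dots>, p - 1)\<close>: the first entry that is not in
its lowest place can be lowered by one.\<close>

lemma incr_connected:
  assumes cong: "\<And>s s'. (\<And>a. a < p \<Longrightarrow> s a = s' a) \<Longrightarrow> Q s = Q s'"
    and step: "\<And>s b. incr p n s \<Longrightarrow> b < p \<Longrightarrow> s b > 0 \<Longrightarrow> incr p n (s(b := s b - 1)) \<Longrightarrow>
       Q s = Q (s(b := s b - 1))"
    and "incr p n s"
  shows "Q s = Q (\<lambda>a. a)"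
  using \<open>incr p n s\<close>
proof (induction "\<Sum>a<p. s a" arbitrary: s rule: less_induct)
  case (less s)
  show ?case
  proof (cases "\<forall>a<p. s a = a")
    case True
    then show ?thesis by (intro cong) auto
  next
    case False
    define b where "b = (LEAST b. b < p \<and> s b \<noteq> b)"
    have b: "b < p" "s b \<noteq> b"
      using LeastI_ex[of "\<lambda>b. b < p \<and> s b \<noteq> b"] False by (auto simp: b_def)
    have before: "s a = a" if "a < b" for a
      using not_less_Least[of a "\<lambda>b. b < p \<and> s b \<noteq> b"] that b(1) by (auto simp: b_def)
    have gt: "s b > b"
    proof (cases b)
      case (Suc b')
      then have "s b' < s b" using incr_less[OF less.prems] b(1) by simp
      then show ?thesis using before[of b'] Suc b(2) by simp
    qed (use b in simp)
    then have pos: "s b > 0" by simp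
    have incr': "incr p n (s(b := s b - 1))"
    proof -
      have "s b - 1 \<notin> s ` {..<p}"
      proof
        assume "s b - 1 \<in> s ` {..<p}"
        then obtain a where a: "a < p" "s b - 1 = s a" by auto
        then have "a < b" using incr_less[OF less.prems, of b a] pos by (cases "a < b"; cases "a = b") auto
        then show False using before a gt by simp
      qed
      then show ?thesis
        using incr_move[OF less.prems b(1), of "s b - 1"] incr_bound[OF less.prems b(1)] pos by simp
    qed
    have "(\<Sum>a<p. (s(b := s b - 1)) a) < (\<Sum>a<p. s a)"
      by (rule sum_strict_mono_ex1) (use b pos in auto)
    then show ?thesis
      using less.hyps[OF _ incr'] step[OF less.prems b(1) pos incr'] by simp
  qed
qed

lemma finite_incr_PiE: "finite {s \<in> {..<p} \<rightarrow>\<^sub>E {..<n}. R s}" for p n :: nat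
  by (rule finite_subset[of _ "{..<p} \<rightarrow>\<^sub>E {..<n}"]) (auto intro: finite_PiE)

text \<open>If some minor is positive and some is not, connectedness gives two adjacent tuples of this
kind. A small row operation makes the second minor positive and decreases none, so the number of
minors that are not positive drops.\<close>

theorem nonneg_rows_perturb:
  assumes "nonneg_rows p n M" "incr p n s0" "rdet p (\<lambda>a. M (s0 a)) > 0" "\<epsilon> > 0"
  shows "\<exists>M'. (\<forall>i. \<forall>c<p. \<bar>M' i c - M i c\<bar> < \<epsilon>) \<and> pos_rows p n M'"
  using assms
proof (induction "card {s \<in> {..<p} \<rightarrow>\<^sub>E {..<n}. incr p n s \<and> \<not> rdet p (\<lambda>a. M (s a)) > 0}"
    arbitrary: M \<epsilon> rule: less_induct)
  case (less M \<epsilon>)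
  let ?N = "\<lambda>M. {s \<in> {..<p} \<rightarrow>\<^sub>E {..<n}. incr p n s \<and> \<not> rdet p (\<lambda>a. M (s a)) > 0}"
  let ?Q = "\<lambda>s. rdet p (\<lambda>a. M (s a)) > 0"
  have Qcong: "?Q s = ?Q s'" if "\<And>a. a < p \<Longrightarrow> s a = s' a" for s s'
    using that rdet_cong[of p "\<lambda>a. M (s a)" "\<lambda>a. M (s' a)"] by simp
  show ?case
  proof (cases "pos_rows p n M")
    case True
    then show ?thesis using less.prems(4) by (intro exI[of _ M]) auto
  next
    case False
    then obtain s1 where s1: "incr p n s1" "\<not> ?Q s1" by (auto simp: pos_rows_def)
    have "\<exists>s b. incr p n s \<and> b < p \<and> s b > 0 \<and> incr p n (s(b := s b - 1)) \<and> ?Q s \<noteq> ?Q (s(b := s b - 1))"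
    proof (rule ccontr)
      assume "\<not> ?thesis"
      then have "?Q s = ?Q (\<lambda>a. a)" if "incr p n s" for s
        using incr_connected[of p ?Q n, OF Qcong _ that] by blast
      then show False using s1 less.prems(2,3) by blast
    qed
    then obtain s b i where s: "incr p n s" "b < p" "i < n" "i = Suc (s b) \<or> s b = Suc i"
      "incr p n (s(b := i))" "\<not> ?Q s" "?Q (s(b := i))"
    proof (elim exE conjE)
      fix s b assume *: "incr p n s" "b < p" "s b > 0" "incr p n (s(b := s b - 1))" "?Q s \<noteq> ?Q (s(b := s b - 1))"
      show ?thesis
      proof (cases "?Q s")
        case True
        show ?thesis
          by (rule that[of "s(b := s b - 1)" b "s b"])
             (use * True incr_bound[OF *(1)] in \<open>simp_all add: fun_upd_idem\<close>)
      next
        case False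
        show ?thesis
          by (rule that[of s b "s b - 1"]) (use * False incr_bound[OF *(1,2)] in simp_all)
      qed
    qed
    \<comment> \<open>The step must move every entry by less than half of \<open>\<epsilon>\<close>; the induction uses the other half.\<close>
    define t where "t = \<epsilon> / (2 * (1 + (\<Sum>c<p. \<bar>M i c\<bar>)))"
    have den: "1 + (\<Sum>c<p. \<bar>M i c\<bar>) > 0"
      by (intro add_pos_nonneg sum_nonneg) auto
    then have t: "t > 0" using less.prems(4) by (simp add: t_def)
    have tM: "\<bar>t * M i c\<bar> < \<epsilon> / 2" if "c < p" for c
    proof -
      have "\<bar>M i c\<bar> \<le> (\<Sum>c<p. \<bar>M i c\<bar>)"
        by (rule member_le_sum) (use that in auto)
      then have "t * \<bar>M i c\<bar> < t * (1 + (\<Sum>c<p. \<bar>M i c\<bar>))" using t by (intro mult_strict_left_mono) auto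
      also have "\<dots> = \<epsilon> / 2" using den by (simp add: t_def field_simps)
      finally show ?thesis using t by (simp add: abs_mult)
    qed
    define M1 where "M1 = M(s b := \<lambda>c. M (s b) c + t * M i c)"
    have ge: "rdet p (\<lambda>a. M1 (s' a)) \<ge> rdet p (\<lambda>a. M (s' a))" if "incr p n s'" for s'
      unfolding M1_def using minor_row_step_ge[OF less.prems(1) that s(3,4)] t by simp
    have nonneg1: "nonneg_rows p n M1"
      using less.prems(1) ge order_trans unfolding nonneg_rows_def by blast
    have pos_s: "rdet p (\<lambda>a. M1 (s a)) > 0"
    proof -
      have "rdet p (\<lambda>a. M (s a)) \<ge> 0" using less.prems(1) s(1) by (simp add: nonneg_rows_def)
      moreover have "t * rdet p (\<lambda>a. M ((s(b := i)) a)) > 0" using t s(7) by simp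
      ultimately show ?thesis
        unfolding M1_def minor_row_step[OF s(1,2), of M t i] by linarith
    qed
    have "?N M1 \<subset> ?N M"
    proof
      show "?N M1 \<subseteq> ?N M" using ge by (force simp: not_less)
      let ?s = "restrict s {..<p}"
      have "?s \<in> {..<p} \<rightarrow>\<^sub>E {..<n}" "incr p n ?s"
        using s(1) by (auto simp: incr_def)
      moreover have "rdet p (\<lambda>a. M' (?s a)) = rdet p (\<lambda>a. M' (s a))" for M'
        by (intro rdet_cong) auto
      ultimately have "?s \<in> ?N M" "?s \<notin> ?N M1" using s(6) pos_s by auto
      then show "?N M1 \<noteq> ?N M" by blast
    qed
    then have "card (?N M1) < card (?N M)"
      by (intro psubset_card_mono finite_incr_PiE)
    moreover have "rdet p (\<lambda>a. M1 (s0 a)) > 0" using ge[OF less.prems(2)] less.prems(3) by linarith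
    moreover have "\<epsilon> / 2 > 0" using less.prems(4) by simp
    ultimately obtain M' where M': "\<forall>i. \<forall>c<p. \<bar>M' i c - M1 i c\<bar> < \<epsilon> / 2" "pos_rows p n M'"
      using less.hyps[OF _ nonneg1 less.prems(2)] by blast
    have "\<bar>M' i' c - M i' c\<bar> < \<epsilon>" if "c < p" for i' c
    proof -
      have "\<bar>M' i' c - M1 i' c\<bar> < \<epsilon> / 2" using M'(1) that by blast
      moreover have "\<bar>M1 i' c - M i' c\<bar> < \<epsilon> / 2" using tM[OF that] less.prems(4) by (simp add: M1_def)
      ultimately show ?thesis by linarith
    qed
    then show ?thesis using M'(2) by blast
  qed
qed

corollary nonneg_range_not_alternates:
  assumes "nonneg_rows p n M" "incr p n s0" "rdet p (\<lambda>a. M (s0 a)) > 0"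
  shows "\<not> alternates (Suc p) n (\<lambda>i. \<Sum>c<p. M i c * x c)"
proof
  let ?u = "\<lambda>M i. \<Sum>c<p. M i c * x c"
  assume "alternates (Suc p) n (?u M)"
  then obtain s e where s: "incr (Suc p) n s" "\<And>a. a < Suc p \<Longrightarrow> e * (-1) ^ a * ?u M (s a) > 0"
    by (auto simp: alternates_def)
  define \<delta> where "\<delta> = Min ((\<lambda>a. \<bar>?u M (s a)\<bar>) ` {..<Suc p})"
  have \<delta>le: "\<delta> \<le> \<bar>?u M (s a)\<bar>" if "a < Suc p" for a
    unfolding \<delta>_def using that by (intro Min_le) auto
  have "\<delta> \<in> (\<lambda>a. \<bar>?u M (s a)\<bar>) ` {..<Suc p}" unfolding \<delta>_def by (intro Min_in) auto
  then have \<delta>: "\<delta> > 0" using s(2) by fastforce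
  define \<epsilon> where "\<epsilon> = \<delta> / (1 + (\<Sum>c<p. \<bar>x c\<bar>))"
  have den: "1 + (\<Sum>c<p. \<bar>x c\<bar>) > 0"
    by (intro add_pos_nonneg sum_nonneg) auto
  then have \<epsilon>: "\<epsilon> > 0" using \<delta> by (simp add: \<epsilon>_def)
  obtain M' where M': "\<And>i c. c < p \<Longrightarrow> \<bar>M' i c - M i c\<bar> < \<epsilon>" "pos_rows p n M'"
    using nonneg_rows_perturb[OF assms \<epsilon>] by blast
  have close: "\<bar>?u M' i - ?u M i\<bar> < \<delta>" for i
  proof -
    have "\<bar>?u M' i - ?u M i\<bar> = \<bar>\<Sum>c<p. (M' i c - M i c) * x c\<bar>"
      by (simp add: sum_subtractf left_diff_distrib)
    also have "\<dots> \<le> (\<Sum>c<p. \<bar>(M' i c - M i c) * x c\<bar>)" by (rule sum_abs)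
    also have "\<dots> \<le> (\<Sum>c<p. \<epsilon> * \<bar>x c\<bar>)"
    proof (rule sum_mono)
      fix c assume "c \<in> {..<p}"
      then have "\<bar>M' i c - M i c\<bar> \<le> \<epsilon>" using M'(1)[of c i] by simp
      then show "\<bar>(M' i c - M i c) * x c\<bar> \<le> \<epsilon> * \<bar>x c\<bar>"
        by (simp add: abs_mult mult_right_mono)
    qed
    also have "\<dots> = \<epsilon> * (\<Sum>c<p. \<bar>x c\<bar>)" by (simp add: sum_distrib_left)
    also have "\<dots> < \<epsilon> * (1 + (\<Sum>c<p. \<bar>x c\<bar>))" using \<epsilon> by (intro mult_strict_left_mono) auto
    also have "\<dots> = \<delta>" using den by (simp add: \<epsilon>_def)
    finally show ?thesis .
  qed
  have "e * (-1) ^ a * ?u M' (s a) > 0" if "a < Suc p" for a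
  proof -
    have "?u M (s a) * ?u M' (s a) > 0"
      using close[of "s a"] \<delta>le[OF that] by (auto simp: abs_if zero_less_mult_iff split: if_splits)
    then show ?thesis
      using s(2)[OF that] sign_transfer by blast
  qed
  then have "alternates (Suc p) n (?u M')" using s(1) by (auto simp: alternates_def)
  moreover from this obtain c where "c < p" "x c \<noteq> 0"
  proof -
    have "?u M (s 0) \<noteq> 0" using s(2)[of 0] by auto
    then show ?thesis using that by (metis (no_types, lifting) lessThan_iff mult_zero_right sum.neutral)
  qed
  ultimately show False
    using range_not_weakly_alternates[OF M'(2)] alternates_imp_weakly by blast
qed

section \<open>Brackets modulo a subspace\<close>

text \<open>\<open>bracket k y u v\<close> is \<open>\<langle>Y u v\<rangle>\<close>, the area form of the quotient of \<open>\<real>\<^bsup>k+2\<^esup>\<close> by the span of the first \<open>k\<close> rows of \<open>y\<close>.\<close>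

definition bracket :: "nat \<Rightarrow> (nat \<Rightarrow> nat \<Rightarrow> real) \<Rightarrow> (nat \<Rightarrow> real) \<Rightarrow> (nat \<Rightarrow> real) \<Rightarrow> real" where
  "bracket k y u v = rdet (k + 2) (\<lambda>a. if a < k then y a else if a = k then u else v)"

lemma bracket_linear: "\<exists>h. \<forall>v. bracket k y u v = (\<Sum>c<k + 2. h c * v c)"
proof -
  let ?f = "\<lambda>a. if a < k then y a else if a = k then u else (\<lambda>_. 0)"
  have "bracket k y u v = rdet (k + 2) (?f(Suc k := v))" for v
    unfolding bracket_def by (intro rdet_cong) (auto simp: less_Suc_eq)
  then show ?thesis using rdet_expand_row[of "Suc k" "k + 2" ?f] by simp
qed

lemma bracket_add_right: "bracket k y u (\<lambda>c. v c + w c) = bracket k y u v + bracket k y u w"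
  using bracket_linear[of k y u] by (auto simp: sum.distrib algebra_simps)

lemma bracket_add_left: "bracket k y (\<lambda>c. u c + w c) v = bracket k y u v + bracket k y w v"
proof -
  let ?f = "\<lambda>a. if a < k then y a else v"
  have "bracket k y u v = rdet (k + 2) (?f(k := u))" for u
    unfolding bracket_def by (intro rdet_cong) auto
  then show ?thesis using rdet_row_add[of k "k + 2" ?f u 1 w] by simp
qed

lemma bracket_same: "bracket k y u u = 0"
  unfolding bracket_def by (rule rdet_identical_rows[of k _ "Suc k"]) auto

lemma bracket_row: "r < k \<Longrightarrow> bracket k y u (y r) = 0"
  unfolding bracket_def by (rule rdet_identical_rows[of r _ "Suc k"]) auto

lemma bracket_antisym: "bracket k y u v = - bracket k y v u"
  using bracket_same[of k y "\<lambda>c. u c + v c"]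
  by (simp add: bracket_add_left bracket_add_right bracket_same)

text \<open>The three-term Pluecker relation: apply the linear form \<open>bracket k y t\<close>, which vanishes on the rows
of \<open>y\<close>, to the relation between \<open>y\<^sub>0, \<dots>, y\<^sub>k\<^sub>-\<^sub>1, u, v, x\<close> given by Cramer's rule.\<close>

lemma bracket_pluecker:
  "bracket k y t u * bracket k y v x - bracket k y t v * bracket k y u x
     + bracket k y t x * bracket k y u v = 0"
proof -
  obtain h where h: "\<And>v. bracket k y t v = (\<Sum>c<k + 2. h c * v c)"
    using bracket_linear by blast
  define f where "f a = (if a < k then y a else if a = k then u else if a = Suc k then v else x)" for a
  let ?D = "\<lambda>j. rdet (k + 2) (\<lambda>i. f (if i < j then i else Suc i))"
  have "(\<Sum>j\<le>k + 2. (-1) ^ j * ?D j * bracket k y t (f j))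
      = (\<Sum>c<k + 2. h c * (\<Sum>j\<le>k + 2. (-1) ^ j * f j c * ?D j))"
    unfolding h sum_distrib_left by (subst sum.swap) (simp add: mult_ac)
  also have "\<dots> = 0"
    using rdet_cramer[of _ "k + 2" f] by (intro sum.neutral) auto
  finally have "(\<Sum>j\<le>k + 2. (-1) ^ j * ?D j * bracket k y t (f j)) = 0" .
  moreover have "(\<Sum>j\<le>k + 2. G j) = (\<Sum>j<k. G j) + G k + G (Suc k) + G (Suc (Suc k))" for G :: "nat \<Rightarrow> real"
    by (simp add: numeral_2_eq_2 flip: lessThan_Suc_atMost)
  moreover have "(\<Sum>j<k. (-1) ^ j * ?D j * bracket k y t (f j)) = 0"
    by (intro sum.neutral) (auto simp: f_def bracket_row)
  ultimately have "(-1) ^ k * (?D k * bracket k y t u - ?D (Suc k) * bracket k y t v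
      + ?D (Suc (Suc k)) * bracket k y t x) = 0"
    by (simp add: f_def algebra_simps)
  moreover have "?D k = bracket k y v x" "?D (Suc k) = bracket k y u x" "?D (Suc (Suc k)) = bracket k y u v"
    unfolding bracket_def by (rule rdet_cong; auto simp: f_def less_Suc_eq)+
  ultimately show ?thesis by (simp add: mult.commute)
qed

section \<open>Counting sign flips\<close>

lemma neg_square_neg: "x \<noteq> 0 \<Longrightarrow> x * - x < 0" "x \<noteq> 0 \<Longrightarrow> - x * x < 0" for x :: real
  by (metis mult_minus_left mult_minus_right neg_less_0_iff_less not_real_square_gt_zero)+

lemma real_square_pos: "x \<noteq> 0 \<Longrightarrow> 0 < x * x" for x :: real
  by (metis not_real_square_gt_zero)


text \<open>Unlike \<open>Flip\<close>, this counts along a path: the pair of the last and the first entry is left out.\<close>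

definition flips :: "nat \<Rightarrow> (nat \<Rightarrow> real) \<Rightarrow> nat set" where
  "flips n u = {j. Suc j < n \<and> u j * u (Suc j) < 0}"

lemma finite_flips [simp]: "finite (flips n u)"
  by (rule finite_subset[of _ "{..<n}"]) (auto simp: flips_def)

lemma flips_Suc:
  "flips (Suc (Suc N)) u = (if u N * u (Suc N) < 0 then insert N (flips (Suc N) u) else flips (Suc N) u)"
  by (auto simp: flips_def less_Suc_eq)

lemma card_flips_Suc:
  "card (flips (Suc (Suc N)) u) = card (flips (Suc N) u) + (if u N * u (Suc N) < 0 then 1 else 0)"
proof -
  have "N \<notin> flips (Suc N) u" by (simp add: flips_def)
  then show ?thesis by (simp add: flips_Suc)
qed

lemma flips_parity:
  assumes "\<And>j. j \<le> N \<Longrightarrow> u j \<noteq> 0"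
  shows "(-1) ^ card (flips (Suc N) u) * (u 0 * u N) > 0"
  using assms
proof (induction N)
  case 0
  have "u 0 \<noteq> 0" using 0 by blast
  then have "u 0 * u 0 > 0" by (rule real_square_pos)
  moreover have "flips (Suc 0) u = {}" by (simp add: flips_def)
  ultimately show ?case by (simp only: card.empty power_0 mult_1)
next
  case (Suc N)
  let ?e = "(-1) ^ card (flips (Suc N) u) :: real"
  have IH: "?e * u 0 * u N > 0" using Suc by simp
  have "u N * u (Suc N) \<noteq> 0" using Suc.prems[of N] Suc.prems[of "Suc N"] by simp
  then consider "u N * u (Suc N) < 0" | "u N * u (Suc N) > 0" by linarith
  then show ?case
  proof cases
    case 1
    then show ?thesis using sign_transfer[OF IH, of "- u (Suc N)"] by (simp add: card_flips_Suc)
  next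
    case 2
    then show ?thesis using sign_transfer[OF IH, of "u (Suc N)"] by (simp add: card_flips_Suc mult_ac)
  qed
qed

lemma flips_alternates:
  assumes "\<And>j. j \<le> N \<Longrightarrow> u j \<noteq> 0"
  shows "\<exists>s e. incr (Suc (card (flips (Suc N) u))) (Suc N) s \<and> s (card (flips (Suc N) u)) = N \<and>
    (\<forall>a\<le>card (flips (Suc N) u). e * (-1) ^ a * u (s a) > 0)"
  using assms
proof (induction N)
  case 0
  show ?case
    by (rule exI[of _ "\<lambda>_. 0"], rule exI[of _ "u 0"])
       (use 0 real_square_pos[of "u 0"] in \<open>auto simp: flips_def incr_def\<close>)
next
  case (Suc N)
  let ?m = "card (flips (Suc N) u)"
  obtain s e where s: "incr (Suc ?m) (Suc N) s" "s ?m = N" "\<And>a. a \<le> ?m \<Longrightarrow> e * (-1) ^ a * u (s a) > 0"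
    using Suc by auto
  have "u N * u (Suc N) \<noteq> 0" using Suc.prems[of N] Suc.prems[of "Suc N"] by simp
  then consider "u N * u (Suc N) < 0" | "u N * u (Suc N) > 0" by linarith
  then show ?case
  proof cases
    case 1
    then have m': "card (flips (Suc (Suc N)) u) = Suc ?m" by (simp add: card_flips_Suc)
    have "e * (-1) ^ Suc ?m * u (Suc N) > 0"
      using sign_transfer[of "e * (-1) ^ ?m" "u N" "- u (Suc N)"] s(2) s(3)[of ?m] 1 by simp
    then have "\<forall>a\<le>Suc ?m. e * (-1) ^ a * u ((s(Suc ?m := Suc N)) a) > 0"
      using s(3) by (simp add: le_Suc_eq)
    moreover have "incr (Suc (Suc ?m)) (Suc (Suc N)) (s(Suc ?m := Suc N))"
      using s(1) by (auto simp: incr_def less_Suc_eq)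
    moreover have "(s(Suc ?m := Suc N)) (Suc ?m) = Suc N" by simp
    ultimately show ?thesis unfolding m' by blast
  next
    case 2
    then have m': "card (flips (Suc (Suc N)) u) = ?m" by (simp add: card_flips_Suc)
    have "e * (-1) ^ ?m * u (Suc N) > 0"
      using sign_transfer[of "e * (-1) ^ ?m" "u N" "u (Suc N)"] s(2) s(3)[of ?m] 2 by simp
    then have "\<forall>a\<le>?m. e * (-1) ^ a * u ((s(?m := Suc N)) a) > 0"
      using s(3) by simp
    moreover have "incr (Suc ?m) (Suc (Suc N)) (s(?m := Suc N))"
      using s(1) by (fastforce simp: incr_def less_Suc_eq)
    moreover have "(s(?m := Suc N)) ?m = Suc N" by simp
    ultimately show ?thesis unfolding m' by blast
  qed
qed

corollary alternates_flips:
  assumes "\<And>j. j < n \<Longrightarrow> u j \<noteq> 0" "n > 0"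
  shows "alternates (Suc (card (flips n u))) n u"
proof -
  obtain N where N: "n = Suc N" using assms(2) by (cases n) auto
  then show ?thesis using flips_alternates[of N u] assms(1) by (auto simp: alternates_def less_Suc_eq_le)
qed

lemma sign_change_flip:
  fixes u :: "nat \<Rightarrow> real"
  assumes "a < b" "u a * u b < 0" "\<And>j. a \<le> j \<Longrightarrow> j \<le> b \<Longrightarrow> u j \<noteq> 0"
  shows "\<exists>j. a \<le> j \<and> j < b \<and> u j * u (Suc j) < 0"
proof (rule ccontr)
  assume no: "\<not> ?thesis"
  have "u a * u b > 0"
    using less_imp_le[OF \<open>a < b\<close>] assms(3) no
  proof (induction b rule: dec_induct)
    case base
    then show ?case by (intro real_square_pos) simp
  next
    case (step b)
    have "u a * u b > 0" using step by auto
    moreover have "u b * u (Suc b) > 0"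
    proof -
      have "u b \<noteq> 0" "u (Suc b) \<noteq> 0" using step.prems(1) step.hyps by auto
      moreover have "\<not> u b * u (Suc b) < 0" using step.prems(2) step.hyps by auto
      ultimately show ?thesis by (metis linorder_neqE_linordered_idom mult_eq_0_iff)
    qed
    ultimately show ?case using sign_transfer by blast
  qed
  then show False using assms(2) by simp
qed

lemma alternates_le_flips:
  assumes "alternates (Suc m) n u" "\<And>j. j < n \<Longrightarrow> u j \<noteq> 0"
  shows "m \<le> card (flips n u)"
proof -
  obtain s e where s: "incr (Suc m) n s" "\<And>a. a < Suc m \<Longrightarrow> e * (-1) ^ a * u (s a) > 0"
    using assms(1) by (auto simp: alternates_def)
  have "j \<le> card (flips (Suc (s j)) u)" if "j \<le> m" for j
    using that
  proof (induction j)
    case (Suc j)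
    have lt: "s j < s (Suc j)" using incr_less[OF s(1)] Suc.prems by simp
    have "e * (-1) ^ j * u (s j) > 0" "- (e * (-1) ^ j) * u (s (Suc j)) > 0"
      using s(2)[of j] s(2)[of "Suc j"] Suc.prems by auto
    then have "u (s j) * u (s (Suc j)) < 0"
      by (auto simp: zero_less_mult_iff mult_less_0_iff)
    moreover have "u i \<noteq> 0" if "i \<le> s (Suc j)" for i
      using assms(2) incr_bound[OF s(1), of "Suc j"] Suc.prems that by simp
    ultimately obtain i where i: "s j \<le> i" "i < s (Suc j)" "u i * u (Suc i) < 0"
      using sign_change_flip[OF lt, of u] by auto
    then have "insert i (flips (Suc (s j)) u) \<subseteq> flips (Suc (s (Suc j))) u" "i \<notin> flips (Suc (s j)) u"
      using lt by (auto simp: flips_def)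
    then have "Suc (card (flips (Suc (s j)) u)) \<le> card (flips (Suc (s (Suc j))) u)"
      by (metis card_insert_disjoint card_mono finite_flips)
    then show ?case using Suc by simp
  qed simp
  then have "m \<le> card (flips (Suc (s m)) u)" by simp
  also have "\<dots> \<le> card (flips n u)"
    using incr_bound[OF s(1), of m] by (intro card_mono finite_flips) (auto simp: flips_def)
  finally show ?thesis .
qed

lemma alternates_update:
  assumes "alternates m n v" "v i = 0"
  shows "alternates m n (v(i := x))"
proof -
  obtain s e where s: "incr m n s" "\<And>a. a < m \<Longrightarrow> e * (-1) ^ a * v (s a) > 0"
    using assms(1) by (auto simp: alternates_def)
  have "e * (-1) ^ a * (v(i := x)) (s a) > 0" if "a < m" for a
  proof -
    have "s a \<noteq> i" using s(2)[OF that] assms(2) by (metis less_irrefl mult_zero_right)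
    then show ?thesis using s(2)[OF that] by simp
  qed
  then show ?thesis unfolding alternates_def using s(1) by blast
qed

lemma weakly_alternates_of_update:
  assumes "alternates m n (v(i := x))" "v i = 0" "m > 0"
  shows "weakly_alternates m n v"
proof -
  obtain s e where s: "incr m n s" "\<And>a. a < m \<Longrightarrow> e * (-1) ^ a * (v(i := x)) (s a) > 0"
    using assms(1) by (auto simp: alternates_def)
  have "e \<noteq> 0" using s(2)[OF assms(3)] by (metis less_irrefl mult_zero_left)
  moreover have "e * (-1) ^ a * v (s a) \<ge> 0" if "a < m" for a
  proof (cases "s a = i")
    case True
    then show ?thesis using assms(2) by simp
  next
    case False
    then show ?thesis using s(2)[OF that] by simp
  qed
  ultimately show ?thesis unfolding weakly_alternates_def using s(1) by blast
qed

text \<open>If \<open>v\<close> vanishes only at \<open>i\<close>, any nonzero value may be put there: an alternation of \<open>v\<close> survives, and an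
alternation of the new vector is a weak one of \<open>v\<close>. So both choices of sign give between \<open>k\<close>
and \<open>k + 1\<close> flips, which is what determines the signs next to \<open>i\<close>.\<close>

lemma one_zero_flips:
  assumes alt: "alternates (Suc k) n v" and nwalt: "\<not> weakly_alternates (k + 3) n v"
    and nz: "\<And>j. j < n \<Longrightarrow> j \<noteq> i \<Longrightarrow> v j \<noteq> 0" and "v i = 0" "i < n" "x \<noteq> 0"
  shows "k \<le> card (flips n (v(i := x)))" "card (flips n (v(i := x))) \<le> k + 1"
proof -
  have nz': "(v(i := x)) j \<noteq> 0" if "j < n" for j using nz[OF that] \<open>x \<noteq> 0\<close> by simp
  show "k \<le> card (flips n (v(i := x)))"
    using alternates_le_flips[OF alternates_update[OF alt \<open>v i = 0\<close>]] nz' by blast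
  show "card (flips n (v(i := x))) \<le> k + 1"
  proof (rule ccontr)
    let ?m = "card (flips n (v(i := x)))"
    assume "\<not> ?m \<le> k + 1"
    then have m: "k + 3 \<le> Suc ?m" by simp
    have "alternates (Suc ?m) n (v(i := x))"
      using alternates_flips[of n "v(i := x)"] nz' \<open>i < n\<close> by auto
    then have "weakly_alternates (Suc ?m) n v"
      using weakly_alternates_of_update \<open>v i = 0\<close> by blast
    then have "weakly_alternates (k + 3) n v"
      using m incr_mono[of "Suc ?m" n _ "k + 3"] unfolding weakly_alternates_def
      by (meson less_le_trans)
    then show False using nwalt by simp
  qed
qed

lemma flips_update_inner:
  assumes "Suc (Suc i) < n"
  shows "flips n (v(Suc i := x)) = {j \<in> flips n v. j \<noteq> i \<and> j \<noteq> Suc i}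
    \<union> (if v i * x < 0 then {i} else {}) \<union> (if x * v (Suc (Suc i)) < 0 then {Suc i} else {})"
    (is "?L = ?R")
proof -
  have "j \<in> ?L \<longleftrightarrow> j \<in> ?R" for j
  proof -
    consider "j = i" | "j = Suc i" | "j \<noteq> i" "j \<noteq> Suc i" by blast
    then show ?thesis by cases (use assms in \<open>auto simp: flips_def\<close>)
  qed
  then show ?thesis by blast
qed

lemma flips_update_first:
  assumes "1 < n"
  shows "flips n (v(0 := x)) = {j \<in> flips n v. j \<noteq> 0} \<union> (if x * v 1 < 0 then {0} else {})"
    (is "?L = ?R")
proof -
  have "j \<in> ?L \<longleftrightarrow> j \<in> ?R" for j
    by (cases "j = 0") (use assms in \<open>auto simp: flips_def\<close>)
  then show ?thesis by blast
qed

text \<open>If the two neighbours of the zero had the same sign, the two choices of a sign at the zero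
would give numbers of flips that differ by two.\<close>

lemma inner_zero_flip:
  assumes alt: "alternates (Suc k) n v" and nwalt: "\<not> weakly_alternates (k + 3) n v"
    and nz: "\<And>j. j < n \<Longrightarrow> j \<noteq> Suc i \<Longrightarrow> v j \<noteq> 0" and "v (Suc i) = 0" "Suc (Suc i) < n"
  shows "v i * v (Suc (Suc i)) < 0"
proof (rule ccontr)
  assume "\<not> ?thesis"
  moreover have vi: "v i \<noteq> 0" "v (Suc (Suc i)) \<noteq> 0" using nz[of i] nz[of "Suc (Suc i)"] assms(5) by auto
  ultimately have same: "v i * v (Suc (Suc i)) > 0" by (metis linorder_neqE_linordered_idom mult_eq_0_iff)
  let ?F = "{j \<in> flips n v. j \<noteq> i \<and> j \<noteq> Suc i}"
  have plus: "flips n (v(Suc i := v i)) = ?F"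
    using same real_square_pos[OF vi(1)]
    by (subst flips_update_inner[OF assms(5)]) (simp add: not_less order.asym)
  have minus: "flips n (v(Suc i := - v i)) = insert i (insert (Suc i) ?F)"
    using same neg_square_neg(1)[OF vi(1)]
    by (subst flips_update_inner[OF assms(5)]) (auto)
  have "finite ?F" "i \<notin> ?F" "Suc i \<notin> ?F" by (auto intro: finite_subset[OF _ finite_flips[of n v]])
  then have "card (insert i (insert (Suc i) ?F)) = card ?F + 2" by simp
  moreover have "k \<le> card ?F"
    using one_zero_flips(1)[OF alt nwalt nz \<open>v (Suc i) = 0\<close> assms(5)[THEN Suc_lessD] vi(1)] plus by simp
  moreover have "card (insert i (insert (Suc i) ?F)) \<le> k + 1"
    using one_zero_flips(2)[OF alt nwalt nz \<open>v (Suc i) = 0\<close> assms(5)[THEN Suc_lessD], of "- v i"] vi(1) minus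
    by simp
  ultimately show False by linarith
qed

text \<open>At the end of the path the two choices differ by one flip, so the smaller number is \<open>k\<close>.\<close>

lemma first_zero_flips:
  assumes alt: "alternates (Suc k) n v" and nwalt: "\<not> weakly_alternates (k + 3) n v"
    and nz: "\<And>j. j < n \<Longrightarrow> j \<noteq> 0 \<Longrightarrow> v j \<noteq> 0" and "v 0 = 0" "1 < n"
  shows "card {j. 1 \<le> j \<and> Suc j < n \<and> v j * v (Suc j) < 0} = k" "(-1) ^ k * (v 1 * v (n - 1)) > 0"
proof -
  have v1: "v 1 \<noteq> 0" and n0: "0 < n" using nz[of 1] assms(5) by auto
  let ?F = "{j \<in> flips n v. j \<noteq> 0}"
  have plus: "flips n (v(0 := v 1)) = ?F"
    using real_square_pos[OF v1]
    by (subst flips_update_first[OF assms(5)]) (simp add: not_less order.asym)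
  have minus: "flips n (v(0 := - v 1)) = insert 0 ?F"
    using neg_square_neg(2)[OF v1] by (subst flips_update_first[OF assms(5)]) auto
  have "finite ?F" "0 \<notin> ?F" by (auto intro: finite_subset[OF _ finite_flips[of n v]])
  then have "card (insert 0 ?F) = card ?F + 1" by simp
  moreover have "k \<le> card ?F"
    using one_zero_flips(1)[OF alt nwalt nz \<open>v 0 = 0\<close> n0 v1] plus by simp
  moreover have "card (insert 0 ?F) \<le> k + 1"
    using one_zero_flips(2)[OF alt nwalt nz \<open>v 0 = 0\<close> n0, of "- v 1"] v1 minus by simp
  ultimately have k: "card ?F = k" by linarith
  have "?F = {j. 1 \<le> j \<and> Suc j < n \<and> v j * v (Suc j) < 0}"
    unfolding flips_def by (simp add: Suc_le_eq conj_ac)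
  then show "card {j. 1 \<le> j \<and> Suc j < n \<and> v j * v (Suc j) < 0} = k" using k by simp
  have nzu: "(v(0 := v 1)) j \<noteq> 0" if "j \<le> n - 1" for j using v1 nz[of j] that n0 by simp
  have "(-1) ^ card (flips (Suc (n - 1)) (v(0 := v 1))) * ((v(0 := v 1)) 0 * (v(0 := v 1)) (n - 1)) > 0"
    using flips_parity[OF nzu] .
  then show "(-1) ^ k * (v 1 * v (n - 1)) > 0"
    using assms(5) k plus by simp
qed

section \<open>Signs of the brackets\<close>

text \<open>The first two claims say that consecutive vectors always turn in the same sense, also from the last one to
\<open>(-1)\<^bsup>k+1\<^esup>\<close> times the first. The row \<open>d i\<close> is a relation among the \<open>M j\<close>, since a row of \<open>y\<close> has bracket zero with
\<open>Z i\<close>, and it consists of the values at the \<open>Z j\<close> of a linear form.\<close>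

theorem bracket_signs:
  assumes M: "pos_rows k n M" and Z: "pos_rows (k + 2) n Z" and kn: "k + 2 \<le> n"
    and y: "\<And>r c. r < k \<Longrightarrow> c < k + 2 \<Longrightarrow> y r c = (\<Sum>j<n. M j r * Z j c)"
    and d: "\<And>i j. d i j = bracket k y (Z i) (Z j)"
    and nz: "\<And>i j. i < n \<Longrightarrow> j < n \<Longrightarrow> i \<noteq> j \<Longrightarrow> d i j \<noteq> 0"
  shows "Suc i < n \<Longrightarrow> d 0 1 * d i (Suc i) > 0"
    and "(-1) ^ k * (d 0 1 * d 0 (n - 1)) > 0"
    and "card {j. 1 \<le> j \<and> Suc j < n \<and> d 0 j * d 0 (Suc j) < 0} = k"
proof -
  have d0: "d i i = 0" for i by (simp add: d bracket_same)
  have anti: "d i j = - d j i" for i j unfolding d by (rule bracket_antisym)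
  have alt: "alternates (Suc k) n (d i)" "\<not> weakly_alternates (k + 3) n (d i)" if "i < n" for i
  proof -
    obtain h where h: "\<And>v. bracket k y (Z i) v = (\<Sum>c<k + 2. h c * v c)"
      using bracket_linear by blast
    obtain j where j: "j < n" "d i j \<noteq> 0"
    proof (cases "i = 0")
      case True
      then show ?thesis using that[of 1] nz[of 0 1] kn by auto
    next
      case False
      then show ?thesis using that[of 0] nz[of i 0] kn \<open>i < n\<close> by auto
    qed
    have "(\<Sum>j<n. d i j * M j r) = 0" if "r < k" for r
    proof -
      have "(\<Sum>j<n. d i j * M j r) = (\<Sum>c<k + 2. h c * (\<Sum>j<n. M j r * Z j c))"
        unfolding d h sum_distrib_left sum_distrib_right by (subst sum.swap) (simp add: mult_ac)
      also have "\<dots> = (\<Sum>c<k + 2. h c * y r c)" using y[OF that] by simp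
      also have "\<dots> = 0" using bracket_row[OF that, of y "Z i"] by (simp add: h)
      finally show ?thesis .
    qed
    then show "alternates (Suc k) n (d i)"
      using kernel_alternates[where v = "d i", OF M _ _ j] kn by simp
    have dh: "d i = (\<lambda>j. \<Sum>c<k + 2. Z j c * h c)" by (simp add: d h mult.commute fun_eq_iff)
    obtain c where "c < k + 2" "h c \<noteq> 0"
      using j(2) unfolding dh by (metis (no_types, lifting) lessThan_iff mult_zero_right sum.neutral)
    then show "\<not> weakly_alternates (k + 3) n (d i)"
      using range_not_weakly_alternates[OF Z, of c h] unfolding dh by (simp add: numeral_3_eq_3)
  qed
  note first = first_zero_flips[OF alt[of 0] nz[of 0] d0]
  show "(-1) ^ k * (d 0 1 * d 0 (n - 1)) > 0"
    and "card {j. 1 \<le> j \<and> Suc j < n \<and> d 0 j * d 0 (Suc j) < 0} = k"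
    using first kn by auto
  show "d 0 1 * d i (Suc i) > 0" if "Suc i < n"
    using that
  proof (induction i)
    case 0
    then show ?case using real_square_pos[of "d 0 1"] nz[of 0 1] kn by simp
  next
    case (Suc i)
    have "d (Suc i) i * d (Suc i) (Suc (Suc i)) < 0"
      using inner_zero_flip[OF alt[of "Suc i"] nz[of "Suc i"] d0] Suc.prems by auto
    then have "d i (Suc i) * d (Suc i) (Suc (Suc i)) > 0" using anti[of "Suc i" i] by simp
    then show ?case using Suc sign_transfer by auto
  qed
qed

section \<open>The permutation of a configuration of lines\<close>

lemma left_of_sorted_wrt:
  assumes "sorted_wrt R w" "\<And>i j. R i j \<Longrightarrow> \<not> R j i"
  shows "left_of w i j \<longleftrightarrow> i \<in> set w \<and> j \<in> set w \<and> R i j"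
proof
  assume "left_of w i j"
  then show "i \<in> set w \<and> j \<in> set w \<and> R i j"
    using sorted_wrt_nth_less[OF assms(1)] by (auto simp: left_of_def)
next
  assume *: "i \<in> set w \<and> j \<in> set w \<and> R i j"
  then obtain p q where pq: "p < length w" "w ! p = i" "q < length w" "w ! q = j"
    by (meson in_set_conv_nth)
  then have "p < q"
    using * assms(2) sorted_wrt_nth_less[OF assms(1), of q p] by (metis linorder_neqE_nat)
  then show "left_of w i j" using pq by (auto simp: left_of_def)
qed

lemma rot_to_end_split:
  assumes "b \<notin> set ys"
  shows "rot_to_end (ys @ b # zs) b = zs @ ys @ [b]"
proof -
  have "takeWhile (\<lambda>x. x \<noteq> b) (ys @ b # zs) = ys"
    using assms by (subst takeWhile_append2) auto
  then have "rot_to_end (ys @ b # zs) b = rotate (length (ys @ [b])) ((ys @ [b]) @ zs)"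
    by (simp add: rot_to_end_def)
  then show ?thesis by (metis append_assoc rotate_append)
qed

text \<open>The order on a circle that is cut open just after the point \<open>A\<close>: the points beyond \<open>A\<close> come first.\<close>

definition cut_less :: "real \<Rightarrow> real \<Rightarrow> real \<Rightarrow> bool" where
  "cut_less A x y \<longleftrightarrow> (x > A \<and> y \<le> A) \<or> ((x \<le> A \<longleftrightarrow> y \<le> A) \<and> x < y)"

text \<open>Rotating a word that is sorted by \<open>key\<close> until it ends with \<open>b\<close> amounts to cutting the cyclic order just
after \<open>b\<close>.\<close>

lemma left_of_rot_to_end:
  assumes "sorted_wrt (\<lambda>i j. key i < key j) w" "b \<in> set w"
  shows "left_of (rot_to_end w b) i j \<longleftrightarrow> i \<in> set w \<and> j \<in> set w \<and> cut_less (key b) (key i) (key j)"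
proof -
  obtain ys zs where w: "w = ys @ b # zs" "b \<notin> set ys"
    using split_list_first[OF assms(2)] by blast
  have srt: "sorted_wrt (\<lambda>i j. key i < key j) ys" "sorted_wrt (\<lambda>i j. key i < key j) zs"
    "\<And>y. y \<in> set ys \<Longrightarrow> key y < key b" "\<And>z. z \<in> set zs \<Longrightarrow> key b < key z"
    using assms(1) by (auto simp: w(1) sorted_wrt_append)
  have "sorted_wrt (\<lambda>i j. cut_less (key b) (key i) (key j)) ys"
    using srt(1) by (rule sorted_wrt_mono_rel[rotated]) (use srt(3) in \<open>force simp: cut_less_def\<close>)
  moreover have "sorted_wrt (\<lambda>i j. cut_less (key b) (key i) (key j)) zs"
    using srt(2) by (rule sorted_wrt_mono_rel[rotated]) (use srt(4) in \<open>force simp: cut_less_def\<close>)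
  ultimately have "sorted_wrt (\<lambda>i j. cut_less (key b) (key i) (key j)) (zs @ ys @ [b])"
    using srt(3,4) by (force simp: sorted_wrt_append cut_less_def)
  then have "left_of (zs @ ys @ [b]) i j \<longleftrightarrow>
      i \<in> set (zs @ ys @ [b]) \<and> j \<in> set (zs @ ys @ [b]) \<and> cut_less (key b) (key i) (key j)"
    by (rule left_of_sorted_wrt) (auto simp: cut_less_def)
  then show ?thesis using rot_to_end_split[OF w(2), of zs] w(1) by auto
qed

lemma real_nonzero_cases: "x \<noteq> 0 \<Longrightarrow> x < 0 \<or> x > 0" for x :: real
  by auto

lemma pos_mult_less_0: "a > 0 \<Longrightarrow> a * b < 0 \<longleftrightarrow> b < 0" for a b :: real
  using mult_less_cancel_left_pos[of a b 0] by simp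

lemma sgn_neq_iff: "x \<noteq> 0 \<and> y \<noteq> 0 \<and> sgn x \<noteq> sgn y \<longleftrightarrow> x * y < 0" for x y :: real
proof -
  consider "x = 0" | "y = 0" | "x < 0" "y < 0" | "x < 0" "y > 0" | "x > 0" "y < 0" | "x > 0" "y > 0"
    by linarith
  then show ?thesis by cases (simp_all add: mult_less_0_iff)
qed

text \<open>The product of the three terms on the right has the sign of \<open>u * w\<close>, so \<open>u * w\<close> is negative iff an odd number
of them is.\<close>

lemma mult_neg_parity:
  fixes P Q S u w :: real
  assumes "P \<noteq> 0" "Q \<noteq> 0" "S \<noteq> 0" "u \<noteq> 0" "w \<noteq> 0"
  shows "u * w < 0 \<longleftrightarrow> (u * (P * Q) > 0) \<noteq> ((w * (P * S) > 0) = (Q * S > 0))"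
  using assms[THEN real_nonzero_cases]
  by (elim disjE) (simp_all add: zero_less_mult_iff mult_less_0_iff)

text \<open>Here \<open>d i j\<close> is the area on \<open>z\<^sub>i\<close> and \<open>z\<^sub>j\<close> in the plane. The ratio \<open>d 2 j / d 1 j\<close> increases with the angle from
line \<open>1\<close> to line \<open>j\<close>, so it sorts the lines without mentioning angles. By the Pluecker relation,
comparing two ratios comes down to a sign of a product of areas, and both flips and
descents can be read off from such signs.\<close>

theorem chamber_word_exists:
  fixes d :: "nat \<Rightarrow> nat \<Rightarrow> real"
  assumes n: "n \<ge> 3"
    and anti: "\<And>i j. d i j = - d j i"
    and nz: "\<And>i j. i \<in> {1..n} \<Longrightarrow> j \<in> {1..n} \<Longrightarrow> i \<noteq> j \<Longrightarrow> d i j \<noteq> 0"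
    and pluecker: "\<And>i j. d 1 2 * d i j = d 1 i * d 2 j - d 1 j * d 2 i"
    and cons: "\<And>i. 1 \<le> i \<Longrightarrow> i < n \<Longrightarrow> d i (i + 1) > 0"
    and wrap: "(-1) ^ k * d 1 n > 0"
    and count: "card {i. 2 \<le> i \<and> i < n \<and> d 1 i * d 1 (i + 1) < 0} = k"
  shows "\<exists>w \<in> D_perms (k + 1) n. \<forall>a \<in> {1..n}.
    Flip n (\<lambda>j. if j < a then (-1) ^ (k + 1) * d a j else d a j) = I_set n w a - {a}"
proof -
  have d0: "d i i = 0" for i using anti[of i i] by simp
  define x where "x j = d 2 j / d 1 j" for j
  \<comment> \<open>Line \<open>1\<close> is the cut of the order, so it is put above all other lines.\<close>
  define X where "X j = (if j = 1 then 1 + (\<Sum>j\<in>{2..n}. \<bar>x j\<bar>) else x j)" for j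
  have X_less: "X p < X q \<longleftrightarrow> d p q * (d 1 p * d 1 q) > 0" if "p \<in> {2..n}" "q \<in> {2..n}" for p q
  proof -
    have "d 1 p \<noteq> 0" "d 1 q \<noteq> 0" using nz[of 1 p] nz[of 1 q] that by auto
    then have "X q - X p = (d 1 p * d 2 q - d 1 q * d 2 p) / (d 1 p * d 1 q)"
      using that by (simp add: X_def x_def field_simps)
    then have "X q - X p = d 1 2 * d p q / (d 1 p * d 1 q)"
      by (simp only: pluecker)
    moreover have "d 1 2 > 0" using cons[of 1] n by (simp add: numeral_2_eq_2)
    ultimately have "X q - X p > 0 \<longleftrightarrow> d p q * (d 1 p * d 1 q) > 0"
      by (simp add: zero_less_divide_iff zero_less_mult_iff mult_less_0_iff)
    then show ?thesis by simp
  qed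
  have X_desc: "X (i + 1) < X i \<longleftrightarrow> d 1 i * d 1 (i + 1) < 0" if "2 \<le> i" "i < n" for i
  proof -
    have pos: "d i (i + 1) > 0" using cons[of i] that by simp
    have "X (i + 1) < X i \<longleftrightarrow> d (i + 1) i * (d 1 (i + 1) * d 1 i) > 0"
      using X_less[of "i + 1" i] that by simp
    also have "d (i + 1) i * (d 1 (i + 1) * d 1 i) = - (d i (i + 1) * (d 1 i * d 1 (i + 1)))"
      unfolding anti[of "i + 1" i] by (simp only: mult.commute mult_minus_left mult_minus_right)
    also have "\<dots> > 0 \<longleftrightarrow> d i (i + 1) * (d 1 i * d 1 (i + 1)) < 0" by (rule neg_0_less_iff_less)
    also have "\<dots> \<longleftrightarrow> d 1 i * d 1 (i + 1) < 0"
      by (rule pos_mult_less_0[OF pos])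
    finally show ?thesis .
  qed
  have X_top: "X p < X 1" if "p \<in> {2..n}" for p
  proof -
    have "\<bar>x p\<bar> \<le> (\<Sum>j\<in>{2..n}. \<bar>x j\<bar>)" by (rule member_le_sum) (use that in auto)
    then show ?thesis using that by (auto simp: X_def)
  qed
  have X_inj: "X p \<noteq> X q" if "p \<in> {1..n}" "q \<in> {1..n}" "p \<noteq> q" for p q
  proof -
    have ne: "X p \<noteq> X q" if "p \<in> {2..n}" "q \<in> {2..n}" "p \<noteq> q" for p q
    proof -
      have "d p q * (d 1 p * d 1 q) \<noteq> 0" using nz[of p q] nz[of 1 p] nz[of 1 q] that by auto
      then have "d p q * (d 1 p * d 1 q) > 0 \<or> d q p * (d 1 q * d 1 p) > 0"
        using real_nonzero_cases[of "d p q * (d 1 p * d 1 q)"] by (auto simp: anti[of q p] mult_ac)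
      then show ?thesis using X_less[of p q] X_less[of q p] that by auto
    qed
    show ?thesis
      using ne[of p q] X_top[of p] X_top[of q] that
      by (cases "p = 1"; cases "q = 1") (auto simp: Suc_le_eq numeral_2_eq_2)
  qed
  define succ where "succ i = i mod n + 1" for i
  have succ: "succ i = (if i = n then 1 else i + 1)" if "i \<in> {1..n}" for i
  proof (cases "i = n")
    case False
    then have "i mod n = i" using that by (intro mod_less) simp
    then show ?thesis using False by (simp add: succ_def)
  qed (simp add: succ_def)
  \<comment> \<open>The label \<open>i\<close> stands for line \<open>i + 1\<close>, so the descent at \<open>i\<close> compares the lines
    \<open>i + 1\<close> and \<open>i\<close>, as does the flip at \<open>i\<close>.\<close>
  define key where "key i = X (succ i)" for i
  have succ_in: "succ i \<in> {1..n}" if "i \<in> {1..n}" for i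
    using n that by (simp add: succ)
  have key_inj: "inj_on key {1..n}"
  proof (rule inj_onI)
    fix i j assume *: "i \<in> {1..n}" "j \<in> {1..n}" "key i = key j"
    then have "succ i = succ j"
      using X_inj[OF succ_in succ_in, of i j] unfolding key_def by blast
    then have "(if i = n then 1 else i + 1) = (if j = n then 1 else j + 1)"
      by (simp only: succ[OF *(1)] succ[OF *(2)])
    then show "i = j" using *(1,2) by (cases "i = n"; cases "j = n") simp_all
  qed
  have key_n: "key i < key n" if "i \<in> {1..n}" "i \<noteq> n" for i
  proof -
    have "succ i \<in> {2..n}" "succ n = 1" using that n by (simp_all add: succ)
    then show ?thesis using X_top unfolding key_def by simp
  qed
  define w where "w = sort_key key [1..<Suc n]"
  have set_w: "set w = {1..n}" and dist_w: "distinct w" and len_w: "length w = n"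
    unfolding w_def by (simp_all add: atLeastLessThanSuc_atLeastAtMost del: upt_Suc)
  have "sorted (map key w)" unfolding w_def by (rule sorted_sort_key)
  moreover have "distinct (map key w)" using key_inj dist_w by (simp only: distinct_map set_w)
  ultimately have "sorted_wrt (<) (map key w)" unfolding strict_sorted_iff by blast
  then have srt: "sorted_wrt (\<lambda>i j. key i < key j) w" by (simp only: sorted_wrt_map)
  have last: "w ! (n - 1) = n"
  proof -
    have n_in: "n \<in> set w" using n by (simp add: set_w)
    then obtain q where q: "q < n" "w ! q = n" unfolding in_set_conv_nth len_w by blast
    have last_in: "w ! (n - 1) \<in> {1..n}"
      using nth_mem[of "n - 1" w] n unfolding len_w set_w by simp
    have "\<not> q < n - 1"
    proof
      assume "q < n - 1"
      then have "key n < key (w ! (n - 1))"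
        using sorted_wrt_nth_less[OF srt, of q "n - 1"] q n unfolding len_w by simp
      then show False using key_n[OF last_in] by (cases "w ! (n - 1) = n") simp_all
    qed
    then have "q = n - 1" using q by simp
    then show ?thesis using q by simp
  qed
  \<comment> \<open>The label of line \<open>i\<close>.\<close>
  define pr where "pr i = (if i = 1 then n else i - 1)" for i
  have pr: "pr i \<in> {1..n}" "key (pr i) = X i" if "i \<in> {1..n}" for i
  proof -
    show in_n: "pr i \<in> {1..n}" using that n by (auto simp: pr_def)
    have "succ (pr i) = i" unfolding succ[OF in_n] using that n by (auto simp: pr_def)
    then show "key (pr i) = X i" by (simp add: key_def)
  qed
  have cDes_iff: "i \<in> cDes_L n u \<longleftrightarrow> i \<in> {1..n} \<and> left_of u i (pr i)" for i u
    by (auto simp: cDes_L_def pr_def)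
  have I_set_iff: "i \<in> I_set n w a \<longleftrightarrow> i \<in> {1..n} \<and> cut_less (X a) (X (succ i)) (X i)" if a: "a \<in> {1..n}" for a i
  proof -
    have "I_set n w a = cDes_L n (rot_to_end w (pr a))" by (simp add: I_set_def pr_def)
    moreover have "left_of (rot_to_end w (pr a)) i (pr i) \<longleftrightarrow> cut_less (X a) (X (succ i)) (X i)"
      if "i \<in> {1..n}"
    proof -
      have "pr a \<in> set w" using pr(1)[OF a] by (simp only: set_w)
      then show ?thesis
        by (simp only: left_of_rot_to_end[OF srt] set_w pr[OF a] pr[OF that] key_def[of i] that simp_thms)
    qed
    ultimately show ?thesis using cDes_iff by blast
  qed
  have wD: "w \<in> D_perms (k + 1) n"
  proof -
    have "left_of w i j \<longleftrightarrow> i \<in> {1..n} \<and> j \<in> {1..n} \<and> key i < key j" for i j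
      unfolding set_w[symmetric] by (rule left_of_sorted_wrt[OF srt]) simp
    then have "left_of w i (pr i) \<longleftrightarrow> X (succ i) < X i" if "i \<in> {1..n}" for i
      by (simp only: pr[OF that] that key_def[of i] simp_thms)
    then have "i \<in> cDes_L n w \<longleftrightarrow> i \<in> {1..n} \<and> X (succ i) < X i" for i
      using cDes_iff by blast
    moreover have "i \<in> {1..n} \<and> X (succ i) < X i \<longleftrightarrow>
        i = 1 \<or> (2 \<le> i \<and> i < n \<and> d 1 i * d 1 (i + 1) < 0)" for i
    proof -
      consider "i \<notin> {1..n}" | "i = 1" | "i = n" | "2 \<le> i" "i < n" by fastforce
      then show ?thesis
      proof cases
        case 1
        then show ?thesis using n by auto
      next
        case 2
        then show ?thesis using X_top[of 2] n by (simp add: succ numeral_2_eq_2)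
      next
        case 3
        then show ?thesis using X_top[of n] n by (simp add: succ)
      next
        case 4
        then show ?thesis using X_desc[of i] by (simp add: succ)
      qed
    qed
    ultimately have "cDes_L n w = insert 1 {i. 2 \<le> i \<and> i < n \<and> d 1 i * d 1 (i + 1) < 0}" by blast
    moreover have "finite {i. 2 \<le> i \<and> i < n \<and> d 1 i * d 1 (i + 1) < 0}"
      by (rule finite_subset[of _ "{..<n}"]) auto
    ultimately have "card (cDes_L n w) = k + 1" using count by simp
    then show ?thesis
      using last set_w dist_w by (simp add: D_perms_def permutations_of_set_def)
  qed
  have "i \<in> Flip n (\<lambda>j. if j < a then (-1) ^ (k + 1) * d a j else d a j) \<longleftrightarrow> i \<in> I_set n w a - {a}"
    if a: "a \<in> {1..n}" for a i
  proof -
    define e :: real where "e = (-1) ^ (k + 1)"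
    have e: "e * e = 1" by (simp add: e_def flip: power_add)
    define v where "v j = (if j < a then e * d a j else d a j)" for j
    have vnz: "v j \<noteq> 0 \<longleftrightarrow> j \<noteq> a" if "j \<in> {1..n}" for j
    proof (cases "j = a")
      case True
      then show ?thesis using d0 by (simp add: v_def)
    next
      case False
      have "e \<noteq> 0" by (simp add: e_def)
      then show ?thesis using nz[OF a that] False by (simp add: v_def)
    qed
    have flip: "i \<in> Flip n v \<longleftrightarrow> i \<in> {1..n} \<and> v i * v (succ i) < 0"
      unfolding Flip_def succ_def by (simp add: sgn_neq_iff)
    have "v i * v (succ i) < 0 \<longleftrightarrow> i \<noteq> a \<and> cut_less (X a) (X (succ i)) (X i)" if i: "i \<in> {1..n}"
    proof -
      have si: "succ i \<in> {1..n}" "succ i \<noteq> i" using i n by (auto simp: succ)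
      consider "i = a" | "succ i = a" "i \<noteq> a" | "i \<noteq> a" "succ i \<noteq> a" by blast
      then show ?thesis
      proof cases
        case 1
        then show ?thesis using vnz[of a] a by auto
      next
        case 2
        then have "v (succ i) = 0" using vnz[of a] a by auto
        then show ?thesis using 2 by (auto simp: cut_less_def)
      next
        case 3
        consider "i = n" | "i < n" "a = 1" | "i = 1" "a \<noteq> 1" | "2 \<le> i" "i < n" "a \<noteq> 1"
          using i by (cases "i = n"; cases "a = 1"; cases "i = 1") simp_all
        then show ?thesis
        proof cases
          case 1
          have an: "a \<in> {2..n}" "a < n" using 3 1 a n by (auto simp: succ)
          have "v i * v (succ i) = - (e * (d a n * d 1 a))"
            using 1 an n anti[of a 1] by (simp add: v_def succ)
          also have "\<dots> = ((-1) ^ k) * (d a n * d 1 a)" by (simp add: e_def)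
          also have "\<dots> < 0 \<longleftrightarrow> d a n * (d 1 a * d 1 n) < 0"
          proof -
            have "(-1) ^ k * d 1 n > 0" by (rule wrap)
            then show ?thesis
              by (cases "even k") (auto simp: zero_less_mult_iff mult_less_0_iff)
          qed
          also have "\<dots> \<longleftrightarrow> X n < X a"
            using X_less[of n a] an anti[of n a] by (simp add: mult.commute)
          also have "\<dots> \<longleftrightarrow> cut_less (X a) (X 1) (X n)"
            using X_top[of a] X_top[of n] an n X_inj[of a n] by (auto simp: cut_less_def)
          finally show ?thesis using 1 3 n by (simp add: succ)
        next
          case 2
          then have i2: "2 \<le> i" using 3 i by auto
          have "v i * v (succ i) = d 1 i * d 1 (i + 1)" using 2 i by (simp add: v_def succ)
          also have "\<dots> < 0 \<longleftrightarrow> X (i + 1) < X i" using X_desc[of i] i2 2(1) by simp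
          also have "\<dots> \<longleftrightarrow> cut_less (X 1) (X (i + 1)) (X i)"
            using X_top[of i] X_top[of "i + 1"] i2 2(1) by (auto simp: cut_less_def)
          finally show ?thesis using 2 3 i by (simp add: succ)
        next
          case c3: 3
          have a3: "a \<in> {2..n}" "a \<noteq> 2" using c3 a n 3(2) i by (auto simp: succ numeral_2_eq_2)
          have eq: "d a 2 * (d 1 a * d 1 2) = - (d 1 2 * (d a 1 * d a 2))"
            unfolding anti[of a 1] by (simp only: mult_ac mult_minus_left mult_minus_right minus_minus)
          have pos: "d 1 2 > 0" using cons[of 1] n by (simp add: numeral_2_eq_2)
          have "X a < X 2 \<longleftrightarrow> d a 2 * (d 1 a * d 1 2) > 0" by (rule X_less) (use a3(1) n in auto)
          also have "\<dots> \<longleftrightarrow> d 1 2 * (d a 1 * d a 2) < 0" unfolding eq by (rule neg_0_less_iff_less)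
          also have "\<dots> \<longleftrightarrow> d a 1 * d a 2 < 0"
            by (rule pos_mult_less_0[OF pos])
          finally have "X a < X 2 \<longleftrightarrow> d a 1 * d a 2 < 0" .
          moreover have "v i * v (succ i) = e * e * (d a 1 * d a 2)"
            using c3 a3 n i by (simp add: v_def succ numeral_2_eq_2)
          ultimately have "v i * v (succ i) < 0 \<longleftrightarrow> X a < X 2" using e by simp
          also have "\<dots> \<longleftrightarrow> cut_less (X a) (X 2) (X 1)"
            using X_top[of 2] X_top[of a] a3 n by (auto simp: cut_less_def)
          finally show ?thesis using c3 3 i n by (simp add: succ numeral_2_eq_2)
        next
          case 4
          have a4: "a \<in> {2..n}" "i \<in> {2..n}" "i + 1 \<in> {2..n}" "a \<noteq> i" "a \<noteq> i + 1"
            using 4 a 3 i by (simp_all add: succ)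
          have "v i * v (succ i) = (if i < a then e * e else 1) * (d a i * d a (i + 1))"
            using 4 a4(4,5) i by (simp add: v_def succ)
          then have vv: "v i * v (succ i) = d a i * d a (i + 1)" using e by simp
          have dnz: "d a i \<noteq> 0" "d a (i + 1) \<noteq> 0" "d 1 a \<noteq> 0" "d 1 i \<noteq> 0" "d 1 (i + 1) \<noteq> 0"
            by (rule nz; use a4 in simp)+
          have ord: "X a < X i \<longleftrightarrow> d a i * (d 1 a * d 1 i) > 0"
            "X a < X (i + 1) \<longleftrightarrow> d a (i + 1) * (d 1 a * d 1 (i + 1)) > 0"
            "X i < X (i + 1) \<longleftrightarrow> d 1 i * d 1 (i + 1) > 0"
          proof -
            show "X a < X i \<longleftrightarrow> d a i * (d 1 a * d 1 i) > 0"
              by (rule X_less[OF a4(1,2)])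
            show "X a < X (i + 1) \<longleftrightarrow> d a (i + 1) * (d 1 a * d 1 (i + 1)) > 0"
              by (rule X_less[OF a4(1,3)])
            have "X i < X (i + 1) \<longleftrightarrow> d i (i + 1) * (d 1 i * d 1 (i + 1)) > 0"
              by (rule X_less[OF a4(2,3)])
            also have "\<dots> \<longleftrightarrow> d 1 i * d 1 (i + 1) > 0"
              using mult_less_cancel_left_pos[of "d i (i + 1)" 0] cons[of i] 4 by simp
            finally show "X i < X (i + 1) \<longleftrightarrow> d 1 i * d 1 (i + 1) > 0" .
          qed
          have ne: "X a \<noteq> X i" "X a \<noteq> X (i + 1)" "X i \<noteq> X (i + 1)"
            by (rule X_inj; use a4 in simp)+
          have "v i * v (succ i) < 0 \<longleftrightarrow> cut_less (X a) (X (i + 1)) (X i)"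
            unfolding vv mult_neg_parity[OF dnz(3-5) dnz(1,2)]
            unfolding ord[symmetric] cut_less_def using ne by linarith
          then show ?thesis using 3 4 i by (simp add: succ)
        qed
      qed
    qed
    moreover have "(\<lambda>j. if j < a then (-1) ^ (k + 1) * d a j else d a j) = v"
      by (rule ext) (simp only: v_def e_def)
    ultimately show ?thesis
      using flip I_set_iff[OF a, of i] by auto
  qed
  then show ?thesis using wD by blast
qed

section \<open>Matrices and the amplituhedron\<close>

lemma pick_incr:
  assumes "incr m n s" "a < m"
  shows "pick (s ` {..<m}) a = s a"
proof -
  have "{x \<in> s ` {..<m}. x < s a} = s ` {..<a}"
  proof (intro equalityI subsetI)
    fix x assume "x \<in> {x \<in> s ` {..<m}. x < s a}"
    then obtain b where b: "b < m" "x = s b" "s b < s a" by auto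
    have "\<not> a \<le> b" using incr_less[OF assms(1), of a b] b by (cases "a = b") auto
    then show "x \<in> s ` {..<a}" using b by auto
  next
    fix x assume "x \<in> s ` {..<a}"
    then obtain b where "b < a" "x = s b" by auto
    then show "x \<in> {x \<in> s ` {..<m}. x < s a}"
      using incr_less[OF assms(1), of b a] assms(2) by auto
  qed
  moreover have "card (s ` {..<a}) = a"
    using incr_inj[OF assms(1)] assms(2) by (subst card_image) (auto intro: inj_on_subset)
  ultimately show ?thesis
    using pick_card_in_set[of "s a" "s ` {..<m}"] assms(2) by simp
qed

lemma incr_image:
  assumes "incr m n s"
  shows "s ` {..<m} \<subseteq> {..<n}" "card (s ` {..<m}) = m"
  using assms incr_bound[OF assms] by (auto simp: card_image incr_inj)

lemma det_submatrix_rows: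
  assumes "A \<in> carrier_mat n p" "incr p n s"
  shows "det (submatrix A (s ` {..<p}) UNIV) = rdet p (\<lambda>a c. A $$ (s a, c))"
proof -
  have "{i. i < n \<and> i \<in> s ` {..<p}} = s ` {..<p}" using incr_image(1)[OF assms(2)] by auto
  then have "submatrix A (s ` {..<p}) UNIV = mat p p (\<lambda>(a, c). A $$ (s a, c))"
    using assms(1) incr_image(2)[OF assms(2)]
    by (intro eq_matI) (auto simp: submatrix_def pick_incr[OF assms(2)] pick_UNIV)
  then show ?thesis by (simp add: rdet_def)
qed

lemma det_submatrix_columns:
  assumes "A \<in> carrier_mat p n" "incr p n s"
  shows "det (submatrix A UNIV (s ` {..<p})) = rdet p (\<lambda>a r. A $$ (r, s a))"
proof -
  have "{i. i < n \<and> i \<in> s ` {..<p}} = s ` {..<p}" using incr_image(1)[OF assms(2)] by auto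
  then have "submatrix A UNIV (s ` {..<p}) = (mat p p (\<lambda>(a, r). A $$ (r, s a)))\<^sup>T"
    using assms(1) incr_image(2)[OF assms(2)]
    by (intro eq_matI) (auto simp: submatrix_def pick_incr[OF assms(2)] pick_UNIV)
  then show ?thesis by (simp add: rdet_def det_transpose[of _ p])
qed

lemma pos_mats_iff:
  "Z \<in> pos_mats n p \<longleftrightarrow> Z \<in> carrier_mat n p \<and> pos_rows p n (\<lambda>i c. Z $$ (i, c))"
proof -
  have "(\<forall>I \<subseteq> {..<n}. card I = p \<longrightarrow> det (submatrix Z I UNIV) > 0) \<longleftrightarrow> pos_rows p n (\<lambda>i c. Z $$ (i, c))"
    if Z: "Z \<in> carrier_mat n p"
  proof
    assume "\<forall>I \<subseteq> {..<n}. card I = p \<longrightarrow> det (submatrix Z I UNIV) > 0"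
    then show "pos_rows p n (\<lambda>i c. Z $$ (i, c))"
      unfolding pos_rows_def using incr_image det_submatrix_rows[OF Z] by metis
  next
    assume pos: "pos_rows p n (\<lambda>i c. Z $$ (i, c))"
    show "\<forall>I \<subseteq> {..<n}. card I = p \<longrightarrow> det (submatrix Z I UNIV) > 0"
    proof (intro allI impI)
      fix I assume "I \<subseteq> {..<n}" "card I = p"
      then obtain s where "incr p n s" "s ` {..<p} = I" using incr_enumerates by blast
      then show "det (submatrix Z I UNIV) > 0"
        using pos det_submatrix_rows[OF Z] unfolding pos_rows_def by metis
    qed
  qed
  then show ?thesis by (auto simp: pos_mats_def)
qed

abbreviation column_vectors :: "real mat \<Rightarrow> nat \<Rightarrow> nat \<Rightarrow> real" where
  "column_vectors C \<equiv> \<lambda>j r. C $$ (r, j)"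

lemma nonneg_minors_iff:
  assumes C: "C \<in> carrier_mat k n"
  shows "(\<forall>J \<subseteq> {..<n}. card J = k \<longrightarrow> det (submatrix C UNIV J) \<ge> 0) \<longleftrightarrow> nonneg_rows k n (column_vectors C)"
proof
  assume "\<forall>J \<subseteq> {..<n}. card J = k \<longrightarrow> det (submatrix C UNIV J) \<ge> 0"
  then show "nonneg_rows k n (column_vectors C)"
    unfolding nonneg_rows_def using incr_image det_submatrix_columns[OF C] by metis
next
  assume pos: "nonneg_rows k n (column_vectors C)"
  show "\<forall>J \<subseteq> {..<n}. card J = k \<longrightarrow> det (submatrix C UNIV J) \<ge> 0"
  proof (intro allI impI)
    fix J assume "J \<subseteq> {..<n}" "card J = k"
    then obtain s where "incr k n s" "s ` {..<k} = J" using incr_enumerates by blast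
    then show "det (submatrix C UNIV J) \<ge> 0"
      using pos det_submatrix_columns[OF C] unfolding nonneg_rows_def by metis
  qed
qed

text \<open>For a \<open>k\<close> by \<open>n\<close> matrix, rank \<open>k\<close>, a nonzero maximal minor and independence of the rows are equivalent; the next
lemmas go around this circle.\<close>

definition rows_independent :: "nat \<Rightarrow> nat \<Rightarrow> real mat \<Rightarrow> bool" where
  "rows_independent k n C \<longleftrightarrow>
     (\<forall>x. (\<forall>j<n. (\<Sum>r<k. x r * C $$ (r, j)) = 0) \<longrightarrow> (\<forall>r<k. x r = 0))"

lemma full_rank_minor:
  assumes "C \<in> full_rank_mats k n"
  shows "\<exists>s. incr k n s \<and> rdet k (\<lambda>a. column_vectors C (s a)) \<noteq> 0"
proof -
  have C: "C \<in> carrier_mat k n" and rk: "vec_space.rank k C = k"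
    using assms by (auto simp: full_rank_mats_def)
  interpret V: vec_space "TYPE(real)" k .
  obtain S where S: "maximal S (\<lambda>T. T \<subseteq> set (cols C) \<and> V.lin_indpt T)"
    using maximal_exists[of "\<lambda>T. T \<subseteq> set (cols C) \<and> V.lin_indpt T" "card (set (cols C))" "{}"]
    by (meson List.finite_set card_mono empty_iff empty_subsetI V.finite_lin_indpt2 rev_finite_subset)
  then have cardS: "card S = k" using V.rank_card_indpt[OF C S] rk by simp
  have SC: "S \<subseteq> set (cols C)" "V.lin_indpt S" using S by (auto simp: maximal_def)
  have "\<forall>v\<in>S. \<exists>j<n. col C j = v"
    using SC(1) C by (metis carrier_matD(2) cols_length cols_nth in_set_conv_nth subsetD)
  then obtain f where f: "\<And>v. v \<in> S \<Longrightarrow> f v < n \<and> col C (f v) = v" by metis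
  have "inj_on f S" using f by (metis inj_onI)
  then have "card (f ` S) = k" "f ` S \<subseteq> {..<n}" using f cardS by (auto simp: card_image)
  then obtain s where s: "incr k n s" "s ` {..<k} = f ` S" using incr_enumerates by metis
  define A where "A = mat k k (\<lambda>(r, a). C $$ (r, s a))"
  have A: "A \<in> carrier_mat k k" by (simp add: A_def)
  have colA: "col A a = col C (s a)" if "a < k" for a
    using that C incr_bound[OF s(1) that] by (intro eq_vecI) (auto simp: A_def)
  have "set (cols A) = (\<lambda>a. col C (s a)) ` {..<k}"
    using A colA by (auto simp: cols_def)
  also have "\<dots> = col C ` f ` S" using s(2) by (metis image_image)
  also have "\<dots> = S" using f by (simp add: image_image cong: image_cong)
  finally have setA: "set (cols A) = S" .
  then have dist: "distinct (cols A)" using cardS A by (intro card_distinct) simp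
  have "V.rank A = k" using V.lin_indpt_full_rank[OF A dist] SC(2) setA by simp
  then have "det A \<noteq> 0" using V.det_rank_iff[OF A] by simp
  moreover have "A = (mat k k (\<lambda>(a, r). C $$ (r, s a)))\<^sup>T" by (auto simp: A_def)
  ultimately have "rdet k (\<lambda>a. column_vectors C (s a)) \<noteq> 0"
    by (simp add: rdet_def det_transpose[of _ k])
  then show ?thesis using s(1) by blast
qed

lemma minor_rows_independent:
  assumes "incr k n s" "rdet k (\<lambda>a. column_vectors C (s a)) \<noteq> 0"
  shows "rows_independent k n C"
  unfolding rows_independent_def
proof (intro allI impI)
  fix x r assume *: "\<forall>j<n. (\<Sum>r<k. x r * C $$ (r, j)) = 0" "r < k"
  show "x r = 0"
    by (rule rdet_nonzero_columns_independent[OF assms(2) _ *(2)])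
       (use * incr_bound[OF assms(1)] in \<open>simp add: mult.commute\<close>)
qed

text \<open>Over the reals \<open>C C\<^sup>T\<close> is invertible if the rows of \<open>C\<close> are independent, because \<open>v\<^sup>T C C\<^sup>T v\<close> is the squared
length of \<open>C\<^sup>T v\<close>. So the columns of \<open>C\<close> span.\<close>

lemma rows_independent_full_rank:
  assumes C: "C \<in> carrier_mat k n" and indep: "rows_independent k n C"
  shows "C \<in> full_rank_mats k n"
proof -
  interpret V: vec_space "TYPE(real)" k .
  let ?G = "C * C\<^sup>T"
  have G: "?G \<in> carrier_mat k k" using C by simp
  have "det ?G \<noteq> 0"
  proof
    assume "det ?G = 0"
    then obtain v where v: "v \<in> carrier_vec k" "v \<noteq> 0\<^sub>v k" "?G *\<^sub>v v = 0\<^sub>v k"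
      using det_0_iff_vec_prod_zero_field[OF G] by blast
    let ?u = "C\<^sup>T *\<^sub>v v"
    have "?u \<bullet> ?u = v \<bullet> (C *\<^sub>v ?u)"
      using transpose_vec_mult_scalar[OF C _ v(1), of ?u] C v(1) by (simp add: comm_scalar_prod[of _ n])
    also have "C *\<^sub>v ?u = ?G *\<^sub>v v" using assoc_mult_mat_vec[OF C _ v(1), of "C\<^sup>T"] C by simp
    finally have "?u \<bullet> ?u = 0" using v by simp
    then have "(\<Sum>j<n. (?u $ j)\<^sup>2) = 0"
      using C by (simp add: scalar_prod_def power2_eq_square lessThan_atLeast0)
    then have "?u $ j = 0" if "j < n" for j
      using that by (subst (asm) sum_nonneg_eq_0_iff) auto
    moreover have "?u $ j = (\<Sum>r<k. v $ r * C $$ (r, j))" if "j < n" for j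
      using that C v(1) by (auto simp: scalar_prod_def lessThan_atLeast0 mult.commute intro!: sum.cong)
    ultimately have "v $ r = 0" if "r < k" for r
      using indep that by (simp add: rows_independent_def)
    then show False using v(1,2) by (metis carrier_vecD eq_vecI index_zero_vec)
  qed
  have "carrier_vec k \<subseteq> V.col_space C"
  proof
    fix w :: "real vec" assume w: "w \<in> carrier_vec k"
    obtain B where B: "B \<in> carrier_mat k k" "?G * B = 1\<^sub>m k"
      using det_non_zero_imp_unit[OF G \<open>det ?G \<noteq> 0\<close>] unfolding Units_def ring_mat_def by auto
    have "C *\<^sub>v (C\<^sup>T *\<^sub>v (B *\<^sub>v w)) = (?G * B) *\<^sub>v w"
      using C B(1) w by (simp add: assoc_mult_mat_vec[of _ k n _ k] assoc_mult_mat_vec[of _ k k _ k])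
    then have "C *\<^sub>v (C\<^sup>T *\<^sub>v (B *\<^sub>v w)) = w" using B(2) w by simp
    moreover have "C\<^sup>T *\<^sub>v (B *\<^sub>v w) \<in> carrier_vec n" using C B(1) w by auto
    ultimately show "w \<in> V.col_space C" using V.col_space_eq[OF C] C w by auto
  qed
  moreover have "V.col_space C \<subseteq> carrier_vec k" using V.col_space_eq[OF C] C by auto
  ultimately have "V.span (set (cols C)) = carrier_vec k" by (simp add: V.col_space_def)
  then have "V.rank C = V.dim"
    unfolding V.rank_def by (simp add: module_vec_def)
  then show ?thesis using C by (simp add: full_rank_mats_def V.dim_is_n)
qed

lemma full_rank_iff_rows_independent:
  assumes "C \<in> carrier_mat k n"
  shows "C \<in> full_rank_mats k n \<longleftrightarrow> rows_independent k n C"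
  using assms full_rank_minor minor_rows_independent rows_independent_full_rank by blast

lemma full_rank_carrier: "C \<in> full_rank_mats k n \<Longrightarrow> C \<in> carrier_mat k n"
  by (simp add: full_rank_mats_def)

lemma rowspan_eq:
  assumes "C \<in> carrier_mat k n"
  shows "rowspan n C = {w \<in> carrier_vec n. \<exists>x \<in> carrier_vec k. C\<^sup>T *\<^sub>v x = w}"
  using vec_space.row_space_eq[OF assms] assms by (simp add: rowspan_def)

lemma rowspan_mult_subset:
  assumes "g \<in> carrier_mat k' k" "C \<in> carrier_mat k n"
  shows "rowspan n (g * C) \<subseteq> rowspan n C"
proof
  fix w assume "w \<in> rowspan n (g * C)"
  then obtain x where x: "x \<in> carrier_vec k'" "(g * C)\<^sup>T *\<^sub>v x = w" "w \<in> carrier_vec n"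
    using rowspan_eq[of "g * C" k' n] assms by auto
  have "(g * C)\<^sup>T *\<^sub>v x = C\<^sup>T *\<^sub>v (g\<^sup>T *\<^sub>v x)"
    using assms x(1) by (simp add: transpose_mult[OF assms] assoc_mult_mat_vec[of _ n k _ k'])
  then show "w \<in> rowspan n C"
    unfolding rowspan_eq[OF assms(2)] using x assms by (intro CollectI conjI bexI[of _ "g\<^sup>T *\<^sub>v x"]) auto
qed

lemma rowspan_subset_factor:
  assumes "rowspan n C \<subseteq> rowspan n C'" "C \<in> carrier_mat k n" "C' \<in> carrier_mat k n"
  shows "\<exists>g \<in> carrier_mat k k. C = g * C'"
proof -
  have "\<exists>x \<in> carrier_vec k. C'\<^sup>T *\<^sub>v x = row C r" if "r < k" for r
  proof -
    have "C\<^sup>T *\<^sub>v unit_vec k r = row C r"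
      using that assms(2) by (intro eq_vecI) auto
    then have "row C r \<in> rowspan n C"
      using assms(2) that by (auto simp: rowspan_eq[OF assms(2)])
    then show ?thesis using assms(1,3) rowspan_eq by blast
  qed
  then obtain x where x: "\<And>r. r < k \<Longrightarrow> x r \<in> carrier_vec k \<and> C'\<^sup>T *\<^sub>v x r = row C r" by metis
  define g where "g = mat k k (\<lambda>(r, c). x r $ c)"
  have "C $$ (r, j) = (g * C') $$ (r, j)" if "r < k" "j < n" for r j
  proof -
    have xr: "x r \<in> carrier_vec k" and row: "C'\<^sup>T *\<^sub>v x r = row C r" using x[OF that(1)] by auto
    have "C $$ (r, j) = row C r $ j" using that assms(2) by simp
    also have "\<dots> = (C'\<^sup>T *\<^sub>v x r) $ j" by (simp only: row)
    also have "\<dots> = (g * C') $$ (r, j)"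
      using xr that assms(3)
      by (auto simp: g_def scalar_prod_def mult.commute intro!: sum.cong)
    finally show ?thesis .
  qed
  then have "C = g * C'" using assms(2,3) by (intro eq_matI) (auto simp: g_def)
  then show ?thesis by (auto simp: g_def)
qed

lemma rowspan_mult_right:
  assumes "rowspan n C = rowspan n C'" "C \<in> carrier_mat k n" "C' \<in> carrier_mat k n" "Z \<in> carrier_mat n q"
  shows "rowspan q (C * Z) = rowspan q (C' * Z)"
proof -
  have "rowspan q (A * Z) \<subseteq> rowspan q (B * Z)"
    if AB: "rowspan n A = rowspan n B" "A \<in> carrier_mat k n" "B \<in> carrier_mat k n" for A B
  proof -
    obtain g where g: "g \<in> carrier_mat k k" "A = g * B"
      using rowspan_subset_factor[of n A B k] AB by auto
    have "A * Z = g * (B * Z)" using g AB assms(4) by simp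
    then show ?thesis using rowspan_mult_subset[OF g(1), of "B * Z" q] AB assms(4) by simp
  qed
  from this[OF assms(1-3)] this[OF assms(1)[symmetric] assms(3,2)] show ?thesis by blast
qed

text \<open>A point of the nonnegative Grassmannian may also be given by a matrix whose minors are nonpositive. Passing
to a nonnegative representative does not change the image, as it only multiplies by a \<open>k\<close> by
\<open>k\<close> matrix on the left.\<close>

lemma amplituhedron_eq:
  assumes "Z \<in> carrier_mat n (k + 2)"
  shows "amplituhedron n k Z =
    {rowspan (k + 2) (C * Z) | C. C \<in> full_rank_mats k n \<and> nonneg_rows k n (column_vectors C)}"
proof (intro equalityI subsetI)
  fix Y assume "Y \<in> amplituhedron n k Z"
  then obtain C C' where C: "Y = rowspan (k + 2) (C * Z)" "C \<in> full_rank_mats k n" "C' \<in> full_rank_mats k n"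
    "rowspan n C' = rowspan n C" "\<forall>J \<subseteq> {..<n}. card J = k \<longrightarrow> det (submatrix C' UNIV J) \<ge> 0"
    unfolding amplituhedron_def nonneg_grassmannian_def by blast
  have "nonneg_rows k n (column_vectors C')"
    using nonneg_minors_iff C(3,5) full_rank_carrier by blast
  moreover have "Y = rowspan (k + 2) (C' * Z)"
    using rowspan_mult_right[OF C(4) full_rank_carrier[OF C(3)] full_rank_carrier[OF C(2)] assms] C(1)
    by (simp only:)
  ultimately show "Y \<in> {rowspan (k + 2) (C * Z) | C. C \<in> full_rank_mats k n \<and> nonneg_rows k n (column_vectors C)}"
    using C(3) by blast
next
  fix Y assume "Y \<in> {rowspan (k + 2) (C * Z) | C. C \<in> full_rank_mats k n \<and> nonneg_rows k n (column_vectors C)}"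
  then obtain C where C: "Y = rowspan (k + 2) (C * Z)" "C \<in> full_rank_mats k n" "nonneg_rows k n (column_vectors C)"
    by blast
  then have "rowspan n C \<in> nonneg_grassmannian k n"
    unfolding nonneg_grassmannian_def using nonneg_minors_iff[OF full_rank_carrier] by blast
  then show "Y \<in> amplituhedron n k Z" unfolding amplituhedron_def using C by blast
qed

lemma nonneg_full_rank_pos_minor:
  assumes "C \<in> full_rank_mats k n" "nonneg_rows k n (column_vectors C)"
  obtains s where "incr k n s" "rdet k (\<lambda>a. column_vectors C (s a)) > 0"
proof -
  obtain s where s: "incr k n s" "rdet k (\<lambda>a. column_vectors C (s a)) \<noteq> 0"
    using full_rank_minor[OF assms(1)] by blast
  moreover have "rdet k (\<lambda>a. column_vectors C (s a)) \<ge> 0"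
    using assms(2) s(1) by (simp add: nonneg_rows_def)
  ultimately show ?thesis using that by fastforce
qed

lemma alternates_mono: "alternates m n v \<Longrightarrow> m' \<le> m \<Longrightarrow> alternates m' n v"
  unfolding alternates_def using incr_mono by (meson less_le_trans)

lemma mult_entry:
  assumes "C \<in> carrier_mat k n" "Z \<in> carrier_mat n q" "r < k" "c < q"
  shows "(C * Z) $$ (r, c) = (\<Sum>j<n. C $$ (r, j) * Z $$ (j, c))"
  using assms by (auto simp: scalar_prod_def lessThan_atLeast0 intro!: sum.cong)

text \<open>A vector of the row space of \<open>C\<close> has at most \<open>k - 1\<close> sign changes, and a nonzero relation among the rows of \<open>Z\<close> has
at least \<open>k + 2\<close>. So the row space of \<open>C\<close> meets the left kernel of \<open>Z\<close> only in zero.\<close>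

theorem nonneg_mult_full_rank:
  assumes C: "C \<in> full_rank_mats k n" "nonneg_rows k n (column_vectors C)"
    and Z: "Z \<in> pos_mats n (k + 2)" and kn: "k + 2 \<le> n"
  shows "C * Z \<in> full_rank_mats k (k + 2)"
proof (rule rows_independent_full_rank)
  have Cc: "C \<in> carrier_mat k n" using C(1) by (rule full_rank_carrier)
  have Zc: "Z \<in> carrier_mat n (k + 2)" "pos_rows (k + 2) n (\<lambda>i c. Z $$ (i, c))"
    using Z by (auto simp: pos_mats_iff)
  show "C * Z \<in> carrier_mat k (k + 2)" using Cc Zc by simp
  show "rows_independent k (k + 2) (C * Z)"
    unfolding rows_independent_def
  proof (intro allI impI)
    fix x r assume *: "\<forall>c<k + 2. (\<Sum>r<k. x r * (C * Z) $$ (r, c)) = 0" "r < k"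
    define v where "v j = (\<Sum>r<k. C $$ (r, j) * x r)" for j
    have ker: "(\<Sum>j<n. v j * Z $$ (j, c)) = 0" if "c < k + 2" for c
    proof -
      have "(\<Sum>j<n. v j * Z $$ (j, c)) = (\<Sum>r<k. x r * (\<Sum>j<n. C $$ (r, j) * Z $$ (j, c)))"
        unfolding v_def sum_distrib_left sum_distrib_right by (subst sum.swap) (simp add: mult_ac)
      also have "\<dots> = (\<Sum>r<k. x r * (C * Z) $$ (r, c))"
        using mult_entry[OF Cc Zc(1)] that by simp
      finally show ?thesis using * that by simp
    qed
    obtain s where s: "incr k n s" "rdet k (\<lambda>a. column_vectors C (s a)) > 0"
      using nonneg_full_rank_pos_minor[OF C] by blast
    have "v j = 0" if "j < n" for j
    proof (rule ccontr)
      assume "v j \<noteq> 0"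
      then have "alternates (Suc (k + 2)) n v"
        using kernel_alternates[where v = v, OF Zc(2) kn ker that] by blast
      then have "alternates (Suc k) n v" by (rule alternates_mono) simp
      then show False
        using nonneg_range_not_alternates[OF C(2) s, of x] unfolding v_def by blast
    qed
    then have "\<forall>j<n. (\<Sum>r<k. x r * C $$ (r, j)) = 0" by (simp add: v_def mult.commute)
    moreover have "rows_independent k n C"
      by (rule minor_rows_independent[OF s(1)]) (use s(2) in simp)
    ultimately show "x r = 0" using \<open>r < k\<close> unfolding rows_independent_def by blast
  qed
qed

section \<open>The topology of full-rank matrices\<close>

lemma openin_full_rank_topology:
  "openin (full_rank_topology k n) U \<longleftrightarrow> U \<subseteq> full_rank_mats k n \<and>
     (\<forall>C \<in> U. \<exists>\<epsilon>>0. \<forall>C' \<in> full_rank_mats k n.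
        (\<forall>r<k. \<forall>c<n. \<bar>C' $$ (r, c) - C $$ (r, c)\<bar> < \<epsilon>) \<longrightarrow> C' \<in> U)"
    (is "?open \<longleftrightarrow> ?sub \<and> ?eps")
proof -
  let ?I = "{..<k} \<times> {..<n}"
  let ?F = "\<lambda>C. restrict (\<lambda>ij. C $$ ij) ?I :: nat \<times> nat \<Rightarrow> real"
  let ?P = "product_topology (\<lambda>_. euclideanreal) ?I"
  have open_iff: "?open \<longleftrightarrow> (\<exists>V. openin ?P V \<and> U = ?F -` V \<inter> full_rank_mats k n)"
    unfolding full_rank_topology_def by (rule openin_pullback_topology)
  show ?thesis
  proof
    assume ?open
    then obtain V where V: "openin ?P V" "U = ?F -` V \<inter> full_rank_mats k n" using open_iff by blast
    have "\<exists>\<epsilon>>0. \<forall>C' \<in> full_rank_mats k n.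
        (\<forall>r<k. \<forall>c<n. \<bar>C' $$ (r, c) - C $$ (r, c)\<bar> < \<epsilon>) \<longrightarrow> C' \<in> U" if "C \<in> U" for C
    proof -
      have "?F C \<in> V" using V(2) that by simp
      from product_topology_open_contains_basis[OF V(1) this]
      obtain X where X: "?F C \<in> (\<Pi>\<^sub>E ij\<in>?I. X ij)" "\<forall>ij. openin euclideanreal (X ij)"
        "(\<Pi>\<^sub>E ij\<in>?I. X ij) \<subseteq> V"
        by (elim exE conjE) (rule that)
      have "\<exists>e>0. \<forall>x. \<bar>x - C $$ ij\<bar> < e \<longrightarrow> x \<in> X ij" if "ij \<in> ?I" for ij
      proof -
        have "?F C ij \<in> X ij" using X(1) that by (rule PiE_mem)
        then have mem: "C $$ ij \<in> X ij" using that by (simp only: restrict_apply if_True)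
        have "open (X ij)" by (rule open_openin[THEN iffD2]) (rule X(2)[rule_format])
        then have "\<exists>e>0. \<forall>x. dist x (C $$ ij) < e \<longrightarrow> x \<in> X ij"
          unfolding open_dist using mem by (rule bspec)
        then show ?thesis by (simp only: dist_real_def)
      qed
      then obtain e where e: "\<And>ij. ij \<in> ?I \<Longrightarrow> e ij > 0"
        "\<And>ij x. ij \<in> ?I \<Longrightarrow> \<bar>x - C $$ ij\<bar> < e ij \<Longrightarrow> x \<in> X ij"
        by (metis (no_types, lifting))
      define \<epsilon> where "\<epsilon> = Min (insert 1 (e ` ?I))"
      have "\<epsilon> > 0" unfolding \<epsilon>_def using e(1) by (subst Min_gr_iff) auto
      moreover have "C' \<in> U" if C': "C' \<in> full_rank_mats k n"
        "\<forall>r<k. \<forall>c<n. \<bar>C' $$ (r, c) - C $$ (r, c)\<bar> < \<epsilon>" for C'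
      proof -
        have "C' $$ ij \<in> X ij" if "ij \<in> ?I" for ij
        proof -
          have "\<epsilon> \<le> e ij" unfolding \<epsilon>_def using that by (intro Min_le) auto
          then show ?thesis using e(2)[OF that, of "C' $$ ij"] C'(2) that by (cases ij) fastforce
        qed
        then have "?F C' \<in> (\<Pi>\<^sub>E ij\<in>?I. X ij)" by (intro restrict_PiE_iff[THEN iffD2]) blast
        then have "?F C' \<in> V" using X(3) by (rule subsetD[rotated])
        then show ?thesis using V(2) C'(1) by simp
      qed
      ultimately show ?thesis by blast
    qed
    moreover have ?sub using V(2) by simp
    ultimately show "?sub \<and> ?eps" by blast
  next
    assume *: "?sub \<and> ?eps"
    then obtain \<epsilon> where \<epsilon>: "\<And>C. C \<in> U \<Longrightarrow> \<epsilon> C > 0"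
      "\<And>C C'. C \<in> U \<Longrightarrow> C' \<in> full_rank_mats k n \<Longrightarrow>
         (\<forall>r<k. \<forall>c<n. \<bar>C' $$ (r, c) - C $$ (r, c)\<bar> < \<epsilon> C) \<Longrightarrow> C' \<in> U" by metis
    let ?B = "\<lambda>C. \<Pi>\<^sub>E ij\<in>?I. {C $$ ij - \<epsilon> C <..< C $$ ij + \<epsilon> C}"
    have "openin ?P (?B C)" for C
      by (subst openin_PiE) auto
    then have "openin ?P (\<Union> (?B ` U))" by (intro openin_Union) auto
    moreover have "U = ?F -` \<Union> (?B ` U) \<inter> full_rank_mats k n"
    proof (intro equalityI subsetI)
      fix C assume C: "C \<in> U"
      then have "?F C \<in> ?B C" using \<epsilon>(1) by (intro restrict_PiE_iff[THEN iffD2]) simp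
      then have "?F C \<in> \<Union> (?B ` U)" using C by (rule UN_I[rotated])
      then show "C \<in> ?F -` \<Union> (?B ` U) \<inter> full_rank_mats k n" using * C by (simp only: Int_iff vimage_eq) blast
    next
      fix C' assume "C' \<in> ?F -` \<Union> (?B ` U) \<inter> full_rank_mats k n"
      then have C': "?F C' \<in> \<Union> (?B ` U)" "C' \<in> full_rank_mats k n" by (simp_all only: Int_iff vimage_eq)
      from C'(1) obtain C where C: "C \<in> U" "?F C' \<in> ?B C" by (rule UN_E)
      have "\<bar>C' $$ (r, c) - C $$ (r, c)\<bar> < \<epsilon> C" if "r < k" "c < n" for r c
        using PiE_mem[OF C(2), of "(r, c)"] that by (simp add: abs_diff_less_iff)
      then show "C' \<in> U" using \<epsilon>(2)[OF C(1) C'(2)] by blast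
    qed
    ultimately show ?open using open_iff by blast
  qed
qed

section \<open>Density of generic points\<close>

lemma rdet_affine_poly: "\<exists>q. \<forall>t. poly q t = rdet p (\<lambda>a c. f a c + t * g a c)"
proof
  let ?q = "\<Sum>\<pi> | \<pi> permutes {0..<p}. Polynomial.smult (signof \<pi>) (\<Prod>i = 0..<p. [:f i (\<pi> i), g i (\<pi> i):])"
  show "\<forall>t. poly ?q t = rdet p (\<lambda>a c. f a c + t * g a c)"
  proof
    fix t
    have "rdet p (\<lambda>a c. f a c + t * g a c)
        = (\<Sum>\<pi> | \<pi> permutes {0..<p}. signof \<pi> * (\<Prod>i = 0..<p. mat p p (\<lambda>(a, c). f a c + t * g a c) $$ (i, \<pi> i)))"
      unfolding rdet_def by (rule det_def') simp
    also have "\<dots> = poly ?q t"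
      unfolding poly_sum poly_smult poly_prod
      by (intro sum.cong prod.cong refl arg_cong2[where f = "(*)"]) (auto simp: permutes_in_image)
    finally show "poly ?q t = rdet p (\<lambda>a c. f a c + t * g a c)" by simp
  qed
qed

lemma eventually_poly_nonzero:
  fixes q :: "real poly"
  assumes "q \<noteq> 0"
  shows "\<forall>\<^sub>F t in at_right 0. poly q t \<noteq> 0"
proof -
  have "\<forall>\<^sub>F t in at_right 0. \<forall>z\<in>{z. poly q z = 0}. t \<noteq> z"
    using poly_roots_finite[OF assms] by (intro eventually_ball_finite ballI eventually_neq_at_within)
  then show ?thesis by (rule eventually_mono) blast
qed

lemma eventually_poly_pos:
  fixes q :: "real poly"
  assumes "poly q 0 > 0"
  shows "\<forall>\<^sub>F t in at_right 0. poly q t > 0"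
proof -
  have "(poly q \<longlongrightarrow> poly q 0) (at_right 0)"
    by (intro tendsto_poly tendsto_ident_at)
  then show ?thesis using assms by (rule order_tendstoD)
qed

text \<open>The rows of \<open>C Z\<close>, where \<open>M\<close> lists the columns of \<open>C\<close>.\<close>

abbreviation image_rows :: "nat \<Rightarrow> (nat \<Rightarrow> nat \<Rightarrow> real) \<Rightarrow> (nat \<Rightarrow> nat \<Rightarrow> real) \<Rightarrow> nat \<Rightarrow> nat \<Rightarrow> real" where
  "image_rows n Z M \<equiv> \<lambda>r c. \<Sum>j<n. M j r * Z j c"

text \<open>Choose \<open>D\<close> so that the rows of the image are \<open>k\<close> rows of \<open>Z\<close> other than \<open>Z i\<close> and \<open>Z j\<close>. The bracket is
then the determinant of \<open>k + 2\<close> different rows of \<open>Z\<close>, possibly unordered, which are independent because a nonzero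
relation among rows of \<open>Z\<close> involves more than \<open>k + 2\<close> of them.\<close>

lemma bracket_nonzero_witness:
  assumes Z: "pos_rows (k + 2) n Z" and kn: "k + 2 \<le> n" and ij: "i < n" "j < n" "i \<noteq> j"
  shows "\<exists>D. bracket k (image_rows n Z D) (Z i) (Z j) \<noteq> 0"
proof -
  have "k \<le> card ({..<n} - {i, j})" using ij kn by (simp add: card_Diff_subset)
  then obtain I where I: "I \<subseteq> {..<n} - {i, j}" "card I = k" by (meson obtain_subset_with_card_n)
  have "I \<subseteq> {..<n}" using I(1) by blast
  then obtain s where s: "incr k n s" "s ` {..<k} = I" using incr_enumerates I(2) by blast
  define D :: "nat \<Rightarrow> nat \<Rightarrow> real" where "D = (\<lambda>a r. if a = s r then 1 else 0)"
  define \<rho> where "\<rho> a = (if a < k then s a else if a = k then i else j)" for a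
  have \<rho>n: "\<rho> a < n" for a using incr_bound[OF s(1)] ij by (simp add: \<rho>_def)
  have inj: "inj_on \<rho> {..<k + 2}"
  proof (rule inj_onI)
    fix a b assume ab: "a \<in> {..<k + 2}" "b \<in> {..<k + 2}" "\<rho> a = \<rho> b"
    have ni: "s c \<noteq> i" "s c \<noteq> j" if "c < k" for c using that s(2) I(1) by auto
    consider "a < k" "b < k" | "a < k" "b \<ge> k" | "a \<ge> k" "b < k" | "a \<ge> k" "b \<ge> k" by linarith
    then show "a = b"
    proof cases
      case 1
      then show ?thesis using ab(3) incr_inj[OF s(1)] by (auto simp: \<rho>_def inj_on_def)
    next
      case 2
      then show ?thesis using ab(3) ni[of a] by (auto simp: \<rho>_def split: if_splits)
    next
      case 3
      then show ?thesis using ab(3) ni[of b] by (auto simp: \<rho>_def split: if_splits)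
    next
      case 4
      then have "a = k \<or> a = Suc k" "b = k \<or> b = Suc k" using ab(1,2) by auto
      then show ?thesis using ab(3) ij(3) by (auto simp: \<rho>_def)
    qed
  qed
  have "bracket k (image_rows n Z D) (Z i) (Z j) = rdet (k + 2) (\<lambda>a. Z (\<rho> a))"
    unfolding bracket_def
  proof (rule rdet_cong)
    fix a c assume "a < k + 2"
    have "image_rows n Z D a c = Z (s a) c" if "a < k"
    proof -
      have "image_rows n Z D a c = (\<Sum>m<n. if m = s a then Z m c else 0)"
        by (intro sum.cong) (auto simp: D_def)
      then show ?thesis using incr_bound[OF s(1) that] by simp
    qed
    then show "(if a < k then image_rows n Z D a else if a = k then Z i else Z j) c = Z (\<rho> a) c"
      by (simp add: \<rho>_def)
  qed
  moreover have "rdet (k + 2) (\<lambda>a. Z (\<rho> a)) \<noteq> 0"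
  proof
    assume "rdet (k + 2) (\<lambda>a. Z (\<rho> a)) = 0"
    then obtain x b where x: "b < k + 2" "x b \<noteq> 0"
      "\<And>c. c < k + 2 \<Longrightarrow> (\<Sum>a<k + 2. x a * Z (\<rho> a) c) = 0"
      using rdet_zero_dependent by blast
    define v where "v m = (\<Sum>a<k + 2. if \<rho> a = m then x a else 0)" for m
    have "v (\<rho> b) = (\<Sum>a<k + 2. if a = b then x a else 0)"
      unfolding v_def using inj x(1) by (intro sum.cong) (auto simp: inj_on_def)
    then have vb: "v (\<rho> b) \<noteq> 0" using x by simp
    have "(\<Sum>m<n. v m * Z m c) = 0" if "c < k + 2" for c
    proof -
      have "(\<Sum>m<n. v m * Z m c) = (\<Sum>a<k + 2. \<Sum>m<n. if \<rho> a = m then x a * Z m c else 0)"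
        unfolding v_def sum_distrib_right by (subst sum.swap) (intro sum.cong, auto)
      also have "\<dots> = (\<Sum>a<k + 2. x a * Z (\<rho> a) c)" using \<rho>n by (simp add: sum.delta')
      finally show ?thesis using x(3)[OF that] by simp
    qed
    then have "k + 2 < card {m. m < n \<and> v m \<noteq> 0}"
      using kernel_support_gt[where v = v and i = "\<rho> b", OF Z kn _ \<rho>n vb] by blast
    moreover have "{m. m < n \<and> v m \<noteq> 0} \<subseteq> \<rho> ` {..<k + 2}"
    proof
      fix m assume "m \<in> {m. m < n \<and> v m \<noteq> 0}"
      then have "(\<Sum>a<k + 2. if \<rho> a = m then x a else 0) \<noteq> 0"
        by (simp only: v_def mem_Collect_eq simp_thms)
      then obtain a where "a \<in> {..<k + 2}" "(if \<rho> a = m then x a else 0) \<noteq> 0"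
        by (rule sum.not_neutral_contains_not_neutral)
      then show "m \<in> \<rho> ` {..<k + 2}" by (auto split: if_splits)
    qed
    then have "card {m. m < n \<and> v m \<noteq> 0} \<le> card (\<rho> ` {..<k + 2})"
      by (rule card_mono[rotated]) simp
    moreover have "card (\<rho> ` {..<k + 2}) \<le> card {..<k + 2}" by (rule card_image_le) simp
    ultimately show False by simp
  qed
  ultimately have "bracket k (image_rows n Z D) (Z i) (Z j) \<noteq> 0" by simp
  then show ?thesis by (rule exI[of _ D])
qed

text \<open>Along the segment from \<open>M\<close> to the witness \<open>D\<close> every bracket and every minor is a polynomial in the
parameter. A bracket that is nonzero at one of the two ends is not the zero polynomial, so it is nonzero for
all small positive parameters.\<close>

lemma generic_step:
  assumes M: "pos_rows k n M" and Z: "pos_rows (k + 2) n Z" and kn: "k + 2 \<le> n" and "\<epsilon> > 0"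
    and fin: "finite S" and S: "\<forall>(i, j) \<in> S. bracket k (image_rows n Z M) (Z i) (Z j) \<noteq> 0"
    and ij: "i < n" "j < n" "i \<noteq> j"
  shows "\<exists>M'. (\<forall>m<n. \<forall>r<k. \<bar>M' m r - M m r\<bar> < \<epsilon>) \<and> pos_rows k n M' \<and>
    (\<forall>(i', j') \<in> insert (i, j) S. bracket k (image_rows n Z M') (Z i') (Z j') \<noteq> 0)"
proof -
  obtain D where D: "bracket k (image_rows n Z D) (Z i) (Z j) \<noteq> 0"
    using bracket_nonzero_witness[OF Z kn ij] by blast
  define N where "N t m r = M m r + t * (D m r - M m r)" for t m r
  have N0: "N 0 = M" and N1: "N 1 = D" by (simp_all add: N_def fun_eq_iff)
  have near: "\<forall>\<^sub>F t in at_right 0. \<forall>m\<in>{..<n}. \<forall>r\<in>{..<k}. \<bar>N t m r - M m r\<bar> < \<epsilon>"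
  proof (intro eventually_ball_finite ballI)
    fix m r
    have "((\<lambda>t. \<bar>t * (D m r - M m r)\<bar>) \<longlongrightarrow> \<bar>0 * (D m r - M m r)\<bar>) (at_right 0)"
      by (intro tendsto_intros)
    then show "\<forall>\<^sub>F t in at_right 0. \<bar>N t m r - M m r\<bar> < \<epsilon>"
      using \<open>\<epsilon> > 0\<close> order_tendstoD(2)[of _ _ _ \<epsilon>] by (simp add: N_def)
  qed auto
  have minors: "\<forall>\<^sub>F t in at_right 0. \<forall>s\<in>{s \<in> {..<k} \<rightarrow>\<^sub>E {..<n}. incr k n s}. rdet k (\<lambda>a. N t (s a)) > 0"
  proof (intro eventually_ball_finite finite_incr_PiE ballI)
    fix s assume "s \<in> {s \<in> {..<k} \<rightarrow>\<^sub>E {..<n}. incr k n s}"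
    then have "rdet k (\<lambda>a. N 0 (s a)) > 0" using M by (simp add: N0 pos_rows_def)
    moreover obtain q where "\<And>t. poly q t = rdet k (\<lambda>a. N t (s a))"
      using rdet_affine_poly[of k "\<lambda>a. M (s a)" "\<lambda>a c. D (s a) c - M (s a) c"] unfolding N_def by blast
    ultimately show "\<forall>\<^sub>F t in at_right 0. rdet k (\<lambda>a. N t (s a)) > 0"
      using eventually_poly_pos[of q] by simp
  qed
  have pos: "pos_rows k n (N t)"
    if "\<forall>s\<in>{s \<in> {..<k} \<rightarrow>\<^sub>E {..<n}. incr k n s}. rdet k (\<lambda>a. N t (s a)) > 0" for t
    unfolding pos_rows_def
  proof (intro allI impI)
    fix s assume s: "incr k n s"
    let ?s = "restrict s {..<k}"
    have "incr k n ?s" "?s \<in> {..<k} \<rightarrow>\<^sub>E {..<n}" using s by (auto simp: incr_def)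
    then have "rdet k (\<lambda>a. N t (?s a)) > 0" using that by blast
    moreover have "rdet k (\<lambda>a. N t (?s a)) = rdet k (\<lambda>a. N t (s a))" by (rule rdet_cong) simp
    ultimately show "rdet k (\<lambda>a. N t (s a)) > 0" by simp
  qed
  have bracket_poly: "\<exists>q. \<forall>t. poly q t = bracket k (image_rows n Z (N t)) u v" for u v
  proof -
    let ?f = "\<lambda>a. if a < k then image_rows n Z M a else if a = k then u else v"
    let ?g = "\<lambda>a c. if a < k then image_rows n Z D a c - image_rows n Z M a c else 0"
    have "rdet (k + 2) (\<lambda>a c. ?f a c + t * ?g a c) = bracket k (image_rows n Z (N t)) u v" for t
      unfolding bracket_def
      by (intro rdet_cong)
         (simp add: N_def sum.distrib algebra_simps sum_distrib_left sum_subtractf)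
    then show ?thesis using rdet_affine_poly[of "k + 2" ?f ?g] by auto
  qed
  have "\<forall>\<^sub>F t in at_right 0. \<forall>ij\<in>insert (i, j) S. bracket k (image_rows n Z (N t)) (Z (fst ij)) (Z (snd ij)) \<noteq> 0"
  proof (intro eventually_ball_finite ballI)
    show "finite (insert (i, j) S)" using fin by simp
    fix ij assume mem: "ij \<in> insert (i, j) S"
    from bracket_poly[of "Z (fst ij)" "Z (snd ij)"]
    obtain q where q: "\<forall>t. poly q t = bracket k (image_rows n Z (N t)) (Z (fst ij)) (Z (snd ij))"
      by (rule exE)
    have "q \<noteq> 0"
    proof (cases "ij = (i, j)")
      case True
      then have "poly q 1 \<noteq> 0" using D by (simp add: q[rule_format] N1)
      then show ?thesis by auto
    next
      case False
      then have "poly q 0 \<noteq> 0" using mem S by (auto simp add: q[rule_format] N0)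
      then show ?thesis by auto
    qed
    then show "\<forall>\<^sub>F t in at_right 0. bracket k (image_rows n Z (N t)) (Z (fst ij)) (Z (snd ij)) \<noteq> 0"
      using eventually_poly_nonzero[of q] by (simp only: q[rule_format] not_False_eq_True)
  qed
  from eventually_conj[OF near eventually_conj[OF minors this]]
  obtain t where "\<forall>m\<in>{..<n}. \<forall>r\<in>{..<k}. \<bar>N t m r - M m r\<bar> < \<epsilon>"
    "\<forall>s\<in>{s \<in> {..<k} \<rightarrow>\<^sub>E {..<n}. incr k n s}. rdet k (\<lambda>a. N t (s a)) > 0"
    "\<forall>ij\<in>insert (i, j) S. bracket k (image_rows n Z (N t)) (Z (fst ij)) (Z (snd ij)) \<noteq> 0"
    using eventually_happens'[OF trivial_limit_at_right_real] by blast
  then show ?thesis using pos by (intro exI[of _ "N t"]) auto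
qed

lemma generic_perturb:
  assumes M: "pos_rows k n M" and Z: "pos_rows (k + 2) n Z" and kn: "k + 2 \<le> n" and "\<epsilon> > 0"
    and "finite S" "S \<subseteq> {(i, j). i < n \<and> j < n \<and> i \<noteq> j}"
  shows "\<exists>M'. (\<forall>m<n. \<forall>r<k. \<bar>M' m r - M m r\<bar> < \<epsilon>) \<and> pos_rows k n M' \<and>
    (\<forall>(i, j) \<in> S. bracket k (image_rows n Z M') (Z i) (Z j) \<noteq> 0)"
  using assms(5,6,4)
proof (induction S arbitrary: \<epsilon> rule: finite_induct)
  case empty
  then show ?case using M by (intro exI[of _ M]) auto
next
  case (insert ij S)
  obtain i j where ij: "ij = (i, j)" by fastforce
  have half: "\<epsilon> / 2 > 0" using insert.prems by simp
  have sub: "S \<subseteq> {(i, j). i < n \<and> j < n \<and> i \<noteq> j}" and ijn: "i < n" "j < n" "i \<noteq> j"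
    using insert.prems(1) ij by auto
  from insert.IH[OF sub half] obtain M1 where M1: "\<forall>m<n. \<forall>r<k. \<bar>M1 m r - M m r\<bar> < \<epsilon> / 2"
    "pos_rows k n M1" "\<forall>(i, j) \<in> S. bracket k (image_rows n Z M1) (Z i) (Z j) \<noteq> 0"
    by (elim exE conjE) (rule that)
  from generic_step[OF M1(2) Z kn half insert.hyps(1) M1(3) ijn] obtain M2
    where M2: "\<forall>m<n. \<forall>r<k. \<bar>M2 m r - M1 m r\<bar> < \<epsilon> / 2" "pos_rows k n M2"
    "\<forall>(i', j') \<in> insert (i, j) S. bracket k (image_rows n Z M2) (Z i') (Z j') \<noteq> 0"
    by (elim exE conjE) (rule that)
  have "\<bar>M2 m r - M m r\<bar> < \<epsilon>" if "m < n" "r < k" for m r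
  proof -
    have "\<bar>M1 m r - M m r\<bar> < \<epsilon> / 2" "\<bar>M2 m r - M1 m r\<bar> < \<epsilon> / 2"
      using M1(1) M2(1) that by simp_all
    then show ?thesis by linarith
  qed
  then show ?case using M2(2,3) unfolding ij by (intro exI[of _ M2] conjI allI impI)
qed

section \<open>Closedness of the amplituhedron\<close>

lemma bounded_coordinates_subseq:
  fixes f :: "nat \<Rightarrow> 'i \<Rightarrow> real"
  assumes "finite I" "\<And>i. i \<in> I \<Longrightarrow> \<exists>B. \<forall>m. \<bar>f m i\<bar> \<le> B"
  shows "\<exists>r l. strict_mono r \<and> (\<forall>i\<in>I. (\<lambda>m. f (r m) i) \<longlonglongrightarrow> l i)"
  using assms
proof (induction I rule: finite_induct)
  case empty
  show ?case by (rule exI[of _ id]) (simp add: strict_mono_def)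
next
  case (insert x I)
  have "\<exists>r l. strict_mono r \<and> (\<forall>i\<in>I. (\<lambda>m. f (r m) i) \<longlonglongrightarrow> l i)"
    by (rule insert.IH) (use insert.prems in blast)
  then obtain r l where r: "strict_mono r" "\<And>i. i \<in> I \<Longrightarrow> (\<lambda>m. f (r m) i) \<longlonglongrightarrow> l i" by blast
  obtain B where "\<And>m. \<bar>f m x\<bar> \<le> B" using insert.prems by blast
  then have "bounded (range (\<lambda>m. f (r m) x))" 
    unfolding bounded_def by (intro exI[of _ 0] exI[of _ B]) (auto simp: dist_real_def)
  then obtain y r' where r': "strict_mono r'" "((\<lambda>m. f (r m) x) \<circ> r') \<longlonglongrightarrow> y"
    using bounded_imp_convergent_subsequence by blast
  have "(\<lambda>m. f ((r \<circ> r') m) i) \<longlonglongrightarrow> (l(x := y)) i" if "i \<in> insert x I" for i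
  proof (cases "i = x")
    case True
    then show ?thesis using r'(2) by (simp add: o_def)
  next
    case False
    then have "i \<in> I" using that by simp
    then show ?thesis using LIMSEQ_subseq_LIMSEQ[OF r(2) r'(1), of i] False by (simp add: o_def)
  qed
  moreover have "strict_mono (r \<circ> r')" using r(1) r'(1) by (rule strict_mono_o)
  ultimately show ?case by blast
qed

lemma alternates_cong:
  assumes "\<And>j. j < n \<Longrightarrow> v j = w j" "alternates m n v"
  shows "alternates m n w"
proof -
  obtain s e where s: "incr m n s" "\<And>a. a < m \<Longrightarrow> e * (-1) ^ a * v (s a) > 0"
    using assms(2) unfolding alternates_def by blast
  have "e * (-1) ^ a * w (s a) > 0" if "a < m" for a
    using s(2)[OF that] assms(1)[OF incr_bound[OF s(1) that]] by simp
  then show ?thesis unfolding alternates_def using s(1) by blast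
qed

lemma alternates_eventually:
  assumes "alternates m n l" "\<And>j. j < n \<Longrightarrow> (\<lambda>N. u N j) \<longlonglongrightarrow> l j"
  shows "\<forall>\<^sub>F N in sequentially. alternates m n (u N)"
proof -
  obtain s e where s: "incr m n s" "\<And>a. a < m \<Longrightarrow> e * (-1) ^ a * l (s a) > 0"
    using assms(1) by (auto simp: alternates_def)
  have "\<forall>\<^sub>F N in sequentially. \<forall>a\<in>{..<m}. e * (-1) ^ a * u N (s a) > 0"
  proof (intro eventually_ball_finite ballI)
    fix a assume "a \<in> {..<m}"
    then have a: "a < m" by simp
    have "(\<lambda>N. e * (-1) ^ a * u N (s a)) \<longlonglongrightarrow> e * (-1) ^ a * l (s a)"
      by (intro tendsto_mult tendsto_const assms(2) incr_bound[OF s(1) a])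
    then show "\<forall>\<^sub>F N in sequentially. e * (-1) ^ a * u N (s a) > 0"
      using s(2)[OF a] by (rule order_tendstoD)
  qed simp
  then show ?thesis
  proof (rule eventually_mono)
    fix N assume "\<forall>a\<in>{..<m}. e * (-1) ^ a * u N (s a) > 0"
    then show "alternates m n (u N)" unfolding alternates_def using s(1) by blast
  qed
qed

lemma alternates_scale:
  assumes "alternates m n (\<lambda>j. v j / A)" "A > 0"
  shows "alternates m n v"
proof -
  obtain s e where s: "incr m n s" "\<And>a. a < m \<Longrightarrow> e * (-1) ^ a * (v (s a) / A) > 0"
    using assms(1) unfolding alternates_def by blast
  have "e * (-1) ^ a * v (s a) > 0" if "a < m" for a
  proof -
    have "e * (-1) ^ a * (v (s a) / A) * A > 0" using s(2)[OF that] assms(2) by (rule mult_pos_pos)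
    then show ?thesis using assms(2) by simp
  qed
  then show ?thesis unfolding alternates_def using s(1) by blast
qed

text \<open>Otherwise a sequence of unit vectors with few sign changes would have images tending to zero. A
limit of a subsequence would be a nonzero relation among the \<open>Z j\<close>, hence have many sign changes, and
strict sign changes of a limit are already present in the sequence.\<close>

lemma few_sign_changes_bound:
  assumes Z: "pos_rows q n Z" and qn: "q \<le> n" and m: "m \<le> Suc q"
  shows "\<exists>K. \<forall>v. \<not> alternates m n v \<longrightarrow>
    (\<Sum>j<n. \<bar>v j\<bar>) \<le> K * (\<Sum>c<q. \<bar>\<Sum>j<n. v j * Z j c\<bar>)"
proof (rule ccontr)
  let ?S = "\<lambda>v. \<Sum>c<q. \<bar>\<Sum>j<n. v j * Z j c\<bar>"
  assume "\<not> ?thesis"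
  then have "\<forall>K. \<exists>v. \<not> alternates m n v \<and> K * ?S v < (\<Sum>j<n. \<bar>v j\<bar>)" by (simp add: not_le)
  then have "\<forall>N. \<exists>v. \<not> alternates m n v \<and> real (Suc N) * ?S v < (\<Sum>j<n. \<bar>v j\<bar>)" by blast
  then obtain v where v: "\<And>N. \<not> alternates m n (v N)"
    "\<And>N. real (Suc N) * ?S (v N) < (\<Sum>j<n. \<bar>v N j\<bar>)" by metis
  define A where "A N = (\<Sum>j<n. \<bar>v N j\<bar>)" for N
  have S0: "?S w \<ge> 0" for w by (intro sum_nonneg) simp
  have A: "A N > 0" for N
  proof -
    have "0 \<le> real (Suc N) * ?S (v N)" using S0[of "v N"] by simp
    also have "\<dots> < A N" using v(2)[of N] by (simp only: A_def)
    finally show ?thesis .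
  qed
  define u where "u N j = v N j / A N" for N j
  have alt_u: "\<not> alternates m n (u N)" for N
    using v(1)[of N] alternates_scale[of m n "v N" "A N"] A[of N] unfolding u_def by blast
  have sum_u: "(\<Sum>j<n. \<bar>u N j\<bar>) = 1" for N
  proof -
    have "(\<Sum>j<n. \<bar>u N j\<bar>) = (\<Sum>j<n. \<bar>v N j\<bar>) / A N"
      using A[of N] by (simp add: u_def sum_divide_distrib)
    then show ?thesis using A[of N] by (simp add: A_def)
  qed
  have ker_u: "\<bar>\<Sum>j<n. u N j * Z j c\<bar> \<le> 1 / real (Suc N)" if "c < q" for N c
  proof -
    have "\<bar>\<Sum>j<n. v N j * Z j c\<bar> \<le> ?S (v N)"
      by (rule member_le_sum) (use that in auto)
    then have "real (Suc N) * \<bar>\<Sum>j<n. v N j * Z j c\<bar> \<le> real (Suc N) * ?S (v N)"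
      by (intro mult_left_mono) auto
    then have "real (Suc N) * \<bar>\<Sum>j<n. v N j * Z j c\<bar> \<le> A N"
      using v(2)[of N] unfolding A_def by linarith
    then have "\<bar>\<Sum>j<n. v N j * Z j c\<bar> / A N \<le> 1 / real (Suc N)"
      using A[of N] by (simp add: field_simps)
    moreover have "(\<Sum>j<n. u N j * Z j c) = (\<Sum>j<n. v N j * Z j c) / A N"
      by (simp add: u_def sum_divide_distrib)
    ultimately show ?thesis using A[of N] by simp
  qed
  have bound_u: "\<bar>u N j\<bar> \<le> 1" if "j < n" for N j
  proof -
    have "\<bar>u N j\<bar> \<le> (\<Sum>j<n. \<bar>u N j\<bar>)" by (rule member_le_sum) (use that in auto)
    then show ?thesis by (simp only: sum_u)
  qed
  have "\<exists>r l. strict_mono r \<and> (\<forall>j\<in>{..<n}. (\<lambda>N. u (r N) j) \<longlonglongrightarrow> l j)"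
  proof (rule bounded_coordinates_subseq)
    show "\<exists>B. \<forall>N. \<bar>u N j\<bar> \<le> B" if "j \<in> {..<n}" for j
      using bound_u[of j] that by (intro exI[of _ 1]) simp
  qed simp
  then obtain r l where r: "strict_mono r" "\<And>j. j < n \<Longrightarrow> (\<lambda>N. u (r N) j) \<longlonglongrightarrow> l j" by auto
  have "(\<lambda>N. \<Sum>j<n. \<bar>u (r N) j\<bar>) \<longlonglongrightarrow> (\<Sum>j<n. \<bar>l j\<bar>)"
    by (intro tendsto_sum tendsto_rabs r(2)) simp
  then have "(\<lambda>N. 1) \<longlonglongrightarrow> (\<Sum>j<n. \<bar>l j\<bar>)" by (simp only: sum_u)
  then have "(\<Sum>j<n. \<bar>l j\<bar>) = 1" by (rule LIMSEQ_unique[OF _ tendsto_const])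
  then have "(\<Sum>j<n. \<bar>l j\<bar>) \<noteq> 0" by simp
  then obtain i where "i \<in> {..<n}" "\<bar>l i\<bar> \<noteq> 0" by (rule sum.not_neutral_contains_not_neutral)
  then have i: "i < n" "l i \<noteq> 0" by simp_all
  have "(\<Sum>j<n. l j * Z j c) = 0" if "c < q" for c
  proof -
    have "(\<lambda>N. \<Sum>j<n. u (r N) j * Z j c) \<longlonglongrightarrow> (\<Sum>j<n. l j * Z j c)"
      by (intro tendsto_sum tendsto_mult tendsto_const r(2)) simp
    moreover have "(\<lambda>N. \<Sum>j<n. u (r N) j * Z j c) \<longlonglongrightarrow> 0"
    proof (rule tendsto_rabs_zero_cancel, rule tendsto_sandwich)
      show "\<forall>\<^sub>F N in sequentially. 0 \<le> \<bar>\<Sum>j<n. u (r N) j * Z j c\<bar>" by simp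
      show "\<forall>\<^sub>F N in sequentially. \<bar>\<Sum>j<n. u (r N) j * Z j c\<bar> \<le> 1 / real (Suc (r N))"
        using ker_u[OF that] by simp
      show "(\<lambda>N. 1 / real (Suc (r N))) \<longlonglongrightarrow> 0"
        using LIMSEQ_subseq_LIMSEQ[OF lim_inverse_n' r(1)] LIMSEQ_subseq_LIMSEQ[OF LIMSEQ_Suc[OF lim_inverse_n'] r(1)]
        by (simp add: o_def)
    qed simp
    ultimately show ?thesis by (rule LIMSEQ_unique)
  qed
  then have "alternates (Suc q) n l"
    using kernel_alternates[where v = l, OF Z qn _ i] by blast
  then have "alternates m n l" using m by (rule alternates_mono)
  then have "\<forall>\<^sub>F N in sequentially. alternates m n (u (r N))"
    using r(2) by (rule alternates_eventually)
  then show False using alt_u by simp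
qed

lemma tendsto_rdet:
  assumes "\<And>a c. a < p \<Longrightarrow> c < p \<Longrightarrow> (\<lambda>N. f N a c) \<longlonglongrightarrow> g a c"
  shows "(\<lambda>N. rdet p (f N)) \<longlonglongrightarrow> rdet p g"
proof -
  have expand: "rdet p h = (\<Sum>\<pi> | \<pi> permutes {0..<p}. signof \<pi> * (\<Prod>i = 0..<p. h i (\<pi> i)))" for h
  proof -
    have "rdet p h = (\<Sum>\<pi> | \<pi> permutes {0..<p}. signof \<pi> * (\<Prod>i = 0..<p. mat p p (\<lambda>(a, c). h a c) $$ (i, \<pi> i)))"
      unfolding rdet_def by (rule det_def') simp
    also have "\<dots> = (\<Sum>\<pi> | \<pi> permutes {0..<p}. signof \<pi> * (\<Prod>i = 0..<p. h i (\<pi> i)))"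
      by (intro sum.cong prod.cong refl arg_cong2[where f = "(*)"]) (auto simp: permutes_in_image)
    finally show ?thesis .
  qed
  show ?thesis
    unfolding expand
    by (intro tendsto_sum tendsto_mult tendsto_const tendsto_prod assms) (auto simp: permutes_in_image)
qed

lemma minor_left_mult:
  assumes "g \<in> carrier_mat k k" "C \<in> carrier_mat k n" "incr k n s"
  shows "rdet k (\<lambda>a. column_vectors (g * C) (s a)) = det g * rdet k (\<lambda>a. column_vectors C (s a))"
proof -
  let ?A = "\<lambda>C. mat k k (\<lambda>(r, a). C $$ (r, s a)) :: real mat"
  have rd: "rdet k (\<lambda>a. column_vectors B (s a)) = det (?A B)" for B :: "real mat"
  proof -
    have "mat k k (\<lambda>(a, r). B $$ (r, s a)) = (?A B)\<^sup>T" by (intro eq_matI) auto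
    then show ?thesis by (simp add: rdet_def det_transpose[of _ k])
  qed
  have "?A (g * C) = g * ?A C"
    using assms(1,2) incr_bound[OF assms(3)]
    by (intro eq_matI) (auto simp: scalar_prod_def intro!: sum.cong)
  then show ?thesis unfolding rd using det_mult[OF assms(1), of "?A C"] by simp
qed

text \<open>If all minors are nonpositive, negating the first row makes them nonnegative without changing the
span. The condition on products, unlike a common sign, is visibly closed under
limits of sequences in which the sign may vary.\<close>

lemma same_sign_rowspan_in_amplituhedron:
  assumes B: "B \<in> full_rank_mats k n" and Z: "Z \<in> carrier_mat n (k + 2)" and "k \<ge> 1"
    and same: "\<And>s s'. incr k n s \<Longrightarrow> incr k n s' \<Longrightarrow>
      rdet k (\<lambda>a. column_vectors B (s a)) * rdet k (\<lambda>a. column_vectors B (s' a)) \<ge> 0"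
  shows "rowspan (k + 2) (B * Z) \<in> amplituhedron n k Z"
proof -
  have Bc: "B \<in> carrier_mat k n" using B by (rule full_rank_carrier)
  obtain s0 where s0: "incr k n s0" "rdet k (\<lambda>a. column_vectors B (s0 a)) \<noteq> 0"
    using full_rank_minor[OF B] by blast
  show ?thesis
  proof (cases "rdet k (\<lambda>a. column_vectors B (s0 a)) > 0")
    case True
    then have "nonneg_rows k n (column_vectors B)"
      unfolding nonneg_rows_def using same[OF s0(1)] by (auto simp: zero_le_mult_iff)
    then show ?thesis
      unfolding amplituhedron_eq[OF Z] using B by (intro CollectI exI[of _ B] conjI refl)
  next
    case False
    then have neg: "rdet k (\<lambda>a. column_vectors B (s0 a)) < 0" using s0(2) by simp
    define d :: "real mat" where "d = multrow_mat k 0 (-1)"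
    have d: "d \<in> carrier_mat k k" "det d = -1"
      using det_multrow_mat[of 0 k "-1"] assms(3) by (simp_all add: d_def)
    have dd: "d * d = 1\<^sub>m k"
      using multrow_mat_inv[of 0 k "-1 :: real"] assms(3) by (simp add: d_def)
    have minors: "rdet k (\<lambda>a. column_vectors (d * B) (s a)) = - rdet k (\<lambda>a. column_vectors B (s a))"
      if "incr k n s" for s
      using minor_left_mult[OF d(1) Bc that] d(2) by simp
    have dBc: "d * B \<in> carrier_mat k n" using d(1) Bc by simp
    have "nonneg_rows k n (column_vectors (d * B))"
      unfolding nonneg_rows_def
    proof (intro allI impI)
      fix s assume s: "incr k n s"
      have "rdet k (\<lambda>a. column_vectors B (s a)) \<le> 0"
        using same[OF s0(1) s] neg by (simp add: zero_le_mult_iff)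
      then show "rdet k (\<lambda>a. column_vectors (d * B) (s a)) \<ge> 0" using minors[OF s] by simp
    qed
    moreover have "d * B \<in> full_rank_mats k n"
    proof (rule rows_independent_full_rank[OF dBc], rule minor_rows_independent[OF s0(1)])
      show "rdet k (\<lambda>a. column_vectors (d * B) (s0 a)) \<noteq> 0" using minors[OF s0(1)] neg by simp
    qed
    moreover have "rowspan (k + 2) (B * Z) = rowspan (k + 2) (d * B * Z)"
    proof
      have "d * (d * B * Z) = d * d * (B * Z)"
        using d(1) Bc Z by (simp add: assoc_mult_mat[of _ k k _ k _ "k + 2"] assoc_mult_mat[of _ k k _ n _ "k + 2"])
      then have "d * (d * B * Z) = B * Z" using dd Bc Z by simp
      then show "rowspan (k + 2) (B * Z) \<subseteq> rowspan (k + 2) (d * B * Z)"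
        using rowspan_mult_subset[OF d(1), of "d * B * Z" "k + 2"] dBc Z by simp
      have "d * B * Z = d * (B * Z)" using d(1) Bc Z by simp
      then show "rowspan (k + 2) (d * B * Z) \<subseteq> rowspan (k + 2) (B * Z)"
        using rowspan_mult_subset[OF d(1), of "B * Z" "k + 2"] Bc Z by simp
    qed
    ultimately show ?thesis
      unfolding amplituhedron_eq[OF Z] by (intro CollectI exI[of _ "d * B"] conjI)
  qed
qed

text \<open>Every representative \<open>y\<close> of a point is \<open>g C Z\<close> with \<open>C\<close> nonnegative. Absorbing \<open>g\<close> into \<open>C\<close> multiplies all
minors by \<open>det g\<close> and keeps the rows inside the row space of \<open>C\<close>.\<close>

lemma amplituhedron_representative:
  assumes Z: "Z \<in> carrier_mat n (k + 2)"
    and y: "y \<in> full_rank_mats k (k + 2)" "rowspan (k + 2) y \<in> amplituhedron n k Z"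
  shows "\<exists>B. B \<in> carrier_mat k n \<and> y = B * Z \<and>
      (\<forall>s s'. incr k n s \<longrightarrow> incr k n s' \<longrightarrow>
        rdet k (\<lambda>a. column_vectors B (s a)) * rdet k (\<lambda>a. column_vectors B (s' a)) \<ge> 0) \<and>
      (\<forall>r<k. \<not> alternates (Suc k) n (\<lambda>j. B $$ (r, j)))"
proof -
  obtain C where C: "C \<in> full_rank_mats k n" "nonneg_rows k n (column_vectors C)"
    "rowspan (k + 2) y = rowspan (k + 2) (C * Z)"
    using y(2) unfolding amplituhedron_eq[OF Z] by blast
  have Cc: "C \<in> carrier_mat k n" using C(1) by (rule full_rank_carrier)
  have yc: "y \<in> carrier_mat k (k + 2)" using y(1) by (rule full_rank_carrier)
  obtain g where g: "g \<in> carrier_mat k k" "y = g * (C * Z)"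
    using rowspan_subset_factor[of "k + 2" y "C * Z" k] C(3) yc Cc Z by auto
  obtain s0 where s0: "incr k n s0" "rdet k (\<lambda>a. column_vectors C (s0 a)) > 0"
    using nonneg_full_rank_pos_minor[OF C(1,2)] by blast
  show ?thesis
  proof (intro exI[of _ "g * C"] conjI allI impI)
    show "g * C \<in> carrier_mat k n" "y = g * C * Z" using g Cc Z by simp_all
    show "rdet k (\<lambda>a. column_vectors (g * C) (s a)) * rdet k (\<lambda>a. column_vectors (g * C) (s' a)) \<ge> 0"
      if "incr k n s" "incr k n s'" for s s'
    proof -
      have "rdet k (\<lambda>a. column_vectors C (s a)) \<ge> 0" "rdet k (\<lambda>a. column_vectors C (s' a)) \<ge> 0"
        using C(2) that by (simp_all add: nonneg_rows_def)
      then have "(det g)\<^sup>2 * (rdet k (\<lambda>a. column_vectors C (s a)) * rdet k (\<lambda>a. column_vectors C (s' a))) \<ge> 0"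
        by simp
      then show ?thesis
        unfolding minor_left_mult[OF g(1) Cc that(1)] minor_left_mult[OF g(1) Cc that(2)]
        by (simp add: power2_eq_square mult_ac)
    qed
    show "\<not> alternates (Suc k) n (\<lambda>j. (g * C) $$ (r, j))" if "r < k" for r
    proof
      assume alt: "alternates (Suc k) n (\<lambda>j. (g * C) $$ (r, j))"
      have "(g * C) $$ (r, j) = (\<Sum>c<k. C $$ (c, j) * g $$ (r, c))" if "j < n" for j
        using mult_entry[OF g(1) Cc \<open>r < k\<close> that] by (simp add: mult.commute)
      then have "alternates (Suc k) n (\<lambda>j. \<Sum>c<k. C $$ (c, j) * g $$ (r, c))"
        using alt by (rule alternates_cong)
      then show False using nonneg_range_not_alternates[OF C(2) s0, of "\<lambda>c. g $$ (r, c)"] by (rule notE[rotated])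
    qed
  qed
qed

text \<open>The factors \<open>B\<close> of the previous lemma are bounded because their rows have few sign changes, so
a subsequence converges; the limit has full rank because its product with \<open>Z\<close> has.\<close>

theorem amplituhedron_limit:
  assumes k: "k \<ge> 1" and kn: "k + 2 \<le> n" and Z: "Z \<in> pos_mats n (k + 2)"
    and y: "\<And>N. y N \<in> full_rank_mats k (k + 2)" "\<And>N. rowspan (k + 2) (y N) \<in> amplituhedron n k Z"
    and y0: "y0 \<in> full_rank_mats k (k + 2)"
    and lim: "\<And>r c. r < k \<Longrightarrow> c < k + 2 \<Longrightarrow> (\<lambda>N. y N $$ (r, c)) \<longlonglongrightarrow> y0 $$ (r, c)"
  shows "rowspan (k + 2) y0 \<in> amplituhedron n k Z"
proof -
  have Zc: "Z \<in> carrier_mat n (k + 2)" and Zp: "pos_rows (k + 2) n (\<lambda>i c. Z $$ (i, c))"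
    using Z by (auto simp: pos_mats_iff)
  have y0c: "y0 \<in> carrier_mat k (k + 2)" using y0 by (rule full_rank_carrier)
  have "\<exists>B. \<forall>N. B N \<in> carrier_mat k n \<and> y N = B N * Z \<and>
      (\<forall>s s'. incr k n s \<longrightarrow> incr k n s' \<longrightarrow>
        rdet k (\<lambda>a. column_vectors (B N) (s a)) * rdet k (\<lambda>a. column_vectors (B N) (s' a)) \<ge> 0) \<and>
      (\<forall>r<k. \<not> alternates (Suc k) n (\<lambda>j. B N $$ (r, j)))"
    by (intro choice allI amplituhedron_representative Zc y)
  then obtain B where "\<forall>N. B N \<in> carrier_mat k n \<and> y N = B N * Z \<and>
      (\<forall>s s'. incr k n s \<longrightarrow> incr k n s' \<longrightarrow>
        rdet k (\<lambda>a. column_vectors (B N) (s a)) * rdet k (\<lambda>a. column_vectors (B N) (s' a)) \<ge> 0) \<and>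
      (\<forall>r<k. \<not> alternates (Suc k) n (\<lambda>j. B N $$ (r, j)))" ..
  then have B: "\<And>N. B N \<in> carrier_mat k n" "\<And>N. y N = B N * Z"
    "\<And>N s s'. incr k n s \<Longrightarrow> incr k n s' \<Longrightarrow>
        rdet k (\<lambda>a. column_vectors (B N) (s a)) * rdet k (\<lambda>a. column_vectors (B N) (s' a)) \<ge> 0"
    "\<And>N r. r < k \<Longrightarrow> \<not> alternates (Suc k) n (\<lambda>j. B N $$ (r, j))"
    by simp_all
  have yB: "y N $$ (r, c) = (\<Sum>j<n. B N $$ (r, j) * Z $$ (j, c))" if "r < k" "c < k + 2" for N r c
    unfolding B(2) by (rule mult_entry[OF B(1) Zc that])
  obtain K where K: "\<And>v. \<not> alternates (Suc k) n v \<Longrightarrow>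
      (\<Sum>j<n. \<bar>v j\<bar>) \<le> K * (\<Sum>c<k + 2. \<bar>\<Sum>j<n. v j * Z $$ (j, c)\<bar>)"
    using few_sign_changes_bound[OF Zp kn, of "Suc k"] by auto
  have bounded: "\<exists>b. \<forall>N. \<bar>B N $$ (r, j)\<bar> \<le> b" if "r < k" "j < n" for r j
  proof -
    have "(\<lambda>N. \<Sum>c<k + 2. \<bar>y N $$ (r, c)\<bar>) \<longlonglongrightarrow> (\<Sum>c<k + 2. \<bar>y0 $$ (r, c)\<bar>)"
      by (intro tendsto_sum tendsto_rabs lim that) simp
    then have "Bseq (\<lambda>N. \<Sum>c<k + 2. \<bar>y N $$ (r, c)\<bar>)"
      by (intro convergent_imp_Bseq convergentI)
    then obtain b where "\<And>N. \<bar>\<Sum>c<k + 2. \<bar>y N $$ (r, c)\<bar>\<bar> \<le> b"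
      unfolding Bseq_def by auto
    then have b: "(\<Sum>c<k + 2. \<bar>y N $$ (r, c)\<bar>) \<le> b" for N
      by (rule order_trans[OF abs_ge_self])
    have "\<bar>B N $$ (r, j)\<bar> \<le> \<bar>K\<bar> * b" for N
    proof -
      have "\<bar>B N $$ (r, j)\<bar> \<le> (\<Sum>j<n. \<bar>B N $$ (r, j)\<bar>)"
        by (rule member_le_sum) (use that in auto)
      also have "\<dots> \<le> K * (\<Sum>c<k + 2. \<bar>\<Sum>j<n. B N $$ (r, j) * Z $$ (j, c)\<bar>)"
        by (rule K[OF B(4)[OF that(1)]])
      also have "\<dots> = K * (\<Sum>c<k + 2. \<bar>y N $$ (r, c)\<bar>)"
        using yB[OF that(1)] by simp
      also have "\<dots> \<le> \<bar>K\<bar> * (\<Sum>c<k + 2. \<bar>y N $$ (r, c)\<bar>)"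
        by (intro mult_right_mono sum_nonneg) simp_all
      also have "\<dots> \<le> \<bar>K\<bar> * b" using b[of N] by (intro mult_left_mono) simp_all
      finally show ?thesis .
    qed
    then show ?thesis by blast
  qed
  have "\<exists>r l. strict_mono r \<and> (\<forall>i\<in>{..<k} \<times> {..<n}. (\<lambda>N. B (r N) $$ i) \<longlonglongrightarrow> l i)"
    by (rule bounded_coordinates_subseq) (use bounded in auto)
  then obtain \<phi> l where \<phi>: "strict_mono \<phi>"
    "\<And>r j. r < k \<Longrightarrow> j < n \<Longrightarrow> (\<lambda>N. B (\<phi> N) $$ (r, j)) \<longlonglongrightarrow> l (r, j)"
    by auto
  define L where "L = mat k n l"
  have Lc: "L \<in> carrier_mat k n" by (simp add: L_def)
  have limL: "(\<lambda>N. B (\<phi> N) $$ (r, j)) \<longlonglongrightarrow> L $$ (r, j)" if "r < k" "j < n" for r j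
    using \<phi>(2)[OF that] that by (simp add: L_def)
  have "y0 $$ (r, c) = (\<Sum>j<n. L $$ (r, j) * Z $$ (j, c))" if "r < k" "c < k + 2" for r c
  proof -
    have "(\<lambda>N. y (\<phi> N) $$ (r, c)) \<longlonglongrightarrow> y0 $$ (r, c)"
      using LIMSEQ_subseq_LIMSEQ[OF lim[OF that] \<phi>(1)] by (simp add: o_def)
    moreover have "(\<lambda>N. y (\<phi> N) $$ (r, c)) \<longlonglongrightarrow> (\<Sum>j<n. L $$ (r, j) * Z $$ (j, c))"
      unfolding yB[OF that] by (intro tendsto_sum tendsto_mult tendsto_const limL that) simp
    ultimately show ?thesis by (rule LIMSEQ_unique)
  qed
  then have "y0 $$ (r, c) = (L * Z) $$ (r, c)" if "r < k" "c < k + 2" for r c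
    using mult_entry[OF Lc Zc that] that by simp
  then have y0L: "y0 = L * Z" using y0c Lc Zc by (intro eq_matI) auto
  have L: "L \<in> full_rank_mats k n"
  proof (rule rows_independent_full_rank[OF Lc])
    show "rows_independent k n L"
      unfolding rows_independent_def
    proof (intro allI impI)
      fix x r assume x: "\<forall>j<n. (\<Sum>r<k. x r * L $$ (r, j)) = 0" "r < k"
      have "(\<Sum>r<k. x r * y0 $$ (r, c)) = 0" if "c < k + 2" for c
      proof -
        have "(\<Sum>r<k. x r * y0 $$ (r, c)) = (\<Sum>r<k. x r * (\<Sum>j<n. L $$ (r, j) * Z $$ (j, c)))"
          unfolding y0L using mult_entry[OF Lc Zc _ that] by simp
        also have "\<dots> = (\<Sum>j<n. (\<Sum>r<k. x r * L $$ (r, j)) * Z $$ (j, c))"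
          unfolding sum_distrib_left sum_distrib_right by (subst sum.swap) (simp add: mult_ac)
        also have "\<dots> = 0" using x(1) by simp
        finally show ?thesis .
      qed
      then show "x r = 0"
        using full_rank_iff_rows_independent[OF y0c] y0 x(2) unfolding rows_independent_def by blast
    qed
  qed
  show ?thesis
    unfolding y0L
  proof (rule same_sign_rowspan_in_amplituhedron[OF L Zc k])
    fix s s' assume s: "incr k n s" "incr k n s'"
    have conv: "(\<lambda>N. rdet k (\<lambda>a. column_vectors (B (\<phi> N)) (s a))) \<longlonglongrightarrow> rdet k (\<lambda>a. column_vectors L (s a))"
      if "incr k n s" for s
      by (rule tendsto_rdet) (intro limL incr_bound[OF that])
    have "(\<lambda>N. rdet k (\<lambda>a. column_vectors (B (\<phi> N)) (s a)) * rdet k (\<lambda>a. column_vectors (B (\<phi> N)) (s' a)))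
        \<longlonglongrightarrow> rdet k (\<lambda>a. column_vectors L (s a)) * rdet k (\<lambda>a. column_vectors L (s' a))"
      by (intro tendsto_mult conv s)
    then show "rdet k (\<lambda>a. column_vectors L (s a)) * rdet k (\<lambda>a. column_vectors L (s' a)) \<ge> 0"
      by (rule LIMSEQ_le_const) (use B(3)[OF s] in blast)
  qed
qed

theorem closedin_amplituhedron:
  assumes k: "k \<ge> 1" and kn: "k + 2 \<le> n" and Z: "Z \<in> pos_mats n (k + 2)"
  shows "closedin (grassmannian_topology k (k + 2)) (amplituhedron n k Z)"
  unfolding closedin_def topspace_grassmannian_topology
proof
  let ?F = "full_rank_mats k (k + 2)" and ?A = "amplituhedron n k Z" and ?G = "grassmannian k (k + 2)"
  have Zc: "Z \<in> carrier_mat n (k + 2)" using Z by (simp add: pos_mats_iff)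
  show "?A \<subseteq> ?G"
  proof
    fix Y assume "Y \<in> ?A"
    then obtain C where C: "C \<in> full_rank_mats k n" "nonneg_rows k n (column_vectors C)"
      "Y = rowspan (k + 2) (C * Z)" unfolding amplituhedron_eq[OF Zc] by blast
    show "Y \<in> ?G" unfolding grassmannian_def C(3)
      by (rule imageI) (rule nonneg_mult_full_rank[OF C(1,2) Z kn])
  qed
  show "openin (grassmannian_topology k (k + 2)) (?G - ?A)"
    unfolding openin_grassmannian_topology openin_full_rank_topology
  proof (intro conjI ballI)
    show "?G - ?A \<subseteq> ?G" "{C \<in> ?F. rowspan (k + 2) C \<in> ?G - ?A} \<subseteq> ?F" by blast+
    fix y0 assume y0: "y0 \<in> {C \<in> ?F. rowspan (k + 2) C \<in> ?G - ?A}"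
    show "\<exists>\<epsilon>>0. \<forall>C'\<in>?F. (\<forall>r<k. \<forall>c<k + 2. \<bar>C' $$ (r, c) - y0 $$ (r, c)\<bar> < \<epsilon>) \<longrightarrow>
        C' \<in> {C \<in> ?F. rowspan (k + 2) C \<in> ?G - ?A}"
    proof (rule ccontr)
      assume neg: "\<not> ?thesis"
      have "\<exists>y. y \<in> ?F \<and> rowspan (k + 2) y \<in> ?A \<and>
          (\<forall>r<k. \<forall>c<k + 2. \<bar>y $$ (r, c) - y0 $$ (r, c)\<bar> < 1 / real (Suc N))" for N
      proof -
        have "(0::real) < 1 / real (Suc N)" by simp
        then obtain y where y: "y \<in> ?F" "\<forall>r<k. \<forall>c<k + 2. \<bar>y $$ (r, c) - y0 $$ (r, c)\<bar> < 1 / real (Suc N)"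
          "y \<notin> {C \<in> ?F. rowspan (k + 2) C \<in> ?G - ?A}"
          using neg by blast
        moreover have "rowspan (k + 2) y \<in> ?G" unfolding grassmannian_def using y(1) by (rule imageI)
        ultimately show ?thesis by blast
      qed
      then obtain y where y: "\<And>N. y N \<in> ?F" "\<And>N. rowspan (k + 2) (y N) \<in> ?A"
        "\<And>N r c. r < k \<Longrightarrow> c < k + 2 \<Longrightarrow> \<bar>y N $$ (r, c) - y0 $$ (r, c)\<bar> < 1 / real (Suc N)"
        by metis
      have lim: "(\<lambda>N. y N $$ (r, c)) \<longlonglongrightarrow> y0 $$ (r, c)" if "r < k" "c < k + 2" for r c
      proof (rule LIM_zero_cancel, rule tendsto_rabs_zero_cancel,
          rule tendsto_sandwich[OF _ _ tendsto_const LIMSEQ_Suc[OF lim_inverse_n']])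
        show "\<forall>\<^sub>F N in sequentially. \<bar>y N $$ (r, c) - y0 $$ (r, c)\<bar> \<le> 1 / real (Suc N)"
          using y(3)[OF that] by (simp add: less_imp_le del: of_nat_Suc)
      qed simp
      have "y0 \<in> ?F" using y0 by simp
      then have "rowspan (k + 2) y0 \<in> ?A"
        by (rule amplituhedron_limit[OF k kn Z y(1,2) _ lim])
      then show False using y0 by simp
    qed
  qed
qed

section \<open>The chambers cover the amplituhedron\<close>

abbreviation row_vectors :: "real mat \<Rightarrow> nat \<Rightarrow> nat \<Rightarrow> real" where
  "row_vectors A \<equiv> \<lambda>i c. A $$ (i, c)"

lemma twistor_bracket:
  assumes "y \<in> carrier_mat k (k + 2)" "Z \<in> carrier_mat n (k + 2)" "i \<in> {1..n}" "j \<in> {1..n}"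
  shows "twistor k Z y i j = bracket k (row_vectors y) (row_vectors Z (i - 1)) (row_vectors Z (j - 1))"
proof -
  let ?rs = "rows y @ [row Z (i - 1), row Z (j - 1)]"
  have len: "length (rows y) = k" using assms(1) by simp
  have "mat_of_rows (k + 2) ?rs = mat (k + 2) (k + 2)
      (\<lambda>(a, c). (if a < k then row_vectors y a else if a = k then row_vectors Z (i - 1) else row_vectors Z (j - 1)) c)"
    (is "?L = ?R")
  proof (rule eq_matI)
    fix a c assume "a < dim_row ?R" "c < dim_col ?R"
    then have ac: "a < k + 2" "c < k + 2" by simp_all
    have zi: "row Z (i - 1) $ c = Z $$ (i - 1, c)" "row Z (j - 1) $ c = Z $$ (j - 1, c)"
      using assms(2-4) ac by auto
    consider "a < k" | "a = k" | "a = Suc k" using ac by linarith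
    then show "?L $$ (a, c) = ?R $$ (a, c)"
    proof cases
      case 1
      then show ?thesis using ac assms(1) len by (simp add: mat_of_rows_index nth_append)
    next
      case 2
      then show ?thesis using ac zi len by (simp add: mat_of_rows_index nth_append)
    next
      case 3
      then show ?thesis using ac zi len by (simp add: mat_of_rows_index nth_append)
    qed
  qed (use assms(1) in simp_all)
  then show ?thesis by (simp only: twistor_def bracket_def rdet_def)
qed

lemma Flip_cong:
  assumes "\<And>j. j \<in> {1..n} \<Longrightarrow> v j = w j"
  shows "Flip n v = Flip n w"
proof -
  have "i \<in> Flip n v \<longleftrightarrow> i \<in> Flip n w" for i
  proof (cases "i \<in> {1..n}")
    case True
    then have "i mod n + 1 \<in> {1..n}" by (simp add: Suc_le_eq)
    then show ?thesis
      unfolding Flip_def mem_Collect_eq by (simp only: assms[OF True] assms)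
  qed (auto simp: Flip_def)
  then show ?thesis by blast
qed

lemma Flip_scale:
  assumes "c \<noteq> 0"
  shows "Flip n (\<lambda>j. c * v j) = Flip n v"
  using assms by (simp add: Flip_def sgn_mult sgn_zero_iff)

text \<open>Scaling all brackets by \<open>\<langle>Y12\<rangle>\<close> makes \<open>\<langle>Y i i+1\<rangle>\<close> positive and affects neither flips nor the Pluecker
relations up to a common factor. So the signs of the brackets are those of a configuration of lines.\<close>

theorem generic_in_open_chamber:
  assumes k: "k \<ge> 1" and kn: "k + 2 \<le> n" and Z: "Z \<in> pos_mats n (k + 2)"
    and C: "C \<in> full_rank_mats k n" "pos_rows k n (column_vectors C)"
    and y: "y = C * Z"
    and nz: "\<And>i j. i < n \<Longrightarrow> j < n \<Longrightarrow> i \<noteq> j \<Longrightarrow>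
      bracket k (row_vectors y) (row_vectors Z i) (row_vectors Z j) \<noteq> 0"
  shows "\<exists>w \<in> D_perms (k + 1) n. rowspan (k + 2) y \<in> open_chamber n k Z w"
proof -
  have Zc: "Z \<in> carrier_mat n (k + 2)" and Zp: "pos_rows (k + 2) n (row_vectors Z)"
    using Z by (auto simp: pos_mats_iff)
  have Cc: "C \<in> carrier_mat k n" using C(1) by (rule full_rank_carrier)
  have nonneg: "nonneg_rows k n (column_vectors C)"
    using C(2) unfolding nonneg_rows_def pos_rows_def by (auto intro: less_imp_le)
  have yF: "y \<in> full_rank_mats k (k + 2)" unfolding y by (rule nonneg_mult_full_rank[OF C(1) nonneg Z kn])
  then have yc: "y \<in> carrier_mat k (k + 2)" by (rule full_rank_carrier)
  have yA: "rowspan (k + 2) y \<in> amplituhedron n k Z"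
    unfolding amplituhedron_eq[OF Zc] y using C(1) nonneg by (intro CollectI exI[of _ C] conjI refl)
  define b where "b i j = bracket k (row_vectors y) (row_vectors Z i) (row_vectors Z j)" for i j
  have y_entry: "row_vectors y r c = (\<Sum>j<n. column_vectors C j r * row_vectors Z j c)"
    if "r < k" "c < k + 2" for r c
    unfolding y by (rule mult_entry[OF Cc Zc that])
  have bnz: "b i j \<noteq> 0" if "i < n" "j < n" "i \<noteq> j" for i j unfolding b_def by (rule nz[OF that])
  have step: "b 0 1 * b i (Suc i) > 0" if "Suc i < n" for i
    by (rule bracket_signs(1)[where y = "row_vectors y" and d = b, OF C(2) Zp kn];
        simp add: y_entry b_def nz that)
  have wrap: "(-1) ^ k * (b 0 1 * b 0 (n - 1)) > 0"
    by (rule bracket_signs(2)[where y = "row_vectors y" and d = b, OF C(2) Zp kn];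
        simp add: y_entry b_def nz)
  have flips: "card {j. 1 \<le> j \<and> Suc j < n \<and> b 0 j * b 0 (Suc j) < 0} = k"
    by (rule bracket_signs(3)[where y = "row_vectors y" and d = b, OF C(2) Zp kn];
        simp add: y_entry b_def nz)
  define \<sigma> where "\<sigma> = b 0 1"
  have \<sigma>: "\<sigma> \<noteq> 0" unfolding \<sigma>_def using kn by (intro bnz) auto
  \<comment> \<open>The labels start at \<open>1\<close> and the rows of \<open>Z\<close> at \<open>0\<close>.\<close>
  define d where "d i j = \<sigma> * b (i - 1) (j - 1)" for i j
  have "\<exists>w \<in> D_perms (k + 1) n. \<forall>a \<in> {1..n}.
    Flip n (\<lambda>j. if j < a then (-1) ^ (k + 1) * d a j else d a j) = I_set n w a - {a}"
  proof (rule chamber_word_exists)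
    show "n \<ge> 3" using k kn by simp
    show "d i j = - d j i" for i j
      unfolding d_def b_def by (subst bracket_antisym) simp
    show "d i j \<noteq> 0" if "i \<in> {1..n}" "j \<in> {1..n}" "i \<noteq> j" for i j
    proof -
      have "b (i - 1) (j - 1) \<noteq> 0" using that by (intro bnz) auto
      then show ?thesis using \<sigma> by (simp add: d_def)
    qed
    show "d 1 2 * d i j = d 1 i * d 2 j - d 1 j * d 2 i" for i j
    proof -
      have "b 0 1 * b (i - 1) (j - 1) - b 0 (i - 1) * b 1 (j - 1) + b 0 (j - 1) * b 1 (i - 1) = 0"
        unfolding b_def by (rule bracket_pluecker)
      then have "\<sigma> * \<sigma> * (b 0 1 * b (i - 1) (j - 1)) = \<sigma> * \<sigma> * (b 0 (i - 1) * b 1 (j - 1) - b 0 (j - 1) * b 1 (i - 1))"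
        by simp
      then show ?thesis by (simp add: d_def algebra_simps)
    qed
    show "d i (i + 1) > 0" if "1 \<le> i" "i < n" for i
    proof -
      have Suc_pred: "Suc (i - 1) = i" using that by linarith
      then have "Suc (i - 1) < n" using that by simp
      then have "b 0 1 * b (i - 1) (Suc (i - 1)) > 0" by (rule step)
      then show ?thesis unfolding Suc_pred by (simp add: d_def \<sigma>_def)
    qed
    show "(-1) ^ k * d 1 n > 0" using wrap by (simp add: d_def \<sigma>_def)
    let ?L = "{i. 2 \<le> i \<and> i < n \<and> d 1 i * d 1 (i + 1) < 0}"
    let ?R = "{j. 1 \<le> j \<and> Suc j < n \<and> b 0 j * b 0 (Suc j) < 0}"
    have mem: "Suc j \<in> ?L \<longleftrightarrow> j \<in> ?R" for j
    proof -
      have "d 1 (Suc j) * d 1 (Suc j + 1) = (\<sigma> * \<sigma>) * (b 0 j * b 0 (Suc j))"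
        by (simp add: d_def mult_ac)
      then have "d 1 (Suc j) * d 1 (Suc j + 1) < 0 \<longleftrightarrow> b 0 j * b 0 (Suc j) < 0"
        by (simp only: pos_mult_less_0[OF real_square_pos[OF \<sigma>]])
      moreover have "2 \<le> Suc j \<longleftrightarrow> 1 \<le> j" by linarith
      ultimately show ?thesis by (simp only: mem_Collect_eq)
    qed
    have "?L = Suc ` ?R"
    proof (rule equalityI; rule subsetI)
      fix i assume i: "i \<in> ?L"
      then obtain j where "i = Suc j" by (cases i) simp_all
      then show "i \<in> Suc ` ?R" using i mem by (simp only: imageI)
    next
      fix i assume "i \<in> Suc ` ?R"
      then obtain j where "i = Suc j" "j \<in> ?R" by (rule imageE)
      then show "i \<in> ?L" using mem by (simp only:)
    qed
    then show "card {i. 2 \<le> i \<and> i < n \<and> d 1 i * d 1 (i + 1) < 0} = k"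
      using flips by (simp add: card_image)
  qed
  then obtain w where w: "w \<in> D_perms (k + 1) n"
    "\<And>a. a \<in> {1..n} \<Longrightarrow> Flip n (\<lambda>j. if j < a then (-1) ^ (k + 1) * d a j else d a j) = I_set n w a - {a}"
    by blast
  have tw: "twistor k Z y i j = b (i - 1) (j - 1)" if "i \<in> {1..n}" "j \<in> {1..n}" for i j
    unfolding b_def by (rule twistor_bracket[OF yc Zc that])
  have "rowspan (k + 2) y \<in> open_chamber n k Z w"
    unfolding open_chamber_def
  proof (intro CollectI conjI yA bexI[of _ y] yF refl ballI impI)
    fix i j assume ij: "i \<in> {1..n}" "j \<in> {1..n}" "i \<noteq> j"
    have "b (i - 1) (j - 1) \<noteq> 0" using ij by (intro bnz) auto
    then show "twistor k Z y i j \<noteq> 0" using tw[OF ij(1,2)] by simp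
  next
    fix a assume a: "a \<in> {1..n}"
    let ?v = "\<lambda>j. if j < a then twistor_hat k Z y a j else twistor k Z y a j"
    have "Flip n ?v = Flip n (\<lambda>j. \<sigma> * ?v j)" by (rule Flip_scale[OF \<sigma>, symmetric])
    also have "\<dots> = Flip n (\<lambda>j. if j < a then (-1) ^ (k + 1) * d a j else d a j)"
    proof (rule Flip_cong)
      fix j assume "j \<in> {1..n}"
      then show "\<sigma> * ?v j = (if j < a then (-1) ^ (k + 1) * d a j else d a j)"
        using tw[OF a] by (simp add: twistor_hat_def d_def)
    qed
    also have "\<dots> = I_set n w a - {a}" by (rule w(2)[OF a])
    finally show "Flip n ?v = I_set n w a - {a}" .
  qed
  then show ?thesis using w(1) by (rule bexI)
qed

text \<open>A nonnegative \<open>C\<close> is moved twice, first to a positive and then to a generic matrix; by continuity of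
the product with \<open>Z\<close> the image stays in any given neighbourhood.\<close>

theorem amplituhedron_subset_closure:
  assumes k: "k \<ge> 1" and kn: "k + 2 \<le> n" and Z: "Z \<in> pos_mats n (k + 2)"
  shows "amplituhedron n k Z \<subseteq>
    grassmannian_topology k (k + 2) closure_of (\<Union>w \<in> D_perms (k + 1) n. open_chamber n k Z w)"
proof
  have Zc: "Z \<in> carrier_mat n (k + 2)" and Zp: "pos_rows (k + 2) n (row_vectors Z)"
    using Z by (auto simp: pos_mats_iff)
  fix Y assume YA: "Y \<in> amplituhedron n k Z"
  then obtain C where C: "C \<in> full_rank_mats k n" "nonneg_rows k n (column_vectors C)"
    "Y = rowspan (k + 2) (C * Z)" unfolding amplituhedron_eq[OF Zc] by blast
  have Cc: "C \<in> carrier_mat k n" using C(1) by (rule full_rank_carrier)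
  have yF: "C * Z \<in> full_rank_mats k (k + 2)" by (rule nonneg_mult_full_rank[OF C(1,2) Z kn])
  obtain s where s: "incr k n s" "rdet k (\<lambda>a. column_vectors C (s a)) > 0"
    using nonneg_full_rank_pos_minor[OF C(1,2)] by blast
  show "Y \<in> grassmannian_topology k (k + 2) closure_of (\<Union>w \<in> D_perms (k + 1) n. open_chamber n k Z w)"
    unfolding in_closure_of
  proof (intro conjI allI impI)
    show "Y \<in> topspace (grassmannian_topology k (k + 2))"
      unfolding topspace_grassmannian_topology grassmannian_def C(3) using yF by (rule imageI)
    fix T assume T: "Y \<in> T \<and> openin (grassmannian_topology k (k + 2)) T"
    let ?U = "{y \<in> full_rank_mats k (k + 2). rowspan (k + 2) y \<in> T}"
    have "openin (full_rank_topology k (k + 2)) ?U" "C * Z \<in> ?U"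
      using T yF C(3) by (simp_all add: openin_grassmannian_topology)
    obtain \<epsilon> where \<epsilon>: "\<epsilon> > 0" "\<And>y. y \<in> full_rank_mats k (k + 2) \<Longrightarrow>
        \<forall>r<k. \<forall>c<k + 2. \<bar>y $$ (r, c) - (C * Z) $$ (r, c)\<bar> < \<epsilon> \<Longrightarrow> y \<in> ?U"
    proof -
      have "\<forall>C \<in> ?U. \<exists>\<epsilon>>0. \<forall>y \<in> full_rank_mats k (k + 2).
          (\<forall>r<k. \<forall>c<k + 2. \<bar>y $$ (r, c) - C $$ (r, c)\<bar> < \<epsilon>) \<longrightarrow> y \<in> ?U"
        using \<open>openin (full_rank_topology k (k + 2)) ?U\<close> unfolding openin_full_rank_topology
        by (rule conjunct2)
      from bspec[OF this \<open>C * Z \<in> ?U\<close>] show thesis using that by (elim exE conjE) (simp only:)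
    qed
    define z where "z = (\<Sum>j<n. \<Sum>c<k + 2. \<bar>Z $$ (j, c)\<bar>)"
    have z: "z \<ge> 0" unfolding z_def by (intro sum_nonneg) simp
    \<comment> \<open>Each perturbation changes an entry of \<open>C\<close> by less than \<open>\<delta>\<close>, so the two together change an entry
      of \<open>C Z\<close> by at most \<open>2 \<delta> z\<close>.\<close>
    define \<delta> where "\<delta> = \<epsilon> / (2 * (1 + z))"
    have \<delta>: "\<delta> > 0" using \<epsilon>(1) z by (simp add: \<delta>_def)
    obtain M1 where M1: "\<forall>i. \<forall>r<k. \<bar>M1 i r - C $$ (r, i)\<bar> < \<delta>" "pos_rows k n M1"
      using nonneg_rows_perturb[OF C(2) s \<delta>] by blast
    let ?S = "{(i, j). i < n \<and> j < n \<and> i \<noteq> j}"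
    have "finite ?S" by (rule finite_subset[of _ "{..<n} \<times> {..<n}"]) auto
    from generic_perturb[OF M1(2) Zp kn \<delta> this order_refl] obtain M
      where M: "\<forall>m<n. \<forall>r<k. \<bar>M m r - M1 m r\<bar> < \<delta>" "pos_rows k n M"
      "\<forall>(i, j) \<in> ?S. bracket k (image_rows n (row_vectors Z) M) (row_vectors Z i) (row_vectors Z j) \<noteq> 0"
      by (elim exE conjE) (rule that)
    define C' where "C' = mat k n (\<lambda>(r, j). M j r)"
    have C'c: "C' \<in> carrier_mat k n" by (simp add: C'_def)
    have C'M: "C' $$ (r, j) = M j r" if "r < k" "j < n" for r j using that by (simp add: C'_def)
    have pos': "pos_rows k n (column_vectors C')"
      unfolding pos_rows_def
    proof (intro allI impI)
      fix s assume s: "incr k n s"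
      have "rdet k (\<lambda>a. column_vectors C' (s a)) = rdet k (\<lambda>a. M (s a))"
        using C'M incr_bound[OF s] by (intro rdet_cong) simp
      then show "rdet k (\<lambda>a. column_vectors C' (s a)) > 0" using M(2) s by (simp add: pos_rows_def)
    qed
    have C'F: "C' \<in> full_rank_mats k n"
    proof (rule rows_independent_full_rank[OF C'c], rule minor_rows_independent[OF s(1)])
      have "rdet k (\<lambda>a. column_vectors C' (s a)) > 0" using pos' s(1) unfolding pos_rows_def by blast
      then show "rdet k (\<lambda>a. column_vectors C' (s a)) \<noteq> 0" by simp
    qed
    have nonneg': "nonneg_rows k n (column_vectors C')"
      using pos' unfolding nonneg_rows_def pos_rows_def by (auto intro: less_imp_le)
    have y'F: "C' * Z \<in> full_rank_mats k (k + 2)" by (rule nonneg_mult_full_rank[OF C'F nonneg' Z kn])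
    have y'_entry: "(C' * Z) $$ (r, c) = image_rows n (row_vectors Z) M r c" if "r < k" "c < k + 2" for r c
      using mult_entry[OF C'c Zc that] C'M[OF that(1)] by simp
    have "\<exists>w \<in> D_perms (k + 1) n. rowspan (k + 2) (C' * Z) \<in> open_chamber n k Z w"
    proof (rule generic_in_open_chamber[OF k kn Z C'F pos' refl])
      fix i j assume "i < n" "j < n" "i \<noteq> j"
      then have "bracket k (image_rows n (row_vectors Z) M) (row_vectors Z i) (row_vectors Z j) \<noteq> 0"
        using M(3) by auto
      moreover have "bracket k (row_vectors (C' * Z)) (row_vectors Z i) (row_vectors Z j)
          = bracket k (image_rows n (row_vectors Z) M) (row_vectors Z i) (row_vectors Z j)"
        unfolding bracket_def using y'_entry by (intro rdet_cong) simp
      ultimately show "bracket k (row_vectors (C' * Z)) (row_vectors Z i) (row_vectors Z j) \<noteq> 0" by simp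
    qed
    moreover
    have "C' * Z \<in> ?U"
    proof (rule \<epsilon>(2)[OF y'F], intro allI impI)
      fix r c assume rc: "r < k" "c < k + 2"
      have near: "\<bar>C' $$ (r, j) - C $$ (r, j)\<bar> \<le> 2 * \<delta>" if "j < n" for j
      proof -
        have "\<bar>M j r - M1 j r\<bar> < \<delta>" "\<bar>M1 j r - C $$ (r, j)\<bar> < \<delta>"
          using M(1) M1(1) that rc(1) by blast+
        then show ?thesis using C'M[OF rc(1) that] by simp
      qed
      have "(C' * Z) $$ (r, c) - (C * Z) $$ (r, c) = (\<Sum>j<n. (C' $$ (r, j) - C $$ (r, j)) * Z $$ (j, c))"
        unfolding mult_entry[OF C'c Zc rc] mult_entry[OF Cc Zc rc]
        by (simp add: sum_subtractf left_diff_distrib)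
      also have "\<bar>\<dots>\<bar> \<le> (\<Sum>j<n. \<bar>(C' $$ (r, j) - C $$ (r, j)) * Z $$ (j, c)\<bar>)" by (rule sum_abs)
      also have "\<dots> \<le> (\<Sum>j<n. 2 * \<delta> * (\<Sum>c<k + 2. \<bar>Z $$ (j, c)\<bar>))"
      proof (rule sum_mono)
        fix j assume "j \<in> {..<n}"
        then have "\<bar>C' $$ (r, j) - C $$ (r, j)\<bar> \<le> 2 * \<delta>" using near by simp
        moreover have "\<bar>Z $$ (j, c)\<bar> \<le> (\<Sum>c<k + 2. \<bar>Z $$ (j, c)\<bar>)"
          by (rule member_le_sum) (use rc in auto)
        ultimately show "\<bar>(C' $$ (r, j) - C $$ (r, j)) * Z $$ (j, c)\<bar> \<le> 2 * \<delta> * (\<Sum>c<k + 2. \<bar>Z $$ (j, c)\<bar>)"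
          unfolding abs_mult using \<delta> by (intro mult_mono) simp_all
      qed
      also have "\<dots> = 2 * \<delta> * z" unfolding z_def by (rule sum_distrib_left[symmetric])
      also have "\<dots> < \<epsilon>" using \<epsilon>(1) z by (simp add: \<delta>_def field_simps)
      finally show "\<bar>(C' * Z) $$ (r, c) - (C * Z) $$ (r, c)\<bar> < \<epsilon>" .
    qed
    then have "rowspan (k + 2) (C' * Z) \<in> T" by (simp only: mem_Collect_eq)
    ultimately show "\<exists>y. y \<in> (\<Union>w \<in> D_perms (k + 1) n. open_chamber n k Z w) \<and> y \<in> T"
      by (intro exI[of _ "rowspan (k + 2) (C' * Z)"]) (simp only: UN_iff simp_thms)
  qed
qed

theorem theorem10p10:
  fixes k n :: nat and Z :: "real mat"
  assumes "k \<ge> 1" and "n \<ge> 1" and "k + 2 \<le> n" and "Z \<in> pos_mats n (k + 2)"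
  shows "amplituhedron n k Z = (\<Union>w \<in> D_perms (k + 1) n. closed_chamber n k Z w)"
proof -
  let ?T = "grassmannian_topology k (k + 2)" and ?D = "D_perms (k + 1) n"
  have "finite ?D" unfolding D_perms_def by simp
  then have "?T closure_of (\<Union>w \<in> ?D. open_chamber n k Z w) = (\<Union>w \<in> ?D. closed_chamber n k Z w)"
    unfolding closed_chamber_def by (subst closure_of_Union) auto
  moreover have "amplituhedron n k Z \<subseteq> ?T closure_of (\<Union>w \<in> ?D. open_chamber n k Z w)"
    by (rule amplituhedron_subset_closure[OF assms(1,3,4)])
  moreover have "?T closure_of (\<Union>w \<in> ?D. open_chamber n k Z w) \<subseteq> amplituhedron n k Z"
    by (rule closure_of_minimal[OF _ closedin_amplituhedron[OF assms(1,3,4)]])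
      (auto simp: open_chamber_def)
  ultimately show ?thesis by blast
qed

end
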